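(* Let $w=w_{75}$ be the Atkin-Lehner involution of $X_0(75)$ attached to $75$. There exist $x,y,t\in\mathbb{Q}(X_0(75))$ such that $\mathbb{Q}(X_0(75))=\mathbb{Q}(x,y,t)$, the subfield of functions invariant under $w^*$ is $\mathbb{Q}(x,y)$, $w^*(t)=-t$, and $$y^2+xy+y=x^3+x^2,$$ $$t^2=-99-390x-569x^2-372x^3-67x^4+56x^5+40x^6+11x^7+x^8-3x(2+x)(-2-4x+3x^2+5x^3+2x^4)y.$$ In particular these two equations are equations for $X_0(75)$ over $\mathbb{Q}$ (up to birational equivalence over $\mathbb{Q}$).
   Context: $X_0(N)$ denotes the smooth projective curve over $\mathbb{Q}$ attached to $\Gamma_0(N)$, where $\mathbb{Q}(X_0(N))$ is the subfield of $\mathbb{C}(X_0(N))$ of functions with rational $q$-expansion at the cusp $\infty$, $q=e^{2\pi i z}$. For a positive divisor $d$ of $N$ coprime to $N/d$, the Atkin-Lehner involution $w_d$ of $X_0(N)$ is induced by any matrix $\frac{1}{\sqrt d}\begin{pmatrix} A d & B\\ N C & D d\end{pmatrix}$ of determinant $1$ with $A,B,C,D\in\mathbb{Z}$; it is defined over $\mathbb{Q}$. *)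

theory Defs
  imports
    "HOL-Complex_Analysis.Complex_Analysis"
    "HOL-Computational_Algebra.Polynomial"
    "HOL-Algebra.QuotRing"
    "HOL-Algebra.Generated_Fields"
    "HOL-Algebra.Algebraic_Closure_Type"
begin

section \<open>Meromorphic functions on the upper half plane\<close>

definition uhp :: "complex set" where
  "uhp = {z. Im z > 0}"

lemma open_uhp [simp, intro]: "open uhp"
  by (simp add: uhp_def open_halfspace_Im_gt)

lemma connected_uhp [simp, intro]: "connected uhp"
  unfolding uhp_def by (intro convex_connected convex_halfspace_Im_gt)

lemma uhp_nonempty [simp]: "uhp \<noteq> {}"
  by (auto simp: uhp_def intro: exI[of _ \<i>])

lemma not_eventually_False_uhp [simp]: "\<not> (\<forall>\<^sub>\<approx>z\<in>uhp. False)"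
  by (simp add: eventually_False)

text \<open>
  Functions in HOL are total, so the values at poles are irrelevant: meromorphic functions
  are identified when they agree outside a set without limit points in the half plane.
\<close>

definition mero_eq :: "(complex \<Rightarrow> complex) \<Rightarrow> (complex \<Rightarrow> complex) \<Rightarrow> bool" where
  "mero_eq f g \<longleftrightarrow> f meromorphic_on uhp \<and> g meromorphic_on uhp \<and> (\<forall>\<^sub>\<approx>z\<in>uhp. f z = g z)"

quotient_type mero = "complex \<Rightarrow> complex" / partial: mero_eq
proof (rule part_equivpI)
  show "\<exists>f. mero_eq f f"
    by (rule exI[of _ "\<lambda>_. 0"]) (auto simp: mero_eq_def)
  show "symp mero_eq"
    by (auto simp: symp_def mero_eq_def elim: eventually_mono)
  show "transp mero_eq"
    by (auto simp: transp_def mero_eq_def elim: eventually_elim2)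
qed

instantiation mero :: Fields.field
begin

lift_definition zero_mero :: mero is "\<lambda>_. 0"
  by (auto simp: mero_eq_def)

lift_definition one_mero :: mero is "\<lambda>_. 1"
  by (auto simp: mero_eq_def)

lift_definition uminus_mero :: "mero \<Rightarrow> mero" is "\<lambda>f z. - f z"
  by (auto simp: mero_eq_def intro!: meromorphic_intros elim: eventually_mono)

lift_definition plus_mero :: "mero \<Rightarrow> mero \<Rightarrow> mero" is "\<lambda>f g z. f z + g z"
  by (auto simp: mero_eq_def intro!: meromorphic_intros elim: eventually_elim2)

lift_definition minus_mero :: "mero \<Rightarrow> mero \<Rightarrow> mero" is "\<lambda>f g z. f z - g z"
  by (auto simp: mero_eq_def intro!: meromorphic_intros elim: eventually_elim2)

lift_definition times_mero :: "mero \<Rightarrow> mero \<Rightarrow> mero" is "\<lambda>f g z. f z * g z"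
  by (auto simp: mero_eq_def intro!: meromorphic_intros elim: eventually_elim2)

lift_definition inverse_mero :: "mero \<Rightarrow> mero" is "\<lambda>f z. inverse (f z)"
  by (auto simp: mero_eq_def intro!: meromorphic_intros elim: eventually_mono)

lift_definition divide_mero :: "mero \<Rightarrow> mero \<Rightarrow> mero" is "\<lambda>f g z. f z / g z"
  by (auto simp: mero_eq_def intro!: meromorphic_intros elim: eventually_elim2)

instance
proof
  fix f g h :: mero
  show "f + g + h = f + (g + h)" "f + g = g + f" "0 + f = f" "- f + f = 0" "f - g = f + - g"
       "f * g * h = f * (g * h)" "f * g = g * f" "1 * f = f" "(f + g) * h = f * h + g * h"
       "f div g = f * inverse g"
    by (transfer; auto simp: mero_eq_def field_simps intro!: meromorphic_intros)+
  show "(0 :: mero) \<noteq> 1"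
    by transfer (auto simp: mero_eq_def)
  show "inverse (0 :: mero) = 0"
    by transfer (auto simp: mero_eq_def)
  show "inverse f * f = 1" if "f \<noteq> 0"
    using that
  proof transfer
    fix F assume F: "mero_eq F F" "\<not> mero_eq F (\<lambda>_. 0)"
    hence mero: "F meromorphic_on uhp" and nz: "\<not> (\<forall>\<^sub>\<approx>z\<in>uhp. F z = 0)"
      by (auto simp: mero_eq_def)
    have "\<forall>\<^sub>\<approx>z\<in>uhp. F z \<noteq> 0"
      using meromorphic_imp_constant_or_avoid[OF mero, of 0] nz by auto
    thus "mero_eq (\<lambda>z. inverse (F z) * F z) (\<lambda>_. 1)"
      using mero by (auto simp: mero_eq_def intro!: meromorphic_intros elim!: eventually_mono)
  qed
qed

end

instance mero :: field_char_0
proof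
  show "inj (of_nat :: nat \<Rightarrow> mero)"
  proof
    fix m n :: nat
    have *: "mero_eq (\<lambda>_. of_nat k) (\<lambda>_. of_nat k)" for k
      by (auto simp: mero_eq_def)
    have of_nat_mero: "(of_nat k :: mero) = abs_mero (\<lambda>_. of_nat k)" for k
    proof (induction k)
      case 0
      show ?case by (simp add: zero_mero_def)
    next
      case (Suc k)
      have "(of_nat (Suc k) :: mero) = 1 + abs_mero (\<lambda>_. of_nat k)"
        by (simp add: Suc)
      also have "\<dots> = abs_mero (\<lambda>_. of_nat (Suc k))"
        unfolding one_mero_def by (subst plus_mero.abs_eq) (auto simp: mero_eq_def)
      finally show ?case .
    qed
    assume "(of_nat m :: mero) = of_nat n"
    hence "mero_eq (\<lambda>_. of_nat m) (\<lambda>_. of_nat n)"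
      using * Quotient_rel[OF Quotient_mero] unfolding of_nat_mero by metis
    thus "m = n"
      by (cases "m = n") (auto simp: mero_eq_def)
  qed
qed


section \<open>Integer matrices of positive determinant acting on functions\<close>

definition moebius_transform :: "int \<Rightarrow> int \<Rightarrow> int \<Rightarrow> int \<Rightarrow> complex \<Rightarrow> complex" where
  "moebius_transform a b c d z = (of_int a * z + of_int b) / (of_int c * z + of_int d)"

lemma moebius_transform_denom_nonzero:
  assumes "a * d - b * c > (0 :: int)" "z \<in> uhp"
  shows   "of_int c * z + of_int d \<noteq> (0 :: complex)"
proof
  assume *: "of_int c * z + of_int d = (0 :: complex)"
  from arg_cong[OF *, of Im] have "c = 0"
    using assms(2) by (auto simp: uhp_def)
  with * have "d = 0" by simp
  with \<open>c = 0\<close> assms(1) show False by simp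
qed

lemma Im_moebius_transform:
  "Im (moebius_transform a b c d z) = of_int (a * d - b * c) * Im z / (cmod (of_int c * z + of_int d))\<^sup>2"
  unfolding moebius_transform_def Im_divide cmod_power2 by (simp add: algebra_simps)

lemma moebius_transform_in_uhp:
  assumes "a * d - b * c > 0" "z \<in> uhp"
  shows   "moebius_transform a b c d z \<in> uhp"
proof -
  have "0 < of_int (a * d - b * c) * Im z / (cmod (of_int c * z + of_int d))\<^sup>2"
    using assms moebius_transform_denom_nonzero[OF assms] 
    by (intro divide_pos_pos mult_pos_pos) (auto simp: uhp_def simp del: of_int_diff of_int_mult)
  thus ?thesis
    unfolding Im_moebius_transform[symmetric] by (simp add: uhp_def)
qed

lemma moebius_transform_inj:
  assumes "a * d - b * c > 0" "z \<in> uhp" "w \<in> uhp" "moebius_transform a b c d z = moebius_transform a b c d w"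
  shows   "z = w"
proof -
  have nz: "of_int c * z + of_int d \<noteq> (0 :: complex)" "of_int c * w + of_int d \<noteq> (0 :: complex)"
    using moebius_transform_denom_nonzero assms by blast+
  have "(of_int a * z + of_int b) * (of_int c * w + of_int d) =
        (of_int a * w + of_int b) * (of_int c * z + of_int d)"
    using assms(4) nz by (simp add: moebius_transform_def frac_eq_eq)
  hence "of_int (a * d - b * c) * (z - w) = 0"
    by (simp add: algebra_simps)
  thus ?thesis using assms(1) by (simp del: of_int_diff of_int_mult)
qed

lemma moebius_transform_analytic:
  assumes "a * d - b * c > 0"
  shows   "moebius_transform a b c d analytic_on uhp"
  unfolding moebius_transform_def [abs_def]
  by (intro analytic_intros) (use moebius_transform_denom_nonzero[OF assms] in auto)

lemma moebius_transform_comp: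
  assumes "a * d - b * c > 0" "z \<in> uhp"
  shows   "moebius_transform a' b' c' d' (moebius_transform a b c d z) =
             moebius_transform (a' * a + b' * c) (a' * b + b' * d) (c' * a + d' * c) (c' * b + d' * d) z"
proof -
  define q where "q = of_int c * z + (of_int d :: complex)"
  have q: "q \<noteq> 0"
    using moebius_transform_denom_nonzero[OF assms] by (simp add: q_def)
  have "moebius_transform a' b' c' d' (moebius_transform a b c d z) =
          ((of_int a' * ((of_int a * z + of_int b) / q) + of_int b') * q) /
          ((of_int c' * ((of_int a * z + of_int b) / q) + of_int d') * q)"
    using q by (simp add: moebius_transform_def q_def)
  also have "(of_int a' * ((of_int a * z + of_int b) / q) + of_int b') * q =
             of_int a' * (of_int a * z + of_int b) + of_int b' * q"
    using q by (simp add: ring_distribs)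
  also have "(of_int c' * ((of_int a * z + of_int b) / q) + of_int d') * q =
             of_int c' * (of_int a * z + of_int b) + of_int d' * q"
    using q by (simp add: ring_distribs)
  finally show ?thesis
    by (simp add: moebius_transform_def q_def algebra_simps)
qed

text \<open>
  \<open>pullback a b c d f\<close> is the function sending \<open>z\<close> to \<open>f ((a z + b) / (c z + d))\<close>. A matrix whose
  determinant is not positive does not preserve the half plane; the value is then \<open>0\<close> by convention.
\<close>

lift_definition pullback :: "int \<Rightarrow> int \<Rightarrow> int \<Rightarrow> int \<Rightarrow> mero \<Rightarrow> mero" is
  "\<lambda>a b c d f. if a * d - b * c > 0 then (\<lambda>z. f (moebius_transform a b c d z)) else (\<lambda>_. 0)"
proof -
  fix a b c d :: int and f g :: "complex \<Rightarrow> complex"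
  assume fg: "mero_eq f g"
  show "mero_eq (if a * d - b * c > 0 then (\<lambda>z. f (moebius_transform a b c d z)) else (\<lambda>_. 0))
                (if a * d - b * c > 0 then (\<lambda>z. g (moebius_transform a b c d z)) else (\<lambda>_. 0))"
  proof (cases "a * d - b * c > 0")
    case det: True
    have mero: "(\<lambda>z. h (moebius_transform a b c d z)) meromorphic_on uhp" if "h meromorphic_on uhp" for h
      by (rule meromorphic_on_compose[OF that moebius_transform_analytic[OF det]])
         (use moebius_transform_in_uhp[OF det] in auto)
    have "\<forall>\<^sub>\<approx>z\<in>uhp. f (moebius_transform a b c d z) = g (moebius_transform a b c d z)"
      unfolding eventually_cosparse_open_eq[OF open_uhp]
    proof
      fix z assume z: "z \<in> uhp"
      have ev: "eventually (\<lambda>w. f w = g w) (at (moebius_transform a b c d z))"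
        using fg moebius_transform_in_uhp[OF det z]
        by (auto simp: mero_eq_def eventually_cosparse_open_eq)
      have "isCont (moebius_transform a b c d) z"
        using moebius_transform_analytic[OF det] z by (meson analytic_at_imp_isCont analytic_on_analytic_at)
      moreover have "eventually (\<lambda>w. w \<in> uhp - {z}) (at z)"
        using z by (intro eventually_at_in_open) auto
      hence "eventually (\<lambda>w. moebius_transform a b c d w \<noteq> moebius_transform a b c d z) (at z)"
        by eventually_elim (use moebius_transform_inj[OF det] z in auto)
      ultimately have "filterlim (moebius_transform a b c d) (at (moebius_transform a b c d z)) (at z)"
        by (auto simp: filterlim_at isCont_def)
      thus "eventually (\<lambda>w. f (moebius_transform a b c d w) = g (moebius_transform a b c d w)) (at z)"
        using ev unfolding filterlim_iff by blast
    qed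
    thus ?thesis
      using fg det mero by (auto simp: mero_eq_def)
  qed (auto simp: mero_eq_def)
qed

lemma pullback_pullback:
  assumes "a * d - b * c > 0" "a' * d' - b' * c' > 0"
  shows "pullback a b c d (pullback a' b' c' d' f) =
           pullback (a' * a + b' * c) (a' * b + b' * d) (c' * a + d' * c) (c' * b + d' * d) f"
proof -
  have "(a' * a + b' * c) * (c' * b + d' * d) - (a' * b + b' * d) * (c' * a + d' * c) =
          (a' * d' - b' * c') * (a * d - b * c)"
    by (simp add: algebra_simps)
  hence det: "(a' * a + b' * c) * (c' * b + d' * d) - (a' * b + b' * d) * (c' * a + d' * c) > 0"
    using assms by simp
  show ?thesis
    using assms det
  proof (transfer fixing: a b c d a' b' c' d')
    fix F assume F: "mero_eq F F"
    define G where "G = (\<lambda>z. F (moebius_transform a' b' c' d' (moebius_transform a b c d z)))"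
    define G' where "G' = (\<lambda>z. F (moebius_transform (a' * a + b' * c) (a' * b + b' * d)
                                  (c' * a + d' * c) (c' * b + d' * d) z))"
    have eq: "G z = G' z" if "z \<in> uhp" for z
      using moebius_transform_comp[OF assms(1) that] by (simp add: G_def G'_def)
    have "G' meromorphic_on uhp"
      unfolding G'_def
      by (rule meromorphic_on_compose[OF _ moebius_transform_analytic[OF det]])
         (use moebius_transform_in_uhp[OF det] F in \<open>auto simp: mero_eq_def\<close>)
    moreover have ev: "\<forall>\<^sub>\<approx>z\<in>uhp. G z = G' z"
      using eventually_in_cosparse[of uhp uhp] by (auto elim!: eventually_mono simp: eq)
    moreover have "G meromorphic_on uhp \<longleftrightarrow> G' meromorphic_on uhp"
      by (intro meromorphic_on_cong') (use ev in auto)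
    ultimately have "mero_eq G G'"
      by (auto simp: mero_eq_def)
    thus "mero_eq
           (if a * d - b * c > 0
            then (\<lambda>z. (if a' * d' - b' * c' > 0 then (\<lambda>z. F (moebius_transform a' b' c' d' z)) else (\<lambda>_. 0))
                     (moebius_transform a b c d z)) else (\<lambda>_. 0))
           (if (a' * a + b' * c) * (c' * b + d' * d) - (a' * b + b' * d) * (c' * a + d' * c) > 0
            then (\<lambda>z. F (moebius_transform (a' * a + b' * c) (a' * b + b' * d) (c' * a + d' * c)
                           (c' * b + d' * d) z))
            else (\<lambda>_. 0))"
      using assms det by (simp add: G_def G'_def)
  qed
qed


section \<open>The function field of the modular curve\<close>

text \<open>
  \<open>L\<close> is the expansion of \<open>f\<close> in powers of \<open>exp (2 \<pi> i z / h)\<close>; the existence of some \<open>L\<close> says that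
  \<open>f\<close> has period \<open>h\<close> and is meromorphic at the cusp at infinity.
\<close>

lift_definition has_q_expansion :: "nat \<Rightarrow> mero \<Rightarrow> complex fls \<Rightarrow> bool" is
  "\<lambda>h f L. \<exists>F. F meromorphic_on ball 0 1 \<and> F has_laurent_expansion L \<and>
     (\<forall>\<^sub>\<approx>z\<in>uhp. f z = F (exp (2 * of_real pi * \<i> * z / of_nat h)))"
proof (intro ext iff_exI conj_cong refl)
  fix h :: nat and f g F :: "complex \<Rightarrow> complex"
  assume "mero_eq f g"
  hence ev: "\<forall>\<^sub>\<approx>z\<in>uhp. f z = g z"
    by (simp add: mero_eq_def)
  show "(\<forall>\<^sub>\<approx>z\<in>uhp. f z = F (exp (2 * of_real pi * \<i> * z / of_nat h))) \<longleftrightarrow>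
        (\<forall>\<^sub>\<approx>z\<in>uhp. g z = F (exp (2 * of_real pi * \<i> * z / of_nat h)))"
    by (rule eventually_cong[OF ev]) simp
qed

text \<open>
  \<open>\<complex>(X\<^sub>0(N))\<close>. The translate of a \<open>\<Gamma>\<^sub>0(N)\<close>-invariant function by any element of the full modular
  group has period \<open>N\<close>, so that \<open>exp (2 \<pi> i z / N)\<close> can be used at every cusp, whatever its width.
\<close>

definition modular_functions :: "nat \<Rightarrow> mero set" where
  "modular_functions N = {f.
     (\<forall>a b c d. a * d - b * c = 1 \<and> int N dvd c \<longrightarrow> pullback a b c d f = f) \<and>
     (\<forall>a b c d. a * d - b * c = 1 \<longrightarrow> (\<exists>L. has_q_expansion N (pullback a b c d f) L))}"

text \<open>\<open>\<rat>(X\<^sub>0(N))\<close>\<close>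

definition rat_modular_functions :: "nat \<Rightarrow> mero set" where
  "rat_modular_functions N =
     {f \<in> modular_functions N. \<exists>L. has_q_expansion 1 f L \<and> (\<forall>n. fls_nth L n \<in> \<rat>)}"

text \<open>
  The pullback \<open>w\<^sub>d\<^sup>*\<close> on functions. The scalar factor \<open>1 / sqrt d\<close> of the matrix is dropped because it
  does not affect the action on the half plane; determinant \<open>1\<close> then becomes determinant \<open>d\<close>.
  For \<open>f\<close> in \<open>\<complex>(X\<^sub>0(N))\<close> the choice of the matrix is irrelevant (lemma \<open>atkin_lehner_eq\<close>).
\<close>

definition atkin_lehner :: "nat \<Rightarrow> nat \<Rightarrow> mero \<Rightarrow> mero" where
  "atkin_lehner N d f = (THE g. \<forall>A B C D.
     (A * int d) * (D * int d) - B * (int N * C) = int d \<longrightarrow>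
       g = pullback (A * int d) B (int N * C) (D * int d) f)"

lemma atkin_lehner_eq:
  assumes f: "f \<in> modular_functions N" and d: "d > 0" "d dvd N"
    and det: "(A * int d) * (D * int d) - B * (int N * C) = int d"
  shows "atkin_lehner N d f = pullback (A * int d) B (int N * C) (D * int d) f"
proof -
  obtain e where N: "N = d * e"
    using d by auto
  define M where "M = int d"
  have M: "M > 0" and N': "int N = M * int e"
    using d by (simp_all add: M_def N)
  have unique: "pullback (A' * M) B' (int N * C') (D' * M) f = pullback (A * M) B (int N * C) (D * M) f"
    if det': "(A' * M) * (D' * M) - B' * (int N * C') = M" for A' B' C' D'
  proof -
    have "M * (A * D * M - B * int e * C) = M * 1"
      using det by (simp add: N' M_def[symmetric] algebra_simps)
    hence 1: "A * D * M - B * int e * C = 1"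
      using M by (simp only: mult_cancel_left) auto
    have "M * (A' * D' * M - B' * int e * C') = M * 1"
      using det' by (simp add: N' algebra_simps)
    hence 2: "A' * D' * M - B' * int e * C' = 1"
      using M by (simp only: mult_cancel_left) auto
    define a where "a = A' * D * M - int e * B' * C"
    define b where "b = A * B' - A' * B"
    define c where "c = int N * (C' * D - C * D')"
    define g where "g = A * D' * M - int e * C' * B"
    have "a * g - b * c = (A * D * M - B * int e * C) * (A' * D' * M - B' * int e * C')"
      unfolding a_def b_def c_def g_def N' by (simp add: algebra_simps)
    hence abcg: "a * g - b * c = 1"
      using 1 2 by simp
    have inv: "pullback a b c g f = f"
      using f abcg by (auto simp: modular_functions_def c_def)
    have "pullback (A * M) B (int N * C) (D * M) f =
            pullback (A * M) B (int N * C) (D * M) (pullback a b c g f)"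
      by (simp add: inv)
    also have "\<dots> = pullback (a * (A * M) + b * (int N * C)) (a * B + b * (D * M))
                       (c * (A * M) + g * (int N * C)) (c * B + g * (D * M)) f"
      by (rule pullback_pullback) (use det M abcg in \<open>simp_all add: M_def\<close>)
    also have "a * (A * M) + b * (int N * C) = A' * M * (A * D * M - B * int e * C)"
      unfolding a_def b_def c_def g_def N' by (simp add: algebra_simps)
    also have "a * B + b * (D * M) = B' * (A * D * M - B * int e * C)"
      unfolding a_def b_def c_def g_def N' by (simp add: algebra_simps)
    also have "c * (A * M) + g * (int N * C) = int N * C' * (A * D * M - B * int e * C)"
      unfolding a_def b_def c_def g_def N' by (simp add: algebra_simps)
    also have "c * B + g * (D * M) = D' * M * (A * D * M - B * int e * C)"
      unfolding a_def b_def c_def g_def N' by (simp add: algebra_simps)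
    finally show ?thesis
      by (simp add: 1)
  qed
  show ?thesis
    unfolding atkin_lehner_def
  proof (rule the_equality)
    show "\<forall>A' B' C' D'. (A' * int d) * (D' * int d) - B' * (int N * C') = int d \<longrightarrow>
            pullback (A * int d) B (int N * C) (D * int d) f =
            pullback (A' * int d) B' (int N * C') (D' * int d) f"
      using unique unfolding M_def by metis
  qed (use det in blast)
qed


section \<open>Fields and birational equivalence\<close>

text \<open>
  An affine scheme \<open>Spec R\<close> is integral with function field \<open>K\<close> precisely if \<open>R\<close> is a domain whose
  fraction field is \<open>K\<close>, and integral curves are birationally equivalent iff their function fields
  are isomorphic. The homomorphism below is linear over \<open>\<rat>\<close> whenever \<open>R\<close> contains \<open>\<rat>\<close>.
\<close>

definition fraction_field_of :: "('a, 'm) ring_scheme \<Rightarrow> ('b, 'n) ring_scheme \<Rightarrow> bool" where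
  "fraction_field_of R K \<longleftrightarrow> domain R \<and> Ring.field K \<and>
     (\<exists>\<phi> \<in> ring_hom R K. inj_on \<phi> (carrier R) \<and>
        carrier K = {\<phi> a \<otimes>\<^bsub>K\<^esub> inv\<^bsub>K\<^esub> (\<phi> b) | a b. a \<in> carrier R \<and> b \<in> carrier R - {\<zero>\<^bsub>R\<^esub>}})"

abbreviation mero_field :: "mero ring" where
  "mero_field \<equiv> ring_of_type_algebra"

text \<open>\<open>\<rat>[X, Y, T]\<close> is encoded as \<open>\<rat>[X][Y][T]\<close>.\<close>

type_synonym rat_poly3 = "rat poly poly poly"

abbreviation rat_poly3_ring :: "rat_poly3 ring" where
  "rat_poly3_ring \<equiv> ring_of_type_algebra"

definition var_X :: rat_poly3 where "var_X = [:[:[:0, 1:]:]:]"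
definition var_Y :: rat_poly3 where "var_Y = [:[:0, 1:]:]"
definition var_T :: rat_poly3 where "var_T = [:0, 1:]"

end

theory Submission
  imports Defs "HOL-Number_Theory.Cong"
begin

text \<open>Put \<open>P(q) = \<Prod>(1 - q\<^sup>n)\<close>. The quotient \<open>h(z) = P(q) / (q P(q\<^sup>2\<^sup>5))\<close> is a Hauptmodul of \<open>\<Gamma>\<^sub>0(25)\<close>; it is a
  quotient of differences of Weierstrass functions at 5-torsion points, which gives its behaviour under
  the modular group without any theory of eta multipliers. For \<open>h\<^sub>1 = h(z)\<close> and \<open>h\<^sub>3 = h(3z)\<close> the involution
  exchanges \<open>h\<^sub>1\<close> with \<open>5 / h\<^sub>3\<close>. Hence \<open>u = h\<^sub>3 / h\<^sub>1\<close> and \<open>v = h\<^sub>3\<^sup>2 / h\<^sub>1 + 5 h\<^sub>3 / h\<^sub>1\<^sup>2\<close> are invariant,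
  \<open>d = h\<^sub>3\<^sup>2 / h\<^sub>1 - 5 h\<^sub>3 / h\<^sub>1\<^sup>2\<close> is anti-invariant, and \<open>d\<^sup>2 = v\<^sup>2 - 20u\<^sup>3\<close>. All three have poles only at the
  cusps \<open>\<infinity>\<close> and \<open>0\<close>, so the cubic equation between \<open>u\<close> and \<open>v\<close> follows by comparing finitely many Fourier
  coefficients and using Liouville's theorem. The solution is \<open>x = u - 1\<close>, \<open>y = (v + 3 + 4x + x\<^sup>2) / x\<close>,
  \<open>t = dv / u\<close>.

  For the generation statement, multiply a modular function by a polynomial in \<open>u\<close> until its poles lie
  at \<open>\<infinity>\<close> and \<open>0\<close>; call the result \<open>f\<close>. Functions with poles of order at most \<open>n\<close> there form a space of
  dimension at most \<open>2n + 1\<close>. If \<open>m\<close> bounds the pole orders of \<open>f, 1, v, d, vd\<close>, their products with the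
  powers \<open>u\<^sup>i\<close>, \<open>i \<le> 2m\<close>, are \<open>5(2m + 1)\<close> functions with poles of order at most \<open>5m\<close>, hence linearly
  dependent. The orders 2 and 5 of the poles of \<open>u\<close> and \<open>v\<close> at \<open>\<infinity>\<close>, together with the sign under the
  involution, make \<open>1, v, d, vd\<close> independent over \<open>\<complex>(u)\<close>, so \<open>f\<close> is in their span.
  A \<open>\<rat>\<close>-linear functional on \<open>\<complex>\<close> turns the relation into a rational one.\<close>


section \<open>Theta products\<close>

text \<open>In the variable z/5 level 25 becomes a question about one lattice: conjugation by
  diag(5, 1) turns \<open>\<Gamma>\<^sub>0(25)\<close> into the matrices with b and c divisible by
  5, which permute 5-torsion points in a simple way. The 5 in the inversion formula is the square of
  a quadratic Gauss sum. Poles are allowed at \<infinity> and 0 because the involution swaps these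
  cusps: for an invariant function with poles only there, the expansion at \<infinity> alone decides
  whether it vanishes. The curve between u and v is singular at u = 1, v = -3. This explains x = u -
  1 and the division by x in y, which resolves the singular point. Four functions suffice over the
  powers of u because u has double poles at two cusps, hence degree 4: k functions independent over
  \<complex>(u) yield about k n / 2 independent products with poles of order at most n, while only
  2n + 1 dimensions are available. Only this upper bound on dimensions is used, and it follows from
  Liouville's theorem and linear algebra on Taylor coefficients.\<close>

definition phi :: "complex \<Rightarrow> complex \<Rightarrow> complex" where
  "phi a q = (\<Prod>n. 1 - a * q ^ n)"

lemma phi_convergent:
  fixes a q :: complex
  assumes "norm q < 1"
  shows "convergent_prod (\<lambda>n. 1 - a * q ^ n)"
proof -
  have "summable (\<lambda>n. norm (1 - a * q ^ n - 1))"
    using assms by (simp add: norm_mult norm_power summable_mult summable_geometric)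
  then show ?thesis
    by (intro abs_convergent_prod_imp_convergent_prod summable_imp_abs_convergent_prod)
qed

lemma phi_limit:
  assumes "norm q < 1"
  shows "(\<lambda>N. \<Prod>n<N. 1 - a * q ^ n) \<longlonglongrightarrow> phi a q"
  using convergent_prod_LIMSEQ[OF phi_convergent[OF assms, of a]]
  unfolding phi_def lessThan_Suc_atMost[symmetric] by (subst (asm) filterlim_sequentially_Suc)

text \<open>The Weierstrass M-test on closed discs: there |f| is at most some C and |g| at most some
  r < 1, so the terms are dominated by C r^n. Both arguments may vary, since later either the nome
  or the point moves.\<close>

lemma phi_holomorphic [holomorphic_intros]:
  assumes "open A" "f holomorphic_on A" "g holomorphic_on A" "\<And>z. z \<in> A \<Longrightarrow> norm (g z) < 1"
  shows "(\<lambda>z. phi (f z) (g z)) holomorphic_on A"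
proof (rule holomorphic_uniform_sequence[OF assms(1)])
  show "(\<lambda>z. \<Prod>n<N. 1 - f z * g z ^ n) holomorphic_on A" for N
    by (intro holomorphic_intros assms)
  fix x assume x: "x \<in> A"
  then obtain d where d: "d > 0" "cball x d \<subseteq> A"
    using assms(1) open_contains_cball by blast
  have cf: "continuous_on (cball x d) f" and cg: "continuous_on (cball x d) g"
    using assms d holomorphic_on_imp_continuous_on holomorphic_on_subset by blast+
  have "compact ((\<lambda>z. norm (g z)) ` cball x d)" "(\<lambda>z. norm (g z)) ` cball x d \<noteq> {}"
    using d by (auto intro!: compact_continuous_image continuous_intros cg)
  then obtain r where r: "r \<in> (\<lambda>z. norm (g z)) ` cball x d" "\<forall>s\<in>(\<lambda>z. norm (g z)) ` cball x d. s \<le> r"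
    using compact_attains_sup[of "(\<lambda>z. norm (g z)) ` cball x d"] by blast
  obtain z0 where z0: "z0 \<in> cball x d" "r = norm (g z0)" using r(1) by blast
  have r1: "0 \<le> r" "r < 1" using z0 assms(4)[of z0] d(2) by auto
  have "bounded (f ` cball x d)"
    by (intro compact_imp_bounded compact_continuous_image cf) auto
  then obtain C where C: "\<And>z. z \<in> cball x d \<Longrightarrow> norm (f z) \<le> C"
    unfolding bounded_iff by blast
  have unif: "uniformly_convergent_on (cball x d) (\<lambda>N z. \<Prod>n<N. 1 - f z * g z ^ n)"
  proof (rule uniformly_convergent_on_prod')
    show "continuous_on (cball x d) (\<lambda>z. 1 - f z * g z ^ n)" for n
      by (intro continuous_intros cf cg)
    show "uniformly_convergent_on (cball x d) (\<lambda>N z. \<Sum>n<N. norm (1 - f z * g z ^ n - 1))"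
    proof (rule Weierstrass_m_test')
      show "norm (norm (1 - f z * g z ^ n - 1)) \<le> C * r ^ n" if "z \<in> cball x d" for n z
      proof -
        have "norm (g z) \<le> r" using r(2) that by blast
        then have "norm (f z) * norm (g z) ^ n \<le> C * r ^ n"
          using order.trans[OF norm_ge_zero C[OF that]] by (intro mult_mono power_mono C that) auto
        then show ?thesis by (simp add: norm_mult norm_power)
      qed
      show "summable (\<lambda>n. C * r ^ n)"
        using r1 by (intro summable_mult summable_geometric) auto
    qed
  qed auto
  have "uniform_limit (cball x d) (\<lambda>N z. \<Prod>n<N. 1 - f z * g z ^ n) (\<lambda>z. phi (f z) (g z)) sequentially"
  proof -
    obtain l where l: "uniform_limit (cball x d) (\<lambda>N z. \<Prod>n<N. 1 - f z * g z ^ n) l sequentially"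
      using unif by (auto simp: uniformly_convergent_on_def)
    have "l z = phi (f z) (g z)" if "z \<in> cball x d" for z
    proof -
      have "(\<lambda>N. \<Prod>n<N. 1 - f z * g z ^ n) \<longlonglongrightarrow> l z"
        using tendsto_uniform_limitI[OF l that] .
      moreover have "(\<lambda>N. \<Prod>n<N. 1 - f z * g z ^ n) \<longlonglongrightarrow> phi (f z) (g z)"
        using phi_limit assms(4) that d by blast
      ultimately show ?thesis using LIMSEQ_unique by blast
    qed
    with l show ?thesis by (subst uniform_limit_cong') auto
  qed
  then show "\<exists>d>0. cball x d \<subseteq> A \<and> uniform_limit (cball x d) (\<lambda>N z. \<Prod>n<N. 1 - f z * g z ^ n) (\<lambda>z. phi (f z) (g z)) sequentially"
    using d by blast
qed

lemma phi_eq_0_iff: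
  assumes "norm q < 1"
  shows "phi a q = 0 \<longleftrightarrow> (\<exists>n. a * q ^ n = 1)"
  using has_prod_eq_0_iff[OF convergent_prod_has_prod[OF phi_convergent[OF assms, of a]]]
  by (auto simp: phi_def)

lemma phi_nonzero: "norm q < 1 \<Longrightarrow> norm a < 1 \<Longrightarrow> phi a q \<noteq> 0"
proof
  assume "norm q < 1" "norm a < 1" "phi a q = 0"
  then obtain n where "a * q ^ n = 1" by (auto simp: phi_eq_0_iff)
  moreover have "norm (a * q ^ n) \<le> norm a * 1"
    unfolding norm_mult norm_power using \<open>norm q < 1\<close> by (intro mult_left_mono power_le_one) auto
  ultimately show False using \<open>norm a < 1\<close> by simp
qed

lemma phi_shift:
  assumes "norm q < 1"
  shows "phi a q = (1 - a) * phi (a * q) q"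
proof -
  have "(\<lambda>N. \<Prod>n<Suc N. 1 - a * q ^ n) \<longlonglongrightarrow> phi a q"
    using phi_limit[OF assms] by (subst filterlim_sequentially_Suc)
  moreover have "(\<lambda>N. (1 - a) * (\<Prod>n<N. 1 - (a * q) * q ^ n)) \<longlonglongrightarrow> (1 - a) * phi (a * q) q"
    by (intro tendsto_intros phi_limit assms)
  moreover have "(\<Prod>n<Suc N. 1 - a * q ^ n) = (1 - a) * (\<Prod>n<N. 1 - (a * q) * q ^ n)" for N
    by (subst prod.lessThan_Suc_shift) (simp add: mult_ac)
  ultimately show ?thesis using LIMSEQ_unique by auto
qed

text \<open>The factors are grouped by the residue of the exponent modulo m. This evaluates the
  theta functions at the torsion point \<tau>/5.\<close>

lemma phi_residues:
  assumes "norm q < 1" "m > 0"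
  shows "phi a q = (\<Prod>j<m. phi (a * q ^ j) (q ^ m))"
proof -
  have nm: "norm (q ^ m) < 1"
    unfolding norm_power using assms by (simp add: power_less_one_iff)
  have "(\<lambda>N. \<Prod>n<N * m. 1 - a * q ^ n) \<longlonglongrightarrow> phi a q"
    using LIMSEQ_subseq_LIMSEQ[OF phi_limit[OF assms(1), of a], of "\<lambda>N. N * m"] assms(2)
    by (auto simp: strict_mono_def o_def)
  moreover have "(\<lambda>N. \<Prod>j<m. \<Prod>n<N. 1 - (a * q ^ j) * (q ^ m) ^ n) \<longlonglongrightarrow> (\<Prod>j<m. phi (a * q ^ j) (q ^ m))"
    by (intro tendsto_prod phi_limit nm)
  moreover have "(\<Prod>n<N * m. 1 - a * q ^ n) = (\<Prod>j<m. \<Prod>n<N. 1 - (a * q ^ j) * (q ^ m) ^ n)" for N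
  proof (induction N)
    case (Suc N)
    have "(\<Prod>n<Suc N * m. 1 - a * q ^ n) = (\<Prod>n<N * m. 1 - a * q ^ n) * (\<Prod>j<m. 1 - a * q ^ (N * m + j))"
    proof -
      have "(\<Prod>n\<in>{0..<N * m}. 1 - a * q ^ n) * (\<Prod>n\<in>{N * m..<N * m + m}. 1 - a * q ^ n) =
              (\<Prod>n\<in>{0..<N * m + m}. 1 - a * q ^ n)"
        by (rule prod.atLeastLessThan_concat) auto
      then show ?thesis
        by (simp add: prod.atLeastLessThan_shift_0[of _ "N * m"] atLeast0LessThan o_def add.commute)
    qed
    also have "(\<Prod>j<m. 1 - a * q ^ (N * m + j)) = (\<Prod>j<m. 1 - (a * q ^ j) * (q ^ m) ^ N)"
      by (simp add: power_add power_mult mult_ac flip: power_mult)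
    finally show ?case
      by (simp add: Suc prod.distrib)
  qed auto
  ultimately show ?thesis using LIMSEQ_unique by auto
qed

text \<open>The companion for the torsion point 1/5: for each n the factors are multiplied over the
  roots of unity c k, which enter only through the factorisation of 1 - x^m.\<close>

lemma phi_roots_of_unity:
  assumes "norm q < 1" and X: "\<And>x. (\<Prod>k<m. 1 - c k * x) = 1 - x ^ m" and "m > 0"
  shows "(\<Prod>k<m. phi (c k * a) q) = phi (a ^ m) (q ^ m)"
proof -
  have nm: "norm (q ^ m) < 1"
    unfolding norm_power using assms by (simp add: power_less_one_iff)
  have "(\<lambda>N. \<Prod>k<m. \<Prod>n<N. 1 - (c k * a) * q ^ n) \<longlonglongrightarrow> (\<Prod>k<m. phi (c k * a) q)"
    by (intro tendsto_prod phi_limit assms)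
  moreover have "(\<lambda>N. \<Prod>n<N. 1 - a ^ m * (q ^ m) ^ n) \<longlonglongrightarrow> phi (a ^ m) (q ^ m)"
    by (intro phi_limit nm)
  moreover have "(\<Prod>k<m. \<Prod>n<N. 1 - (c k * a) * q ^ n) = (\<Prod>n<N. 1 - a ^ m * (q ^ m) ^ n)" for N
    using X[of "a * q ^ n" for n]
    by (subst prod.swap) (auto intro!: prod.cong simp: mult_ac power_mult_distrib simp flip: power_mult)
  ultimately show ?thesis using LIMSEQ_unique by auto
qed

text \<open>The Jacobi theta function in product form, without its constant factor;
  \<open>phi\<close> is the infinite q-Pochhammer symbol.\<close>

definition Theta :: "complex \<Rightarrow> complex \<Rightarrow> complex" where
  "Theta x q = phi x q * phi (q / x) q"

lemma Theta_shift:
  assumes "norm q < 1" "q \<noteq> 0" "x \<noteq> 0"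
  shows "Theta (q * x) q = - Theta x q / x"
proof -
  have "Theta (q * x) q = phi (x * q) q * phi (1 / x) q"
    using assms by (simp add: Theta_def mult_ac)
  also have "phi (1 / x) q = (1 - 1 / x) * phi (q / x) q"
    using phi_shift[OF assms(1), of "1 / x"] by simp
  also have "phi (x * q) q * ((1 - 1 / x) * phi (q / x) q) = - ((1 - x) * phi (x * q) q) * phi (q / x) q / x"
    using assms by (simp add: field_simps)
  also have "(1 - x) * phi (x * q) q = phi x q"
    using phi_shift[OF assms(1), of x] by simp
  finally show ?thesis by (simp add: Theta_def)
qed

lemma Theta_inverse:
  assumes "norm q < 1" "x \<noteq> 0"
  shows "Theta (1 / x) q = - Theta x q / x"
proof -
  have "Theta (1 / x) q = phi (1 / x) q * phi (x * q) q"
    by (simp add: Theta_def mult_ac)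
  also have "phi (1 / x) q = (1 - 1 / x) * phi (q / x) q"
    using phi_shift[OF assms(1), of "1 / x"] by simp
  also have "(1 - 1 / x) * phi (q / x) q * phi (x * q) q = - ((1 - x) * phi (x * q) q) * phi (q / x) q / x"
    using assms by (simp add: field_simps)
  also have "(1 - x) * phi (x * q) q = phi x q"
    using phi_shift[OF assms(1), of x] by simp
  finally show ?thesis by (simp add: Theta_def)
qed

lemma Theta_eq_0_iff:
  assumes "norm q < 1" "q \<noteq> 0" "x \<noteq> 0"
  shows "Theta x q = 0 \<longleftrightarrow> (\<exists>n::int. x = q powi n)"
proof
  assume "Theta x q = 0"
  then consider n where "x * q ^ n = 1" | n where "q / x * q ^ n = 1"
    using assms by (auto simp: Theta_def phi_eq_0_iff)
  then show "\<exists>n::int. x = q powi n"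
  proof cases
    case 1
    then have "x = q powi (- int n)"
      using assms by (simp add: power_int_minus field_simps)
    then show ?thesis by blast
  next
    case 2
    then have "x = q powi (int (Suc n))"
      using assms by (simp add: field_simps del: of_nat_Suc)
    then show ?thesis by blast
  qed
next
  assume "\<exists>n::int. x = q powi n"
  then obtain n where n: "x = q powi n" by blast
  show "Theta x q = 0"
  proof (cases "n \<le> 0")
    case True
    then have "x * q ^ nat (- n) = 1"
      using assms n by (simp flip: power_int_of_nat power_int_add)
    then show ?thesis using assms by (auto simp: Theta_def phi_eq_0_iff)
  next
    case False
    then have "q * q ^ nat (n - 1) = q powi n"
      using power_int_add_1'[of q "n - 1"] assms by (simp add: power_int_def)
    then have "q / x * q ^ nat (n - 1) = 1"
      using assms n by (simp add: field_simps)
    then show ?thesis using assms by (auto simp: Theta_def phi_eq_0_iff)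
  qed
qed

text \<open>For \<open>x = e(u)\<close>, \<open>y = e(v)\<close>, \<open>q = e(\<tau>)\<close> this is, up to a constant, the product formula for the
  difference of the Weierstrass function of the lattice \<open>\<int>\<tau> + \<int>\<close> at \<open>u\<close> and at \<open>v\<close>.\<close>

definition Rfun :: "complex \<Rightarrow> complex \<Rightarrow> complex \<Rightarrow> complex" where
  "Rfun x y q = y * phi q q ^ 4 * Theta (x * y) q * Theta (x / y) q / (Theta x q ^ 2 * Theta y q ^ 2)"

text \<open>The automorphy factors cancel: the numerator contributes 1/(x y) and y/x, the squared
  denominator 1/x^2.\<close>

lemma Rfun_shift:
  assumes "norm q < 1" "q \<noteq> 0" "x \<noteq> 0" "y \<noteq> 0"
  shows "Rfun (q * x) y q = Rfun x y q"
proof -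
  have "Theta (q * x * y) q = - Theta (x * y) q / (x * y)"
    using Theta_shift[OF assms(1,2), of "x * y"] assms by (simp add: mult_ac)
  moreover have "Theta (q * x / y) q = - Theta (x / y) q / (x / y)"
    using Theta_shift[OF assms(1,2), of "x / y"] assms by (simp add: mult_ac)
  ultimately show ?thesis
    using assms by (simp add: Rfun_def Theta_shift power2_eq_square)
qed

lemma Rfun_swap:
  assumes "norm q < 1" "q \<noteq> 0" "x \<noteq> 0" "y \<noteq> 0"
  shows "Rfun y x q = - Rfun x y q"
proof -
  have "Theta (y / x) q = - Theta (x / y) q / (x / y)"
    using Theta_inverse[OF assms(1), of "x / y"] assms by simp
  then show ?thesis
    using assms by (simp add: Rfun_def mult_ac)
qed

lemma Rfun_inverse:
  assumes "norm q < 1" "q \<noteq> 0" "x \<noteq> 0" "y \<noteq> 0"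
  shows "Rfun (1 / x) y q = Rfun x y q"
proof -
  have "Theta (1 / x * y) q = - Theta (x / y) q / (x / y)"
    using Theta_inverse[OF assms(1), of "x / y"] assms by simp
  moreover have "Theta (1 / x / y) q = - Theta (x * y) q / (x * y)"
    using Theta_inverse[OF assms(1), of "x * y"] assms by simp
  ultimately show ?thesis
    using assms by (simp add: Rfun_def Theta_inverse power2_eq_square)
qed


section \<open>Weierstrass differences\<close>

definition ee :: "complex \<Rightarrow> complex" where
  "ee z = exp (2 * of_real pi * \<i> * z)"

lemma ee_nonzero [simp]: "ee z \<noteq> 0"
  by (simp add: ee_def)

lemma ee_0 [simp]: "ee 0 = 1"
  by (simp add: ee_def)

lemma ee_add: "ee (a + b) = ee a * ee b"
  by (simp add: ee_def ring_distribs exp_add)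

lemma ee_diff: "ee (a - b) = ee a / ee b"
  by (simp add: ee_def ring_distribs exp_diff)

lemma ee_minus: "ee (- a) = 1 / ee a"
  by (simp add: ee_def exp_minus field_simps)

lemma ee_of_nat_mult: "ee (of_nat n * z) = ee z ^ n"
  by (simp add: ee_def exp_of_nat_mult[symmetric] mult_ac)

lemma ee_of_int_mult: "ee (of_int n * z) = ee z powi n"
  unfolding ee_def exp_power_int by (simp add: mult_ac)

lemma ee_of_int [simp]: "ee (of_int n) = 1"
  using ee_of_int_mult[of n 1] by (simp add: ee_def)

lemma ee_1 [simp]: "ee 1 = 1"
  using ee_of_int[of 1] by simp

lemma norm_ee: "norm (ee z) = exp (- 2 * pi * Im z)"
  by (simp add: ee_def)

lemma norm_ee_less_1: "z \<in> uhp \<Longrightarrow> norm (ee z) < 1"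
  by (simp add: norm_ee uhp_def)

lemma ee_eq_iff: "ee z = ee w \<longleftrightarrow> (\<exists>n::int. z = w + of_int n)"
proof -
  have "ee z = ee w \<longleftrightarrow> (\<exists>n::int. 2 * of_real pi * \<i> * z = 2 * of_real pi * \<i> * w + of_int (2 * n) * of_real pi * \<i>)"
    unfolding ee_def exp_eq by simp
  also have "\<dots> \<longleftrightarrow> (\<exists>n::int. z = w + of_int n)"
  proof (intro ex_cong1)
    fix n :: int
    have "2 * of_real pi * \<i> * w + of_int (2 * n) * of_real pi * \<i> = 2 * of_real pi * \<i> * (w + of_int n)"
      by (simp add: algebra_simps)
    then show "(2 * of_real pi * \<i> * z = 2 * of_real pi * \<i> * w + of_int (2 * n) * of_real pi * \<i>) \<longleftrightarrow> z = w + of_int n"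
      by simp
  qed
  finally show ?thesis .
qed

lemma holomorphic_on_ee [holomorphic_intros]: "f holomorphic_on A \<Longrightarrow> (\<lambda>z. ee (f z)) holomorphic_on A"
  unfolding ee_def by (intro holomorphic_intros)

lemma analytic_on_ee [analytic_intros]: "f analytic_on A \<Longrightarrow> (\<lambda>z. ee (f z)) analytic_on A"
  unfolding ee_def by (intro analytic_intros)

section \<open>Lattices and even elliptic functions\<close>

definition lat :: "complex \<Rightarrow> complex set" where
  "lat \<tau> = {of_int m * \<tau> + of_int n | m n. True}"

lemma latI: "u = of_int m * \<tau> + of_int n \<Longrightarrow> u \<in> lat \<tau>"
  by (auto simp: lat_def)

lemma lat_0 [simp]: "0 \<in> lat \<tau>"
  by (rule latI[of _ 0 _ 0]) auto

lemma lat_add: "u \<in> lat \<tau> \<Longrightarrow> v \<in> lat \<tau> \<Longrightarrow> u + v \<in> lat \<tau>"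
proof -
  assume "u \<in> lat \<tau>" "v \<in> lat \<tau>"
  then obtain m n m' n' where "u = of_int m * \<tau> + of_int n" "v = of_int m' * \<tau> + of_int n'"
    unfolding lat_def by blast
  then show ?thesis by (intro latI[of _ "m + m'" _ "n + n'"]) (simp add: algebra_simps)
qed

lemma lat_minus: "u \<in> lat \<tau> \<Longrightarrow> - u \<in> lat \<tau>"
proof -
  assume "u \<in> lat \<tau>"
  then obtain m n where "u = of_int m * \<tau> + of_int n"
    unfolding lat_def by blast
  then show ?thesis by (intro latI[of _ "- m" _ "- n"]) (simp add: algebra_simps)
qed

lemma lat_add_iff: "v \<in> lat \<tau> \<Longrightarrow> u + v \<in> lat \<tau> \<longleftrightarrow> u \<in> lat \<tau>"
  using lat_add[of u \<tau> v] lat_add[of "u + v" \<tau> "- v"] lat_minus[of v \<tau>] by auto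

lemma lat_minus_iff [simp]: "- u \<in> lat \<tau> \<longleftrightarrow> u \<in> lat \<tau>"
  using lat_minus[of u \<tau>] lat_minus[of "- u" \<tau>] by auto

lemma lat_isolated:
  assumes "\<tau> \<in> uhp" "u \<in> lat \<tau>" "norm u < min 1 (Im \<tau>)"
  shows "u = 0"
proof -
  obtain m n where u: "u = of_int m * \<tau> + of_int n" using assms(2) unfolding lat_def by blast
  have "\<bar>of_int m\<bar> * Im \<tau> \<le> norm u"
    using abs_Im_le_cmod[of u] assms(1) by (simp add: u uhp_def abs_mult)
  also have "\<dots> < 1 * Im \<tau>" using assms(3) by simp
  finally have m: "m = 0"
    using assms(1) by (subst (asm) mult_less_cancel_right) (auto simp: uhp_def)
  then have "\<bar>of_int n\<bar> < (1 :: real)" using assms(3) by (simp add: u)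
  then show ?thesis using m u by auto
qed

lemma Theta_ee_eq_0_iff:
  assumes "\<tau> \<in> uhp"
  shows "Theta (ee u) (ee \<tau>) = 0 \<longleftrightarrow> u \<in> lat \<tau>"
proof -
  have "Theta (ee u) (ee \<tau>) = 0 \<longleftrightarrow> (\<exists>m::int. ee u = ee (of_int m * \<tau>))"
    by (simp add: Theta_eq_0_iff norm_ee_less_1 assms ee_of_int_mult)
  also have "\<dots> \<longleftrightarrow> u \<in> lat \<tau>"
    by (auto simp: ee_eq_iff lat_def)
  finally show ?thesis .
qed

lemma Theta_ee_holomorphic [holomorphic_intros]:
  assumes "\<tau> \<in> uhp" "f holomorphic_on A" "open A"
  shows "(\<lambda>u. Theta (ee (f u)) (ee \<tau>)) holomorphic_on A"
  unfolding Theta_def by (intro holomorphic_intros assms norm_ee_less_1) auto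

text \<open>The lattice is closed, being the zero set of a theta function.\<close>

lemma open_Compl_lat:
  assumes "\<tau> \<in> uhp"
  shows "open (- lat \<tau>)"
proof -
  have "continuous_on UNIV (\<lambda>u. Theta (ee u) (ee \<tau>))"
    by (intro holomorphic_on_imp_continuous_on holomorphic_intros assms) auto
  then have "open ((\<lambda>u. Theta (ee u) (ee \<tau>)) -` (- {0}))"
    by (subst (asm) continuous_on_open_vimage) auto
  also have "(\<lambda>u. Theta (ee u) (ee \<tau>)) -` (- {0}) = - lat \<tau>"
    using Theta_ee_eq_0_iff[OF assms] by auto
  finally show ?thesis .
qed

text \<open>Periodicity is assumed only off the lattice, because values at poles are arbitrary;
  translation by lattice points never leaves the complement.\<close>

lemma lat_periodic:
  assumes "\<And>u. u \<notin> lat \<tau> \<Longrightarrow> k (u + 1) = k u" "\<And>u. u \<notin> lat \<tau> \<Longrightarrow> k (u + \<tau>) = k u"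
    and "u \<notin> lat \<tau>" "l \<in> lat \<tau>"
  shows "k (u + l) = (k u :: complex)"
proof -
  have 1: "k (u + of_nat n) = k u" if "u \<notin> lat \<tau>" for u n
  proof (induction n)
    case (Suc n)
    have "u + of_nat n \<notin> lat \<tau>"
      using that by (subst lat_add_iff) (auto intro!: latI[of _ 0 _ "int n"])
    from assms(1)[OF this] Suc show ?case by (simp add: add_ac)
  qed auto
  have 2: "k (u + of_int n) = k u" if "u \<notin> lat \<tau>" for u n
  proof (cases "n \<ge> 0")
    case True
    then show ?thesis using 1[OF that, of "nat n"] by simp
  next
    case False
    have "u + of_int n \<notin> lat \<tau>"
      using that by (subst lat_add_iff) (auto intro!: latI[of _ 0 _ n])
    from 1[OF this, of "nat (- n)"] False show ?thesis by simp
  qed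
  have 3: "k (u + of_nat n * \<tau>) = k u" if "u \<notin> lat \<tau>" for u n
  proof (induction n)
    case (Suc n)
    have "u + of_nat n * \<tau> \<notin> lat \<tau>"
      using that by (subst lat_add_iff) (auto intro!: latI[of _ "int n" _ 0])
    from assms(2)[OF this] Suc show ?case by (simp add: algebra_simps)
  qed auto
  have 4: "k (u + of_int n * \<tau>) = k u" if "u \<notin> lat \<tau>" for u n
  proof (cases "n \<ge> 0")
    case True
    then show ?thesis using 3[OF that, of "nat n"] by simp
  next
    case False
    have "u + of_int n * \<tau> \<notin> lat \<tau>"
      using that by (subst lat_add_iff) (auto intro!: latI[of _ n _ 0])
    from 3[OF this, of "nat (- n)"] False show ?thesis by (simp add: algebra_simps)
  qed
  obtain m n where l: "l = of_int m * \<tau> + of_int n" using assms(4) unfolding lat_def by blast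
  have "u + of_int m * \<tau> \<notin> lat \<tau>"
    using assms(3) by (subst lat_add_iff) (auto intro!: latI[of _ m _ 0])
  from 2[OF this, of n] 4[OF assms(3), of m] show ?thesis by (simp add: l add_ac)
qed

text \<open>The limit condition leaves at most a simple pole at 0, and evenness kills its residue.
  The function is then entire and doubly periodic, hence bounded, hence constant.\<close>

lemma even_elliptic_eq_0:
  assumes \<tau>: "\<tau> \<in> uhp" and hol: "k holomorphic_on - lat \<tau>"
    and p1: "\<And>u. u \<notin> lat \<tau> \<Longrightarrow> k (u + 1) = k u" and p2: "\<And>u. u \<notin> lat \<tau> \<Longrightarrow> k (u + \<tau>) = k u"
    and even: "\<And>u. u \<notin> lat \<tau> \<Longrightarrow> k (- u) = k u"
    and lim: "((\<lambda>u. u ^ 2 * k u) \<longlongrightarrow> 0) (at 0)"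
    and v: "v \<notin> lat \<tau>" "k v = 0" and u: "u \<notin> lat \<tau>"
  shows "k u = 0"
proof -
  note per = lat_periodic[OF p1 p2]
  define r where "r = min 1 (Im \<tau>)"
  have r: "r > 0" using \<tau> by (simp add: r_def uhp_def)
  define S where "S = ball (0::complex) r"
  have S: "open S" "0 \<in> interior S" "0 \<in> S" using r by (auto simp: S_def)
  have S_lat: "z \<notin> lat \<tau>" if "z \<in> S - {0}" for z
    using lat_isolated[OF \<tau>, of z] that by (auto simp: S_def r_def)
  have k_hol: "k holomorphic_on S - {0}"
    by (rule holomorphic_on_subset[OF hol]) (use S_lat in auto)
  have evS: "\<forall>\<^sub>F z in at 0. z \<in> S - {0}"
    using S by (intro eventually_at_in_open) auto
  \<comment> \<open>\<open>A\<close> extends z^2 k(z) over 0 and vanishes there, so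
    \<open>deriv A 0\<close> is the residue of k at 0; comparing z with -z shows that it equals its
    own negative.\<close>
  have "\<exists>A. A holomorphic_on S \<and> (\<forall>z\<in>S - {0}. A z = z ^ 2 * k z)"
  proof (subst holomorphic_on_extend_lim)
    show "(\<lambda>z. z\<^sup>2 * k z) holomorphic_on S - {0}" by (intro holomorphic_intros k_hol)
    show "((\<lambda>z. (z - 0) * (z\<^sup>2 * k z)) \<longlongrightarrow> 0) (at 0)"
      using tendsto_mult[OF tendsto_ident_at lim] by simp
  qed (use S in auto)
  then obtain A where A: "A holomorphic_on S" "\<And>z. z \<in> S - {0} \<Longrightarrow> A z = z ^ 2 * k z" by blast
  have "A \<midarrow>0\<rightarrow> A 0"
    using A(1) S by (meson continuous_on_eq_continuous_at holomorphic_on_imp_continuous_on isContD)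
  moreover have "A \<midarrow>0\<rightarrow> 0"
    by (rule Lim_transform_eventually[OF lim]) (use evS A(2) in \<open>auto elim!: eventually_mono\<close>)
  ultimately have A0: "A 0 = 0" by (rule LIM_unique)
  have "(A has_field_derivative deriv A 0) (at 0)"
    using S by (intro holomorphic_derivI[OF A(1)]) auto
  then have "(\<lambda>z. A z / z) \<midarrow>0\<rightarrow> deriv A 0"
    using A0 by (simp add: has_field_derivative_iff)
  then have L: "(\<lambda>z. z * k z) \<midarrow>0\<rightarrow> deriv A 0"
    by (rule Lim_transform_eventually)
       (use evS A(2) in \<open>auto elim!: eventually_mono simp: power2_eq_square\<close>)
  have "(\<lambda>z. (- z) * k (- z)) \<midarrow>0\<rightarrow> deriv A 0"
    by (rule filterlim_compose[OF L]) (auto intro!: filterlim_atI tendsto_eq_intros eventually_neq_at_within)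
  then have "(\<lambda>z. - (z * k z)) \<midarrow>0\<rightarrow> deriv A 0"
    by (rule Lim_transform_eventually)
       (use evS S_lat even in \<open>auto elim!: eventually_mono\<close>)
  moreover have "(\<lambda>z. - (z * k z)) \<midarrow>0\<rightarrow> - deriv A 0"
    by (intro tendsto_minus L)
  ultimately have "deriv A 0 = - deriv A 0" by (rule LIM_unique)
  then have "deriv A 0 = 0" by (simp add: eq_neg_iff_add_eq_0)
  with L have L0: "((\<lambda>z. (z - 0) * k z) \<longlongrightarrow> 0) (at 0)" by simp
  have "\<exists>g. g holomorphic_on S \<and> (\<forall>z\<in>S - {0}. g z = k z)"
    by (subst holomorphic_on_extend_lim) (use k_hol S L0 in auto)
  then obtain g where g: "g holomorphic_on S" "\<And>z. z \<in> S - {0} \<Longrightarrow> g z = k z" by blast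
  define K where "K = (\<lambda>z. if z \<in> lat \<tau> then g 0 else k z)"
  have K_per: "K (z + l) = K z" if "l \<in> lat \<tau>" for z l
    using per[of z l] that by (auto simp: K_def lat_add_iff)
  have "K analytic_on {z}" for z
  proof (cases "z \<in> lat \<tau>")
    case False
    have "K holomorphic_on - lat \<tau>"
      by (rule holomorphic_transform[OF hol]) (auto simp: K_def)
    then show ?thesis
      using False open_Compl_lat[OF \<tau>] by (intro holomorphic_on_imp_analytic_at) auto
  next
    case True
    have "K w = g (w - z)" if "w \<in> ball z r" for w
    proof -
      have "K w = K (w - z)" using K_per[OF True, of "w - z"] by simp
      also have "\<dots> = g (w - z)"
      proof (cases "w = z")
        case False
        then have "w - z \<in> S - {0}" using that by (auto simp: S_def dist_norm norm_minus_commute)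
        then show ?thesis using g(2) S_lat by (auto simp: K_def)
      qed (auto simp: K_def)
      finally show ?thesis .
    qed
    moreover have "(g \<circ> (\<lambda>w. w - z)) holomorphic_on ball z r"
      by (intro holomorphic_on_compose_gen[OF _ g(1)] holomorphic_intros)
         (auto simp: S_def dist_norm norm_minus_commute)
    ultimately have "K holomorphic_on ball z r"
      by (subst holomorphic_cong[OF refl]) (auto simp: o_def)
    then show ?thesis by (rule holomorphic_on_imp_analytic_at) (use r in auto)
  qed
  then have K_hol: "K holomorphic_on UNIV"
    using analytic_imp_holomorphic analytic_on_analytic_at by blast
  \<comment> \<open>Every value is already taken on the closed period parallelogram, which is
    compact.\<close>
  have "range K \<subseteq> K ` ((\<lambda>(s, t). of_real s * \<tau> + of_real t) ` ({0..1} \<times> {0..1}))"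
  proof safe
    fix z
    define s where "s = Im z / Im \<tau>"
    define t where "t = Re z - s * Re \<tau>"
    have z: "z = of_real s * \<tau> + of_real t"
      using \<tau> by (auto simp: complex_eq_iff s_def t_def uhp_def)
    have "z = (of_real (frac s) * \<tau> + of_real (frac t)) + (of_int \<lfloor>s\<rfloor> * \<tau> + of_int \<lfloor>t\<rfloor>)"
      by (simp add: z frac_def algebra_simps)
    then have "K z = K (of_real (frac s) * \<tau> + of_real (frac t))"
      using K_per[of "of_int \<lfloor>s\<rfloor> * \<tau> + of_int \<lfloor>t\<rfloor>"] by (metis latI)
    moreover have "(frac s, frac t) \<in> {0..1} \<times> {0..1}"
      using frac_lt_1 by (auto intro: less_imp_le)
    ultimately show "K z \<in> K ` ((\<lambda>(s, t). of_real s * \<tau> + of_real t) ` ({0..1} \<times> {0..1}))"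
      by force
  qed
  moreover have "compact (K ` ((\<lambda>(s, t). of_real s * \<tau> + of_real t) ` ({0..1} \<times> {0..1})))"
    unfolding case_prod_unfold
    by (intro compact_continuous_image holomorphic_on_imp_continuous_on[OF holomorphic_on_subset[OF K_hol]]
          continuous_intros compact_Times) auto
  ultimately have "bounded (range K)"
    using bounded_subset compact_imp_bounded by blast
  then have "K constant_on UNIV"
    using K_hol Liouville_theorem by blast
  then have "K u = K v" by (auto simp: constant_on_def)
  with u v show ?thesis by (simp add: K_def)
qed

lemma Rfun_ee_lat:
  assumes "\<tau> \<in> uhp" "l \<in> lat \<tau>"
  shows "Rfun (ee (u + l)) (ee v) (ee \<tau>) = Rfun (ee u) (ee v) (ee \<tau>)"
proof -
  have n: "norm (ee \<tau>) < 1" by (rule norm_ee_less_1[OF assms(1)])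
  have 1: "Rfun (ee (u + of_nat k * \<tau>)) (ee v) (ee \<tau>) = Rfun (ee u) (ee v) (ee \<tau>)" for u k
  proof (induction k)
    case (Suc k)
    have "ee (u + of_nat (Suc k) * \<tau>) = ee \<tau> * ee (u + of_nat k * \<tau>)"
      by (simp add: ee_add[symmetric] algebra_simps)
    then show ?case using Suc n by (simp add: Rfun_shift)
  qed auto
  obtain a b where l: "l = of_int a * \<tau> + of_int b" using assms(2) unfolding lat_def by blast
  have 2: "ee (u + l) = ee (u + of_int a * \<tau>)"
    by (simp add: l ee_add)
  show ?thesis
  proof (cases "a \<ge> 0")
    case True
    then show ?thesis using 1[of u "nat a"] by (simp add: 2)
  next
    case False
    then show ?thesis using 1[of "u + of_int a * \<tau>" "nat (- a)"] by (simp add: 2)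
  qed
qed

lemma Rfun_ee_minus:
  assumes "\<tau> \<in> uhp"
  shows "Rfun (ee (- u)) (ee v) (ee \<tau>) = Rfun (ee u) (ee v) (ee \<tau>)"
  unfolding ee_minus by (rule Rfun_inverse) (simp_all add: norm_ee_less_1 assms)

lemma Rfun_ee_swap:
  assumes "\<tau> \<in> uhp"
  shows "Rfun (ee v) (ee u) (ee \<tau>) = - Rfun (ee u) (ee v) (ee \<tau>)"
  by (rule Rfun_swap) (simp_all add: norm_ee_less_1 assms)

lemma Rfun_ee_holomorphic:
  assumes "\<tau> \<in> uhp" "v \<notin> lat \<tau>"
  shows "(\<lambda>u. Rfun (ee u) (ee v) (ee \<tau>)) holomorphic_on - lat \<tau>"
proof -
  have "(\<lambda>u. ee v * phi (ee \<tau>) (ee \<tau>) ^ 4 * Theta (ee (u + v)) (ee \<tau>) * Theta (ee (u - v)) (ee \<tau>) /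
           (Theta (ee u) (ee \<tau>) ^ 2 * Theta (ee v) (ee \<tau>) ^ 2)) holomorphic_on - lat \<tau>"
    by (intro holomorphic_intros assms open_Compl_lat) (use assms Theta_ee_eq_0_iff in auto)
  then show ?thesis
    by (simp add: Rfun_def ee_add ee_diff)
qed

text \<open>The leading coefficient of the double pole depends neither on v nor on \<tau>. This is
  what lets the double poles cancel in \<open>Rfun_moebius\<close>.\<close>

lemma Rfun_ee_limit:
  assumes "\<tau> \<in> uhp" "v \<notin> lat \<tau>"
  shows "((\<lambda>u. u ^ 2 * Rfun (ee u) (ee v) (ee \<tau>)) \<longlongrightarrow> - 1 / (2 * of_real pi * \<i>) ^ 2) (at 0)"
proof -
  define q where "q = ee \<tau>"
  have q: "norm q < 1" "q \<noteq> 0" by (simp_all add: q_def norm_ee_less_1 assms)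
  \<comment> \<open>\<open>G\<close> is the theta function without its zero factor 1 - e(u), so
    \<open>M\<close> is the part of \<open>Rfun\<close> that is regular at 0.\<close>
  define G where "G = (\<lambda>u. phi (ee (u + \<tau>)) q * phi (ee (\<tau> - u)) q)"
  define M where "M = (\<lambda>u. ee v * phi q q ^ 4 * Theta (ee (u + v)) (ee \<tau>) * Theta (ee (u - v)) (ee \<tau>) /
                     (G u ^ 2 * Theta (ee v) q ^ 2))"
  have cont: "isCont G 0" "isCont (\<lambda>u. Theta (ee (u + v)) (ee \<tau>)) 0" "isCont (\<lambda>u. Theta (ee (u - v)) (ee \<tau>)) 0"
    unfolding G_def
    by (rule holomorphic_on_imp_continuous_on[of _ UNIV, unfolded continuous_on_eq_continuous_at[OF open_UNIV], rule_format],
        intro holomorphic_intros assms, use q in auto)+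
  have G0: "G 0 = phi q q ^ 2"
    by (simp add: G_def q_def power2_eq_square)
  have nz: "phi q q \<noteq> 0" "Theta (ee v) q \<noteq> 0"
    using phi_nonzero q Theta_ee_eq_0_iff assms by (auto simp: q_def)
  have "isCont M 0"
    unfolding M_def by (intro continuous_intros cont) (use nz G0 in auto)
  moreover have "M 0 = - 1"
  proof -
    have "Theta (ee (- v)) q = - Theta (ee v) q / ee v"
      using Theta_inverse[OF q(1), of "ee v"] by (simp add: ee_minus)
    then have "M 0 = - (phi q q ^ 4 * Theta (ee v) q ^ 2 / ((phi q q ^ 2) ^ 2 * Theta (ee v) q ^ 2))"
      by (simp add: M_def G0 power2_eq_square[of "Theta (ee v) q"] flip: q_def)
    then show ?thesis using nz by simp
  qed
  ultimately have lim1: "M \<midarrow>0\<rightarrow> - 1" by (metis isContD)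
  have "(ee has_field_derivative 2 * of_real pi * \<i>) (at 0)"
    unfolding ee_def [abs_def] by (auto intro!: derivative_eq_intros)
  then have "(\<lambda>u. (ee u - 1) / u) \<midarrow>0\<rightarrow> 2 * of_real pi * \<i>"
    by (simp add: has_field_derivative_iff)
  then have "(\<lambda>u. M u / ((ee u - 1) / u) ^ 2) \<midarrow>0\<rightarrow> - 1 / (2 * of_real pi * \<i>) ^ 2"
    by (intro tendsto_intros lim1) auto
  moreover have "M u / ((ee u - 1) / u) ^ 2 = u ^ 2 * Rfun (ee u) (ee v) (ee \<tau>)" for u
  proof -
    have "Theta (ee u) q = (1 - ee u) * G u"
      using phi_shift[OF q(1), of "ee u"] by (simp add: Theta_def G_def q_def ee_add ee_diff)
    then have "Rfun (ee u) (ee v) (ee \<tau>) = M u / (1 - ee u) ^ 2"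
      by (simp add: Rfun_def M_def q_def[symmetric] ee_add ee_diff power_mult_distrib)
    also have "(1 - ee u) ^ 2 = (ee u - 1) ^ 2" by (rule power2_commute)
    finally show ?thesis by (simp add: power_divide)
  qed
  ultimately show ?thesis by simp
qed

text \<open>The matrix is a change of basis of the lattice followed by the homothety 1/j; the new
  coordinates are obtained from the inverse matrix.\<close>

lemma lat_moebius:
  fixes a b c d :: int
  assumes "a * d - b * c = 1" "\<tau> \<in> uhp"
  defines "j \<equiv> of_int c * \<tau> + of_int d"
  shows "u / j \<in> lat (moebius_transform a b c d \<tau>) \<longleftrightarrow> u \<in> lat \<tau>"
proof -
  have j: "j \<noteq> 0"
    using moebius_transform_denom_nonzero[of a d b c \<tau>] assms by simp
  have det: "of_int a * of_int d - of_int b * of_int c = (1 :: complex)"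
    using arg_cong[OF assms(1), of of_int] by simp
  show ?thesis
  proof
    assume "u \<in> lat \<tau>"
    then obtain m n where u: "u = of_int m * \<tau> + of_int n" unfolding lat_def by blast
    have "of_int (m * d - n * c) * (of_int a * \<tau> + of_int b) + of_int (n * a - m * b) * j =
            (of_int a * of_int d - of_int b * of_int c) * u"
      by (simp add: j_def u algebra_simps)
    then have "u = of_int (m * d - n * c) * (of_int a * \<tau> + of_int b) + of_int (n * a - m * b) * j"
      by (simp only: det mult_1)
    then have "u / j = of_int (m * d - n * c) * moebius_transform a b c d \<tau> + of_int (n * a - m * b)"
      using j by (simp add: moebius_transform_def add_divide_distrib ring_distribs del: of_int_diff of_int_mult flip: j_def)
    then show "u / j \<in> lat (moebius_transform a b c d \<tau>)" by (rule latI)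
  next
    assume "u / j \<in> lat (moebius_transform a b c d \<tau>)"
    then obtain m n where u: "u / j = of_int m * moebius_transform a b c d \<tau> + of_int n"
      unfolding lat_def mem_Collect_eq by (elim exE conjE) (rule that)
    have "u = of_int m * (of_int a * \<tau> + of_int b) + of_int n * j"
    proof -
      have "u = (u / j) * j" using j by simp
      also have "\<dots> = of_int m * (moebius_transform a b c d \<tau> * j) + of_int n * j"
        by (simp add: u algebra_simps)
      also have "moebius_transform a b c d \<tau> * j = of_int a * \<tau> + of_int b"
        using j by (simp add: moebius_transform_def flip: j_def)
      finally show ?thesis .
    qed
    also have "\<dots> = of_int (m * a + n * c) * \<tau> + of_int (m * b + n * d)"
      by (simp add: j_def algebra_simps)
    finally show "u \<in> lat \<tau>" by (rule latI)
  qed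
qed

text \<open>As functions of u both sides are even and elliptic for the lattice of \<tau>, with the
  same leading coefficient at the double pole. So \<open>even_elliptic_eq_0\<close> applies to their
  difference; the zero it asks for is u = v, where both sides vanish.\<close>

lemma Rfun_moebius:
  fixes a b c d :: int
  assumes det: "a * d - b * c = 1" and \<tau>: "\<tau> \<in> uhp" and v: "v \<notin> lat \<tau>" and u: "u \<notin> lat \<tau>"
  defines "j \<equiv> of_int c * \<tau> + of_int d"
  shows "Rfun (ee (u / j)) (ee (v / j)) (ee (moebius_transform a b c d \<tau>)) = j ^ 2 * Rfun (ee u) (ee v) (ee \<tau>)"
proof -
  define \<tau>' where "\<tau>' = moebius_transform a b c d \<tau>"
  have \<tau>': "\<tau>' \<in> uhp" using moebius_transform_in_uhp[of a d b c \<tau>] det \<tau> by (simp add: \<tau>'_def)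
  have j: "j \<noteq> 0"
    using moebius_transform_denom_nonzero[of a d b c \<tau>] det \<tau> by (simp add: j_def)
  note lat = lat_moebius[OF det \<tau>, folded \<tau>'_def j_def]
  have v': "v / j \<notin> lat \<tau>'" using lat v by simp
  define k where "k = (\<lambda>u. Rfun (ee (u / j)) (ee (v / j)) (ee \<tau>') - j ^ 2 * Rfun (ee u) (ee v) (ee \<tau>))"
  have per: "k (u + l) = k u" if "l \<in> lat \<tau>" for u l
  proof -
    have "l / j \<in> lat \<tau>'" using that lat by simp
    then show ?thesis
      using Rfun_ee_lat[OF \<tau>', of "l / j" "u / j"] Rfun_ee_lat[OF \<tau>, of l u] that
      by (simp add: k_def add_divide_distrib)
  qed
  have "((\<lambda>u. Rfun (ee u) (ee (v / j)) (ee \<tau>')) \<circ> (\<lambda>u. u / j)) holomorphic_on - lat \<tau>"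
    by (rule holomorphic_on_compose_gen[OF _ Rfun_ee_holomorphic[OF \<tau>' v']])
       (use lat j in \<open>auto intro!: holomorphic_intros\<close>)
  then have hol: "k holomorphic_on - lat \<tau>"
    unfolding k_def o_def by (intro holomorphic_intros Rfun_ee_holomorphic \<tau> v)
  have l1: "(\<lambda>u. j ^ 2 * ((u / j) ^ 2 * Rfun (ee (u / j)) (ee (v / j)) (ee \<tau>'))) \<midarrow>0\<rightarrow> j ^ 2 * (- 1 / (2 * of_real pi * \<i>) ^ 2)"
  proof (intro tendsto_intros filterlim_compose[OF Rfun_ee_limit[OF \<tau>' v']])
    show "filterlim (\<lambda>u. u / j) (at 0) (at 0)"
      using j by (intro filterlim_atI) (auto intro!: tendsto_eq_intros eventually_neq_at_within)
  qed
  have l2: "(\<lambda>u. j ^ 2 * (u ^ 2 * Rfun (ee u) (ee v) (ee \<tau>))) \<midarrow>0\<rightarrow> j ^ 2 * (- 1 / (2 * of_real pi * \<i>) ^ 2)"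
    by (intro tendsto_intros Rfun_ee_limit \<tau> v)
  have lim: "((\<lambda>u. u ^ 2 * k u) \<longlongrightarrow> 0) (at 0)"
    using tendsto_diff[OF l1 l2] j by (simp add: k_def field_simps)
  have "Rfun (ee z) (ee z) (ee t) = 0" if "t \<in> uhp" for z t
    using Theta_ee_eq_0_iff[OF that, of 0] by (simp add: Rfun_def)
  then have kv: "k v = 0" using \<tau> \<tau>' by (simp add: k_def)
  have "k u = 0"
  proof (rule even_elliptic_eq_0[OF \<tau> hol _ _ _ lim v kv u])
    show "k (- z) = k z" for z
      using Rfun_ee_minus[OF \<tau>', of "z / j"] Rfun_ee_minus[OF \<tau>, of z] by (simp add: k_def)
    show "k (z + 1) = k z" for z by (rule per) (auto intro!: latI[of _ 0 _ 1])
    show "k (z + \<tau>) = k z" for z by (rule per) (auto intro!: latI[of _ 1 _ 0])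
  qed
  then show ?thesis by (simp add: k_def \<tau>'_def)
qed


section \<open>The Hauptmodul of level 25\<close>

lemma lat_5:
  fixes m n :: int
  assumes "\<tau> \<in> uhp" "(of_int m * \<tau> + of_int n) / 5 \<in> lat \<tau>"
  shows "5 dvd m" "5 dvd n"
proof -
  obtain a b where ab: "(of_int m * \<tau> + of_int n) / 5 = of_int a * \<tau> + of_int b"
    using assms(2) unfolding lat_def by blast
  then have eq: "of_int m * \<tau> + of_int n = 5 * (of_int a * \<tau> + of_int b)"
    by simp
  have "of_int m = (5 * of_int a :: real)"
    using arg_cong[OF eq, of Im] assms(1) by (simp add: uhp_def flip: mult.assoc)
  then have m: "m = 5 * a" by linarith
  with eq have "(of_int n :: complex) = of_int (5 * b)"
    by (simp add: algebra_simps)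
  then have "n = 5 * b" by (simp only: of_int_eq_iff)
  with m show "5 dvd m" "5 dvd n" by auto
qed

text \<open>The Weierstrass difference at the 5-torsion points \<open>v = (r\<tau> + s) / 5\<close> and \<open>2v\<close>, of weight 2;
  the Hauptmodul of level 25 is a quotient of two of these.\<close>

definition Dv :: "int \<Rightarrow> int \<Rightarrow> complex \<Rightarrow> complex" where
  "Dv r s \<tau> = Rfun (ee ((of_int r * \<tau> + of_int s) / 5)) (ee (2 * ((of_int r * \<tau> + of_int s) / 5))) (ee \<tau>)"

text \<open>On the transformed lattice the torsion point with coordinate row (r, s) is 1/j times the
  point whose row is (r, s) times the matrix. The last hypothesis keeps that point off the lattice,
  and its double as well since 2 is invertible modulo 5.\<close>

lemma Dv_moebius:
  assumes det: "a * d - b * c = 1" and \<tau>: "\<tau> \<in> uhp" and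
    nz: "\<not> (5 dvd r * a + s * c \<and> 5 dvd r * b + s * d)"
  shows "Dv r s (moebius_transform a b c d \<tau>) =
           (of_int c * \<tau> + of_int d) ^ 2 * Dv (r * a + s * c) (r * b + s * d) \<tau>"
proof -
  define j where "j = of_int c * \<tau> + of_int d"
  have j: "j \<noteq> 0"
    using moebius_transform_denom_nonzero[of a d b c \<tau>] det \<tau> by (simp add: j_def)
  define v where "v = (of_int (r * a + s * c) * \<tau> + of_int (r * b + s * d)) / 5"
  have v: "v \<notin> lat \<tau>"
    using lat_5[OF \<tau>] nz unfolding v_def by blast
  have v2: "2 * v \<notin> lat \<tau>"
  proof
    assume "2 * v \<in> lat \<tau>"
    moreover have "2 * v = (of_int (2 * (r * a + s * c)) * \<tau> + of_int (2 * (r * b + s * d))) / 5"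
      by (simp add: v_def field_simps)
    ultimately have "5 dvd 2 * (r * a + s * c)" "5 dvd 2 * (r * b + s * d)"
      using lat_5[OF \<tau>, of "2 * (r * a + s * c)" "2 * (r * b + s * d)"] by argo+
    then have "5 dvd r * a + s * c" "5 dvd r * b + s * d" by presburger+
    with nz show False by blast
  qed
  have vj: "(of_int r * moebius_transform a b c d \<tau> + of_int s) / 5 = v / j"
  proof -
    have "of_int r * moebius_transform a b c d \<tau> + of_int s = (of_int r * (of_int a * \<tau> + of_int b) + of_int s * j) / j"
      using j by (simp add: moebius_transform_def j_def[symmetric] add_divide_distrib ring_distribs)
    also have "of_int r * (of_int a * \<tau> + of_int b) + of_int s * j = 5 * v"
      by (simp add: v_def j_def algebra_simps)
    finally show ?thesis by simp
  qed
  have "Dv r s (moebius_transform a b c d \<tau>) = Rfun (ee (v / j)) (ee (2 * v / j)) (ee (moebius_transform a b c d \<tau>))"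
    unfolding Dv_def vj by simp
  also have "\<dots> = j ^ 2 * Rfun (ee v) (ee (2 * v)) (ee \<tau>)"
    unfolding j_def by (rule Rfun_moebius) (use det \<tau> v v2 in auto)
  finally show ?thesis
    by (simp only: Dv_def j_def v_def)
qed

lemma Rfun_ee_lat2:
  assumes "\<tau> \<in> uhp" "l \<in> lat \<tau>"
  shows "Rfun (ee v) (ee (u + l)) (ee \<tau>) = Rfun (ee v) (ee u) (ee \<tau>)"
  using Rfun_ee_lat[OF assms, of u v] Rfun_ee_swap[OF assms(1), of "u + l" v] Rfun_ee_swap[OF assms(1), of u v] by simp

lemma Rfun_ee_minus2:
  assumes "\<tau> \<in> uhp"
  shows "Rfun (ee v) (ee (- u)) (ee \<tau>) = Rfun (ee v) (ee u) (ee \<tau>)"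
  using Rfun_ee_minus[OF assms, of u v] Rfun_ee_swap[OF assms(1), of "- u" v] Rfun_ee_swap[OF assms(1), of u v] by simp

lemma Dv_cong:
  assumes \<tau>: "\<tau> \<in> uhp" and "[r = r'] (mod 5)" "[s = s'] (mod 5)"
  shows "Dv r s \<tau> = Dv r' s' \<tau>"
proof -
  obtain k where k: "r = r' + 5 * k" using assms(2) by (metis cong_iff_lin cong_sym_eq)
  obtain l where l: "s = s' + 5 * l" using assms(3) by (metis cong_iff_lin cong_sym_eq)
  define v where "v = (of_int r' * \<tau> + of_int s') / 5"
  define w where "w = of_int k * \<tau> + of_int l"
  have w: "w \<in> lat \<tau>" "2 * w \<in> lat \<tau>"
    by (auto intro: latI[of _ k _ l] latI[of _ "2 * k" _ "2 * l"] simp: w_def algebra_simps)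
  have v: "(of_int r * \<tau> + of_int s) / 5 = v + w"
    by (simp add: v_def w_def k l field_simps)
  show ?thesis
    unfolding Dv_def v v_def[symmetric] ring_distribs
    by (simp add: Rfun_ee_lat Rfun_ee_lat2 w \<tau>)
qed

lemma Dv_minus:
  assumes \<tau>: "\<tau> \<in> uhp"
  shows "Dv (- r) (- s) \<tau> = Dv r s \<tau>"
proof -
  have *: "(of_int (- r) * \<tau> + of_int (- s)) / 5 = - ((of_int r * \<tau> + of_int s) / 5)"
    by (simp add: field_simps)
  show ?thesis
    unfolding Dv_def * mult_minus_right by (simp only: Rfun_ee_minus Rfun_ee_minus2 \<tau>)
qed

text \<open>Since 4v is congruent to -v modulo the lattice, doubling exchanges the two arguments up
  to sign, and \<open>Rfun\<close> is antisymmetric and even.\<close>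

lemma Dv_double:
  assumes \<tau>: "\<tau> \<in> uhp"
  shows "Dv (2 * r) (2 * s) \<tau> = - Dv r s \<tau>"
proof -
  define v where "v = (of_int r * \<tau> + of_int s) / 5"
  have 1: "(of_int (2 * r) * \<tau> + of_int (2 * s)) / 5 = 2 * v"
    by (simp add: v_def field_simps)
  have 2: "2 * (2 * v) = - v + (of_int r * \<tau> + of_int s)"
    by (simp add: v_def field_simps)
  have "of_int r * \<tau> + of_int s \<in> lat \<tau>" by (rule latI) (rule refl)
  then have "Dv (2 * r) (2 * s) \<tau> = Rfun (ee (2 * v)) (ee v) (ee \<tau>)"
    unfolding Dv_def 1 2 by (simp only: Rfun_ee_minus2 Rfun_ee_lat2 \<tau>)
  also have "\<dots> = - Rfun (ee v) (ee (2 * v)) (ee \<tau>)"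
    by (rule Rfun_ee_swap[OF \<tau>])
  finally show ?thesis by (simp add: Dv_def v_def)
qed

text \<open>The Legendre symbol modulo 5 on integers prime to 5; multiples of 5 receive the default
  value -1, so that it never vanishes.\<close>

definition chi5 :: "int \<Rightarrow> complex" where
  "chi5 k = (if k mod 5 = 1 \<or> k mod 5 = 4 then 1 else - 1)"

lemma chi5_nonzero [simp]: "chi5 k \<noteq> 0"
  by (simp add: chi5_def)

text \<open>The units modulo 5 are generated by 2, which acts by -1; hence they act through the
  quadratic character.\<close>

lemma Dv_mult:
  assumes \<tau>: "\<tau> \<in> uhp" and k: "\<not> 5 dvd k"
  shows "Dv (k * r) (k * s) \<tau> = chi5 k * Dv r s \<tau>"
proof -
  have "k mod 5 = 1 \<or> k mod 5 = 2 \<or> k mod 5 = 3 \<or> k mod 5 = 4"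
    using k by presburger
  moreover have "Dv (k * r) (k * s) \<tau> = Dv (k' * r) (k' * s) \<tau>" if "k mod 5 = k' mod 5" for k'
    by (intro Dv_cong \<tau> cong_mult cong_refl) (use that in \<open>auto simp: cong_def\<close>)
  from this[of 1] this[of 2] this[of "- 2"] this[of "- 1"]
  have "k mod 5 = 1 \<Longrightarrow> Dv (k * r) (k * s) \<tau> = Dv r s \<tau>" "k mod 5 = 4 \<Longrightarrow> Dv (k * r) (k * s) \<tau> = Dv r s \<tau>"
    "k mod 5 = 2 \<Longrightarrow> Dv (k * r) (k * s) \<tau> = - Dv r s \<tau>" "k mod 5 = 3 \<Longrightarrow> Dv (k * r) (k * s) \<tau> = - Dv r s \<tau>"
    using Dv_minus[OF \<tau>, of r s] Dv_double[OF \<tau>, of r s] Dv_minus[OF \<tau>, of "2 * r" "2 * s"] by auto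
  ultimately show ?thesis
    unfolding chi5_def by (elim disjE) simp_all
qed

lemma Dv_translate: "Dv 1 s \<tau> = Dv 1 0 (\<tau> + of_int s)"
  by (simp add: Dv_def ee_add)

section \<open>Product formulas at the 5-torsion points\<close>

definition Pq :: "complex \<Rightarrow> complex" where
  "Pq q = phi q q"

lemma Pq_holomorphic [holomorphic_intros]:
  "f holomorphic_on A \<Longrightarrow> open A \<Longrightarrow> (\<And>z. z \<in> A \<Longrightarrow> norm (f z) < 1) \<Longrightarrow> (\<lambda>z. Pq (f z)) holomorphic_on A"
  unfolding Pq_def by (intro holomorphic_intros)

lemma Pq_nonzero: "norm q < 1 \<Longrightarrow> Pq q \<noteq> 0"
  by (simp add: Pq_def phi_nonzero)

text \<open>This is \<eta>(z) / \<eta>(25 z) written in q; the fractional powers of q combine to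
  1/q.\<close>

definition hq :: "complex \<Rightarrow> complex" where
  "hq q = Pq q / (q * Pq (q ^ 25))"

definition zeta5 :: complex where
  "zeta5 = ee (1 / 5)"

lemma zeta5_power_5: "zeta5 ^ 5 = 1"
  using ee_of_nat_mult[of 5 "1/5"] by (simp add: zeta5_def)

lemma zeta5_cyclotomic: "1 + zeta5 + zeta5 ^ 2 + zeta5 ^ 3 + zeta5 ^ 4 = 0"
proof -
  have "zeta5 \<noteq> 1"
  proof
    assume "zeta5 = 1"
    then have "ee (1 / 5) = ee 0" by (simp add: zeta5_def)
    then obtain n :: int where "1 / 5 = 0 + (of_int n :: complex)" unfolding ee_eq_iff by blast
    then have "of_int (5 * n) = (of_int 1 :: complex)" by (simp add: field_simps)
    then have "1 = 5 * n" unfolding of_int_eq_iff by simp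
    then show False by presburger
  qed
  moreover have "(zeta5 - 1) * (1 + zeta5 + zeta5 ^ 2 + zeta5 ^ 3 + zeta5 ^ 4) = zeta5 ^ 5 - 1"
    by (simp add: algebra_simps eval_nat_numeral)
  ultimately show ?thesis by (simp add: zeta5_power_5)
qed

text \<open>The two Gauss periods are the roots of X^2 + X - 1. Calculating with them avoids long
  expansions in powers of the root of unity.\<close>

lemma zeta5_periods:
  defines "s \<equiv> zeta5 + zeta5 ^ 4"
  shows "zeta5 ^ 2 + zeta5 ^ 3 = - 1 - s" "s * (- 1 - s) = - 1"
proof -
  show t: "zeta5 ^ 2 + zeta5 ^ 3 = - 1 - s"
    using zeta5_cyclotomic unfolding s_def by Groebner_Basis.algebra
  have z6: "zeta5 ^ 6 = zeta5" "zeta5 ^ 7 = zeta5 ^ 2" 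
    using zeta5_power_5 by (simp_all add: eval_nat_numeral)
  have "s * (zeta5 ^ 2 + zeta5 ^ 3) = zeta5 ^ 3 + zeta5 ^ 4 + zeta5 ^ 6 + zeta5 ^ 7"
    by (simp add: s_def algebra_simps eval_nat_numeral)
  also have "\<dots> = - 1"
    using zeta5_cyclotomic unfolding z6 by Groebner_Basis.algebra
  finally show "s * (- 1 - s) = - 1" unfolding t .
qed

lemma zeta5_prod: "(\<Prod>k<5. 1 - zeta5 ^ k * x) = 1 - x ^ 5"
proof -
  define s where "s = zeta5 + zeta5 ^ 4"
  note st = zeta5_periods[folded s_def]
  have "{..<5::nat} = {0, 1, 2, 3, 4}" by auto
  then have "(\<Prod>k<5. 1 - zeta5 ^ k * x) = (1 - x) * ((1 - zeta5 * x) * (1 - zeta5 ^ 4 * x)) * ((1 - zeta5 ^ 2 * x) * (1 - zeta5 ^ 3 * x))"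
    by simp
  also have "(1 - zeta5 * x) * (1 - zeta5 ^ 4 * x) = 1 - s * x + zeta5 ^ 5 * x ^ 2"
    by (simp add: s_def algebra_simps eval_nat_numeral)
  also have "(1 - zeta5 ^ 2 * x) * (1 - zeta5 ^ 3 * x) = 1 - (zeta5 ^ 2 + zeta5 ^ 3) * x + zeta5 ^ 5 * x ^ 2"
    by (simp add: algebra_simps eval_nat_numeral)
  also have "(1 - x) * (1 - s * x + zeta5 ^ 5 * x ^ 2) * (1 - (zeta5 ^ 2 + zeta5 ^ 3) * x + zeta5 ^ 5 * x ^ 2) =
               (1 - x) * ((1 + x ^ 2) ^ 2 + (1 + x ^ 2) * x + (s * (- 1 - s)) * x ^ 2)"
    unfolding st(1) zeta5_power_5 by (simp add: algebra_simps eval_nat_numeral)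
  also have "\<dots> = 1 - x ^ 5"
    unfolding st(2) by (simp add: algebra_simps eval_nat_numeral)
  finally show ?thesis .
qed

text \<open>The ratio of the normalisations of the two torsion values, and a square root of 5. Its
  sign is immaterial, since the inversion formula contains only the square.\<close>

definition c5 :: complex where
  "c5 = - (zeta5 * (1 - zeta5) * (1 - zeta5 ^ 2))"

lemma c5_square: "c5 ^ 2 = 5"
proof -
  define s where "s = zeta5 + zeta5 ^ 4"
  note st = zeta5_periods[folded s_def]
  have "c5 = (zeta5 ^ 2 + zeta5 ^ 3) - s"
    by (simp add: c5_def s_def algebra_simps eval_nat_numeral)
  also have "\<dots> = - 1 - 2 * s" unfolding st(1) by simp
  also have "(- 1 - 2 * s) ^ 2 = 1 - 4 * (s * (- 1 - s))"
    by (simp add: algebra_simps power2_eq_square)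
  finally show ?thesis unfolding st(2) by simp
qed

text \<open>The exponents 1 to 5 are grouped as {1, 4}, {2, 3} and {5}.\<close>

lemma Theta_prod_Q:
  assumes "norm Q < 1" "Q \<noteq> 0"
  shows "Theta Q (Q ^ 5) * Theta (Q ^ 2) (Q ^ 5) * Pq (Q ^ 5) = Pq Q"
proof -
  have "Q ^ 5 / Q = Q ^ 4" "Q ^ 5 / Q ^ 2 = Q ^ 3"
    using assms by (simp_all add: field_simps eval_nat_numeral)
  moreover have "Pq Q = (\<Prod>j<5. phi (Q * Q ^ j) (Q ^ 5))"
    unfolding Pq_def by (rule phi_residues) (use assms in auto)
  moreover have "{..<5::nat} = {0, 1, 2, 3, 4}" by auto
  ultimately show ?thesis
    by (simp add: Theta_def Pq_def eval_nat_numeral mult_ac)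
qed

text \<open>The primitive fifth roots of unity occur in the two theta functions in inverse pairs,
  the trivial root in \<open>Pq q\<close>; \<open>phi_shift\<close> splits off the two leading
  factors.\<close>

lemma Theta_prod_zeta:
  assumes "norm q < 1"
  shows "Theta zeta5 q * Theta (zeta5 ^ 2) q * Pq q = (1 - zeta5) * (1 - zeta5 ^ 2) * Pq (q ^ 5)"
proof -
  have z: "zeta5 \<noteq> 0" by (simp add: zeta5_def)
  have "q / zeta5 = zeta5 ^ 4 * q" "q / zeta5 ^ 2 = zeta5 ^ 3 * q"
    using z zeta5_power_5 by (simp_all add: field_simps eval_nat_numeral)
  moreover have "Pq (q ^ 5) = (\<Prod>k<5. phi (zeta5 ^ k * q) q)"
    unfolding Pq_def by (rule phi_roots_of_unity[symmetric]) (use assms zeta5_prod in auto)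
  moreover have "{..<5::nat} = {0, 1, 2, 3, 4}" by auto
  moreover have "phi zeta5 q = (1 - zeta5) * phi (zeta5 * q) q"
    by (rule phi_shift[OF assms])
  moreover have "phi (zeta5 ^ 2) q = (1 - zeta5 ^ 2) * phi (zeta5 ^ 2 * q) q"
    by (rule phi_shift[OF assms])
  ultimately show ?thesis
    by (simp add: Theta_def Pq_def)
qed

lemma ee_fifth_power: "ee (\<tau> / 5) ^ 5 = ee \<tau>"
  using ee_of_nat_mult[of 5 "\<tau> / 5"] by simp

lemma norm_ee_div: "\<tau> \<in> uhp \<Longrightarrow> n > 0 \<Longrightarrow> norm (ee (\<tau> / of_nat n)) < 1"
  by (simp add: norm_ee uhp_def)

lemma norm_ee_fifth: "\<tau> \<in> uhp \<Longrightarrow> norm (ee (\<tau> / 5)) < 1"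
  using norm_ee_div[of \<tau> 5] by simp

text \<open>At v = \<tau>/5 the thetas in the numerator have arguments Q^3 and 1/Q. Both reduce to
  those in the denominator: Q^3 is the reflection of Q^2 for the nome Q^5, and 1/Q is the inverse of
  Q.\<close>

lemma Dv_1_0:
  assumes \<tau>: "\<tau> \<in> uhp"
  shows "Dv 1 0 \<tau> = - (ee (\<tau> / 5) * Pq (ee \<tau>) ^ 5 / Pq (ee (\<tau> / 5)))"
proof -
  define Q where "Q = ee (\<tau> / 5)"
  have q: "ee \<tau> = Q ^ 5" by (simp add: Q_def ee_fifth_power)
  have Q: "norm Q < 1" "Q \<noteq> 0" by (simp_all add: Q_def norm_ee_fifth \<tau>)
  have nq: "norm (Q ^ 5) < 1" using norm_ee_less_1[OF \<tau>] by (simp add: q)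
  have Q2: "ee (2 * (\<tau> / 5)) = Q ^ 2"
    using ee_of_nat_mult[of 2 "\<tau> / 5"] by (simp add: Q_def)
  have T3: "Theta (Q ^ 3) (Q ^ 5) = Theta (Q ^ 2) (Q ^ 5)"
    using Q by (simp add: Theta_def power_diff[symmetric] del: power_Suc)
  have Tm: "Theta (Q / Q ^ 2) (Q ^ 5) = - Theta Q (Q ^ 5) / Q"
    using Theta_inverse[OF nq Q(2)] Q by (simp add: power2_eq_square)
  have nz: "Theta Q (Q ^ 5) \<noteq> 0" "Theta (Q ^ 2) (Q ^ 5) \<noteq> 0" "Pq (Q ^ 5) \<noteq> 0"
    using Theta_prod_Q[OF Q] Pq_nonzero[OF Q(1)] by auto
  have "Dv 1 0 \<tau> = Rfun Q (Q ^ 2) (Q ^ 5)"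
  proof -
    have "(of_int 1 * \<tau> + of_int 0) / 5 = \<tau> / 5" by simp
    then show ?thesis
      by (simp only: Dv_def Q2 q Q_def[symmetric])
  qed
  also have "\<dots> = Q ^ 2 * Pq (Q ^ 5) ^ 4 * Theta (Q ^ 3) (Q ^ 5) * Theta (Q / Q ^ 2) (Q ^ 5) /
               (Theta Q (Q ^ 5) ^ 2 * Theta (Q ^ 2) (Q ^ 5) ^ 2)"
    by (simp add: Rfun_def Pq_def power3_eq_cube power2_eq_square mult_ac)
  also have "\<dots> = - (Q * Pq (Q ^ 5) ^ 4 / (Theta Q (Q ^ 5) * Theta (Q ^ 2) (Q ^ 5)))"
    unfolding T3 Tm using nz Q by (simp add: power2_eq_square)
  also have "\<dots> = - (Q * Pq (Q ^ 5) ^ 5 / (Theta Q (Q ^ 5) * Theta (Q ^ 2) (Q ^ 5) * Pq (Q ^ 5)))"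
    using nz by (simp add: eval_nat_numeral)
  finally show ?thesis by (simp add: Theta_prod_Q[OF Q] q flip: Q_def)
qed

lemma Dv_0_1:
  assumes \<tau>: "\<tau> \<in> uhp"
  shows "Dv 0 1 \<tau> = Pq (ee \<tau>) ^ 5 / (zeta5 * (1 - zeta5) * (1 - zeta5 ^ 2) * Pq (ee \<tau> ^ 5))"
proof -
  define q where "q = ee \<tau>"
  have q: "norm q < 1" by (simp add: q_def norm_ee_less_1 \<tau>)
  have q5: "norm (q ^ 5) < 1" using q by (simp add: norm_power power_less_one_iff)
  have z: "zeta5 \<noteq> 0" by (simp add: zeta5_def)
  have z2: "ee (2 * (1 / 5)) = zeta5 ^ 2"
    using ee_of_nat_mult[of 2 "1 / 5"] by (simp add: zeta5_def)
  have z3: "zeta5 ^ 3 = 1 / zeta5 ^ 2"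
    using z zeta5_power_5 by (simp add: field_simps eval_nat_numeral)
  have T3: "Theta (zeta5 ^ 3) q = - Theta (zeta5 ^ 2) q / zeta5 ^ 2"
    unfolding z3 by (rule Theta_inverse[OF q]) (use z in simp)
  have Tm: "Theta (zeta5 / zeta5 ^ 2) q = - Theta zeta5 q / zeta5"
    using Theta_inverse[OF q z] z by (simp add: power2_eq_square)
  have "c5 \<noteq> 0" using c5_square by auto
  then have nz: "Theta zeta5 q \<noteq> 0" "Theta (zeta5 ^ 2) q \<noteq> 0" "Pq q \<noteq> 0"
    using Theta_prod_zeta[OF q] Pq_nonzero[OF q5] by (auto simp: c5_def)
  have "Dv 0 1 \<tau> = Rfun zeta5 (zeta5 ^ 2) q"
    unfolding Dv_def by (simp add: z2[simplified] zeta5_def[symmetric] q_def)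
  also have "\<dots> = zeta5 ^ 2 * Pq q ^ 4 * Theta (zeta5 ^ 3) q * Theta (zeta5 / zeta5 ^ 2) q /
               (Theta zeta5 q ^ 2 * Theta (zeta5 ^ 2) q ^ 2)"
    by (simp add: Rfun_def Pq_def power3_eq_cube power2_eq_square mult_ac)
  also have "\<dots> = Pq q ^ 4 / (zeta5 * (Theta zeta5 q * Theta (zeta5 ^ 2) q))"
    unfolding T3 Tm using nz z by (simp add: power2_eq_square)
  also have "\<dots> = Pq q ^ 5 / (zeta5 * (Theta zeta5 q * Theta (zeta5 ^ 2) q * Pq q))"
    using nz by (simp add: eval_nat_numeral)
  finally show ?thesis unfolding Theta_prod_zeta[OF q] by (simp only: q_def mult.assoc)
qed

text \<open>Both torsion values contain the fifth power of \<open>Pq (ee \<tau>)\<close>; it cancels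
  and leaves the eta quotient.\<close>

lemma hq_eq_Dv:
  assumes \<tau>: "\<tau> \<in> uhp"
  shows "hq (ee (\<tau> / 5)) = c5 * Dv 0 1 \<tau> / Dv 1 0 \<tau>"
proof -
  define Q where "Q = ee (\<tau> / 5)"
  have q: "ee \<tau> = Q ^ 5" by (simp add: Q_def ee_fifth_power)
  have Q: "norm Q < 1" "Q \<noteq> 0" by (simp_all add: Q_def norm_ee_fifth \<tau>)
  have nq: "norm (Q ^ 5) < 1" using norm_ee_less_1[OF \<tau>] by (simp add: q)
  have "(Q ^ 5) ^ 5 = Q ^ 25" by (simp flip: power_mult)
  moreover have "norm (Q ^ 25) < 1" using Q by (simp add: norm_power power_less_one_iff)
  moreover define K where "K = zeta5 * (1 - zeta5) * (1 - zeta5 ^ 2)"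
  have c5: "c5 = - K" by (simp add: c5_def K_def)
  then have "K \<noteq> 0" using c5_square by auto
  ultimately show ?thesis
    unfolding Dv_1_0[OF \<tau>] Dv_0_1[OF \<tau>] q hq_def Q_def[symmetric] K_def[symmetric] c5
    using Pq_nonzero[OF nq] Pq_nonzero[OF Q(1)] Pq_nonzero[of "Q ^ 25"] Q(2)
    by simp
qed

text \<open>The factors of weight 2 cancel in the quotient. No row of a matrix of determinant 1 is
  divisible by 5, so \<open>Dv_moebius\<close> applies to both rows.\<close>

lemma hq_moebius:
  assumes det: "a * d - b * c = 1" and \<tau>: "\<tau> \<in> uhp"
  shows "hq (ee (moebius_transform a b c d \<tau> / 5)) = c5 * Dv c d \<tau> / Dv a b \<tau>"
proof -
  have \<tau>': "moebius_transform a b c d \<tau> \<in> uhp" using moebius_transform_in_uhp[of a d b c \<tau>] det \<tau> by simp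
  have j: "of_int c * \<tau> + of_int d \<noteq> 0"
    using moebius_transform_denom_nonzero[of a d b c \<tau>] det \<tau> by simp
  have False if "5 dvd a" "5 dvd b"
  proof -
    have "5 dvd a * d - b * c" using that by simp
    then show False using det by simp
  qed
  moreover have False if "5 dvd c" "5 dvd d"
  proof -
    have "5 dvd a * d - b * c" using that by simp
    then show False using det by simp
  qed
  ultimately have "Dv 0 1 (moebius_transform a b c d \<tau>) = (of_int c * \<tau> + of_int d) ^ 2 * Dv c d \<tau>"
    "Dv 1 0 (moebius_transform a b c d \<tau>) = (of_int c * \<tau> + of_int d) ^ 2 * Dv a b \<tau>"
    using Dv_moebius[OF det \<tau>, of 0 1] Dv_moebius[OF det \<tau>, of 1 0] by auto
  then show ?thesis
    unfolding hq_eq_Dv[OF \<tau>'] using j by simp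
qed

text \<open>Modulo 5 the rows are (a, 0) and (0, d) with a d = 1, so both torsion values are
  multiplied by the same character value.\<close>

lemma hq_invariant:
  assumes det: "a * d - b * c = 1" and \<tau>: "\<tau> \<in> uhp" and "5 dvd b" "5 dvd c"
  shows "hq (ee (moebius_transform a b c d \<tau> / 5)) = hq (ee (\<tau> / 5))"
proof -
  have ad: "[a * d = 1] (mod 5)"
    using det assms(3,4) by (metis cong_iff_dvd_diff diff_diff_eq2 add_diff_cancel_left' cong_sym dvd_mult2)
  have ad': "(a mod 5) * (d mod 5) mod 5 = 1"
    using ad by (simp add: cong_def mod_mult_eq)
  then have nd: "\<not> 5 dvd a" "\<not> 5 dvd d"
    by (auto simp: dvd_eq_mod_eq_0)
  note ad'
  moreover have "a mod 5 \<in> {0,1,2,3,4}" "d mod 5 \<in> {0,1,2,3,4}" by auto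
  ultimately have chi: "chi5 a = chi5 d"
    unfolding chi5_def by (elim insertE emptyE) simp_all
  have "Dv c d \<tau> = Dv (d * 0) (d * 1) \<tau>" "Dv a b \<tau> = Dv (a * 1) (a * 0) \<tau>"
    using assms(3,4) by (auto intro!: Dv_cong \<tau> simp: cong_0_iff)
  then show ?thesis
    unfolding hq_moebius[OF det \<tau>] hq_eq_Dv[OF \<tau>]
    by (simp only: Dv_mult[OF \<tau> nd(1)] Dv_mult[OF \<tau> nd(2)] chi) simp
qed

text \<open>The inversion swaps the two torsion values, so the product of the function with its
  image is \<open>c5 ^ 2\<close>.\<close>

lemma hq_Fricke:
  assumes \<tau>: "\<tau> \<in> uhp"
  shows "hq (ee (- 1 / \<tau> / 5)) = 5 / hq (ee (\<tau> / 5))"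
proof -
  have "hq (ee (- 1 / \<tau> / 5)) = c5 * Dv 1 0 \<tau> / Dv 0 1 \<tau>"
    using hq_moebius[of 0 0 "-1" 1 \<tau>] \<tau> Dv_minus[OF \<tau>, of 0 1] by (simp add: moebius_transform_def)
  also have "\<dots> = c5 ^ 2 / (c5 * Dv 0 1 \<tau> / Dv 1 0 \<tau>)"
  proof -
    have "c5 \<noteq> 0" using c5_square by auto
    then show ?thesis by (simp add: power2_eq_square)
  qed
  finally show ?thesis by (simp only: c5_square hq_eq_Dv[OF \<tau>])
qed

text \<open>If a and c are prime to 5, both rows can be scaled to the form (1, s), so numerator and
  denominator are translates of one torsion value up to constants. Their leading powers of q cancel,
  which leaves neither zero nor pole at the cusp.\<close>

lemma hq_unit:
  assumes det: "a * d - b * c = 1" and nd: "\<not> 5 dvd a" "\<not> 5 dvd c"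
  shows "\<exists>U. U holomorphic_on ball 0 1 \<and> (\<forall>Z\<in>ball 0 1. U Z \<noteq> 0) \<and>
           (\<forall>\<tau>\<in>uhp. hq (ee (moebius_transform a b c d \<tau> / 5)) = U (ee (\<tau> / 5)))"
proof -
  have inverse_ex: "\<exists>k'. [k * k' = 1] (mod 5)" if "\<not> 5 dvd k" for k :: int
  proof -
    have "coprime k 5" using that prime_imp_coprime[of 5 k] by (simp add: coprime_commute)
    then show ?thesis using cong_solve_coprime_int by blast
  qed
  obtain a' c' where a': "[a * a' = 1] (mod 5)" and c': "[c * c' = 1] (mod 5)"
    using inverse_ex nd by blast
  define s s' where "s = c' * d" and "s' = a' * b"
  have red: "Dv c d \<tau> = chi5 c * Dv 1 s \<tau>" "Dv a b \<tau> = chi5 a * Dv 1 s' \<tau>" if \<tau>: "\<tau> \<in> uhp" for \<tau>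
  proof -
    have "Dv c d \<tau> = Dv (c * 1) (c * s) \<tau>"
      using cong_mult[OF c' cong_refl[of d]] by (intro Dv_cong \<tau>) (auto simp: s_def mult_ac cong_sym_eq)
    then show "Dv c d \<tau> = chi5 c * Dv 1 s \<tau>" using Dv_mult[OF \<tau> nd(2), of 1 s] by simp
    have "Dv a b \<tau> = Dv (a * 1) (a * s') \<tau>"
      using cong_mult[OF a' cong_refl[of b]] by (intro Dv_cong \<tau>) (auto simp: s'_def mult_ac cong_sym_eq)
    then show "Dv a b \<tau> = chi5 a * Dv 1 s' \<tau>" using Dv_mult[OF \<tau> nd(1), of 1 s'] by simp
  qed
  define z where "z = (\<lambda>s::int. ee (of_int s / 5))"
  have nz: "norm (z s) = 1" for s by (simp add: z_def norm_ee)
  have nzX: "norm (z s * Z) < 1" if "Z \<in> ball 0 1" for Z s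
    using that by (simp add: norm_mult nz)
  define U where "U = (\<lambda>Z. c5 * (chi5 c / chi5 a) * (z s / z s') * (Pq (z s' * Z) / Pq (z s * Z)))"
  show ?thesis
  proof (intro exI[of _ U] conjI ballI)
    show "U holomorphic_on ball 0 1"
      unfolding U_def by (intro holomorphic_intros Pq_nonzero) (use nzX in auto)
    show "U Z \<noteq> 0" if "Z \<in> ball 0 1" for Z
      using Pq_nonzero[OF nzX[OF that]] c5_square by (auto simp: U_def z_def)
    fix \<tau> assume \<tau>: "\<tau> \<in> uhp"
    have D: "Dv 1 s \<tau> = - (z s * ee (\<tau> / 5) * Pq (ee \<tau>) ^ 5 / Pq (z s * ee (\<tau> / 5)))" for s
    proof -
      have "\<tau> + of_int s \<in> uhp" using \<tau> by (simp add: uhp_def)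
      then show ?thesis
        unfolding Dv_translate[of s] by (subst Dv_1_0) (simp_all add: ee_add add_divide_distrib z_def mult_ac)
    qed
    have Z: "ee (\<tau> / 5) \<in> ball 0 1" using norm_ee_fifth[OF \<tau>] by simp
    show "hq (ee (moebius_transform a b c d \<tau> / 5)) = U (ee (\<tau> / 5))"
      unfolding hq_moebius[OF det \<tau>] red[OF \<tau>] D U_def
      using Pq_nonzero[OF nzX[OF Z]] Pq_nonzero[OF norm_ee_less_1[OF \<tau>]]
      by (simp add: field_simps)
  qed
qed


section \<open>Meromorphic functions and Fourier expansions\<close>

lemma mero_eq_refl: "g meromorphic_on uhp \<Longrightarrow> mero_eq g g"
  by (simp add: mero_eq_def)

lemma abs_mero_eq_iff:
  assumes "f meromorphic_on uhp" "g meromorphic_on uhp"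
  shows "abs_mero f = abs_mero g \<longleftrightarrow> (\<forall>\<^sub>\<approx>z\<in>uhp. f z = g z)"
proof -
  have "mero_eq f f" "mero_eq g g" using assms by (simp_all add: mero_eq_refl)
  then have "abs_mero f = abs_mero g \<longleftrightarrow> mero_eq f g"
    using Quotient_rel[OF Quotient_mero, of f g] by blast
  then show ?thesis using assms by (simp add: mero_eq_def)
qed

lemma mero_cases:
  obtains g where "g meromorphic_on uhp" "f = abs_mero g"
proof -
  have "mero_eq (rep_mero f) (rep_mero f)"
    by (rule Quotient_rep_reflp[OF Quotient_mero])
  then show ?thesis
    using that[of "rep_mero f"] Quotient_abs_rep[OF Quotient_mero, of f] by (simp add: mero_eq_def)
qed

lemma abs_mero_arith:
  assumes "f meromorphic_on uhp" "g meromorphic_on uhp"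
  shows "abs_mero f + abs_mero g = abs_mero (\<lambda>z. f z + g z)"
    and "abs_mero f - abs_mero g = abs_mero (\<lambda>z. f z - g z)"
    and "abs_mero f * abs_mero g = abs_mero (\<lambda>z. f z * g z)"
    and "abs_mero f / abs_mero g = abs_mero (\<lambda>z. f z / g z)"
  using assms
  by (simp_all add: plus_mero.abs_eq minus_mero.abs_eq times_mero.abs_eq divide_mero.abs_eq mero_eq_refl)

lemma abs_mero_arith_unary:
  assumes "f meromorphic_on uhp"
  shows "- abs_mero f = abs_mero (\<lambda>z. - f z)"
    and "inverse (abs_mero f) = abs_mero (\<lambda>z. inverse (f z))"
  using assms by (simp_all add: uminus_mero.abs_eq inverse_mero.abs_eq mero_eq_refl)

definition const_mero :: "complex \<Rightarrow> mero" where
  "const_mero c = abs_mero (\<lambda>_. c)"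

lemma const_mero_0 [simp]: "const_mero 0 = 0"
  by (simp add: const_mero_def zero_mero_def)

lemma const_mero_1 [simp]: "const_mero 1 = 1"
  by (simp add: const_mero_def one_mero_def)

lemma const_mero_add: "const_mero (a + b) = const_mero a + const_mero b"
  by (simp add: const_mero_def abs_mero_arith abs_mero_arith_unary meromorphic_on_const)

lemma const_mero_diff: "const_mero (a - b) = const_mero a - const_mero b"
  by (simp add: const_mero_def abs_mero_arith abs_mero_arith_unary meromorphic_on_const)

lemma const_mero_minus: "const_mero (- a) = - const_mero a"
  by (simp add: const_mero_def abs_mero_arith abs_mero_arith_unary meromorphic_on_const)

lemma const_mero_mult: "const_mero (a * b) = const_mero a * const_mero b"
  by (simp add: const_mero_def abs_mero_arith abs_mero_arith_unary meromorphic_on_const)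

lemma const_mero_divide: "const_mero (a / b) = const_mero a / const_mero b"
  by (simp add: const_mero_def abs_mero_arith abs_mero_arith_unary meromorphic_on_const)

lemma const_mero_of_nat: "const_mero (of_nat n) = of_nat n"
  by (induction n) (simp_all add: const_mero_add)

lemma const_mero_of_int: "const_mero (of_int n) = of_int n"
  by (cases n) (simp_all add: const_mero_minus const_mero_diff const_mero_of_nat)

lemma const_mero_numeral: "const_mero (numeral n) = numeral n"
  using const_mero_of_nat[of "numeral n"] by simp

lemma const_mero_of_rat: "const_mero (of_rat r) = of_rat r"
  by (cases r) (simp add: of_rat_rat const_mero_divide const_mero_of_int)

lemma const_mero_eq_iff [simp]: "const_mero a = const_mero b \<longleftrightarrow> a = b"
proof -
  have "const_mero c \<noteq> 0" if "c \<noteq> 0" for c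
    using that const_mero_mult[of c "inverse c"] by auto
  from this[of "a - b"] show ?thesis by (auto simp: const_mero_diff)
qed

lemma pullback_abs_mero:
  assumes "a * d - b * c > 0" "f meromorphic_on uhp"
  shows "pullback a b c d (abs_mero f) = abs_mero (\<lambda>z. f (moebius_transform a b c d z))"
  using assms by (simp add: pullback.abs_eq mero_eq_refl)

lemma moebius_meromorphic:
  assumes "a * d - b * c > 0" "f meromorphic_on uhp"
  shows "(\<lambda>z. f (moebius_transform a b c d z)) meromorphic_on uhp"
  by (rule meromorphic_on_compose[OF assms(2) moebius_transform_analytic[OF assms(1)]])
     (use moebius_transform_in_uhp[OF assms(1)] in auto)

lemma pullback_arith:
  assumes "a * d - b * c > 0"
  shows "pullback a b c d (f + g) = pullback a b c d f + pullback a b c d g"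
    and "pullback a b c d (f - g) = pullback a b c d f - pullback a b c d g"
    and "pullback a b c d (f * g) = pullback a b c d f * pullback a b c d g"
    and "pullback a b c d (f / g) = pullback a b c d f / pullback a b c d g"
    and "pullback a b c d (- f) = - pullback a b c d f"
    and "pullback a b c d (inverse f) = inverse (pullback a b c d f)"
proof -
  obtain F where F: "F meromorphic_on uhp" "f = abs_mero F" by (rule mero_cases)
  obtain G where G: "G meromorphic_on uhp" "g = abs_mero G" by (rule mero_cases)
  note * = F G moebius_meromorphic[OF assms] pullback_abs_mero[OF assms] abs_mero_arith abs_mero_arith_unary
  show "pullback a b c d (f + g) = pullback a b c d f + pullback a b c d g"
    "pullback a b c d (f - g) = pullback a b c d f - pullback a b c d g"
    "pullback a b c d (f * g) = pullback a b c d f * pullback a b c d g"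
    "pullback a b c d (f / g) = pullback a b c d f / pullback a b c d g"
    "pullback a b c d (- f) = - pullback a b c d f"
    "pullback a b c d (inverse f) = inverse (pullback a b c d f)"
    by (simp_all add: * meromorphic_intros)
qed

lemma pullback_const: "a * d - b * c > 0 \<Longrightarrow> pullback a b c d (const_mero k) = const_mero k"
  by (simp add: const_mero_def pullback_abs_mero meromorphic_on_const)

lemma pullback_0: "a * d - b * c > 0 \<Longrightarrow> pullback a b c d 0 = 0"
  using pullback_const[of a d b c 0] by simp

lemma pullback_1: "a * d - b * c > 0 \<Longrightarrow> pullback a b c d 1 = 1"
  using pullback_const[of a d b c 1] by simp

lemma pullback_numeral: "a * d - b * c > 0 \<Longrightarrow> pullback a b c d (numeral k) = numeral k"
  using pullback_const[of a d b c "numeral k"] by (simp add: const_mero_numeral)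

lemma pullback_power: "a * d - b * c > 0 \<Longrightarrow> pullback a b c d (f ^ n) = pullback a b c d f ^ n"
  by (induction n) (simp_all add: pullback_1 pullback_arith)

lemma pullback_sum:
  "a * d - b * c > 0 \<Longrightarrow> pullback a b c d (sum f A) = (\<Sum>x\<in>A. pullback a b c d (f x))"
  by (induction A rule: infinite_finite_induct) (simp_all add: pullback_0 pullback_arith)

lemma pullback_id: "pullback 1 0 0 1 f = f"
proof -
  obtain F where F: "F meromorphic_on uhp" "f = abs_mero F" by (rule mero_cases)
  then show ?thesis by (simp add: pullback_abs_mero moebius_transform_def)
qed

lemma ee_div_in_ball: "z \<in> uhp \<Longrightarrow> N > 0 \<Longrightarrow> ee (z / of_nat N) \<in> ball 0 1 - {0}"
  using norm_ee_div[of z N] by simp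

lemma ball_minus_0_cases:
  assumes "q \<in> ball 0 1 - {0}" "N > 0"
  obtains z where "z \<in> uhp" "q = ee (z / of_nat N)"
proof -
  define z where "z = of_nat N * (Ln q / (2 * of_real pi * \<i>))"
  have q: "q = ee (z / of_nat N)"
    using assms by (simp add: ee_def z_def)
  have "exp (- (2 * pi * Im (z / of_nat N))) < 1"
    using assms(1) q norm_ee[of "z / of_nat N"] by simp
  then have "z \<in> uhp"
    using assms(2) by (simp add: uhp_def zero_less_mult_iff zero_less_divide_iff)
  with q that show ?thesis by blast
qed

lemma qcomp_meromorphic:
  assumes "F meromorphic_on ball 0 1" "N > 0"
  shows "(\<lambda>z. F (ee (z / of_nat N))) meromorphic_on uhp"
  by (rule meromorphic_on_compose[OF assms(1)])
     (use ee_div_in_ball assms in \<open>auto intro!: analytic_intros\<close>)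

text \<open>The value of F at 0 never enters, because e(z/N) does not vanish; statements about cusps
  therefore have to speak about F near 0.\<close>

definition qser :: "nat \<Rightarrow> (complex \<Rightarrow> complex) \<Rightarrow> mero" where
  "qser N F = abs_mero (\<lambda>z. F (ee (z / of_nat N)))"

lemma abs_mero_cong:
  assumes "\<And>z. z \<in> uhp \<Longrightarrow> f z = g z" "g meromorphic_on uhp"
  shows "abs_mero f = abs_mero g"
proof -
  have ev: "\<forall>\<^sub>\<approx>z\<in>uhp. f z = g z"
    using eventually_in_cosparse[of uhp uhp] by (auto elim!: eventually_mono simp: assms(1))
  have "f meromorphic_on uhp \<longleftrightarrow> g meromorphic_on uhp"
    by (intro meromorphic_on_cong') (use ev in auto)
  then show ?thesis using assms(2) ev by (simp add: abs_mero_eq_iff)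
qed

lemma qser_cong:
  assumes "\<And>q. q \<in> ball 0 1 - {0} \<Longrightarrow> F q = G q" "G meromorphic_on ball 0 1" "N > 0"
  shows "qser N F = qser N G"
  unfolding qser_def
  by (rule abs_mero_cong) (use assms ee_div_in_ball qcomp_meromorphic in auto)

lemma qser_const [simp]: "qser N (\<lambda>_. c) = const_mero c"
  by (simp add: qser_def const_mero_def)

lemma qser_arith:
  assumes "F meromorphic_on ball 0 1" "G meromorphic_on ball 0 1" "N > 0"
  shows "qser N F + qser N G = qser N (\<lambda>q. F q + G q)"
    and "qser N F - qser N G = qser N (\<lambda>q. F q - G q)"
    and "qser N F * qser N G = qser N (\<lambda>q. F q * G q)"
    and "qser N F / qser N G = qser N (\<lambda>q. F q / G q)"
  using qcomp_meromorphic[OF assms(1,3)] qcomp_meromorphic[OF assms(2,3)]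
  by (simp_all add: qser_def abs_mero_arith)

lemma qser_arith_unary:
  assumes "F meromorphic_on ball 0 1" "N > 0"
  shows "- qser N F = qser N (\<lambda>q. - F q)"
    and "inverse (qser N F) = qser N (\<lambda>q. inverse (F q))"
  using qcomp_meromorphic[OF assms] by (simp_all add: qser_def abs_mero_arith_unary)

lemma qser_power:
  assumes "F meromorphic_on ball 0 1" "N > 0"
  shows "qser N F ^ n = qser N (\<lambda>q. F q ^ n)"
proof (induction n)
  case (Suc n)
  then show ?case
    using qser_arith(3)[OF assms(1) meromorphic_on_power[OF assms(1)] assms(2), of n] by simp
qed simp

lemma qser_sum:
  assumes "\<And>i. i \<in> A \<Longrightarrow> F i meromorphic_on ball 0 1" "N > 0"
  shows "(\<Sum>i\<in>A. qser N (F i)) = qser N (\<lambda>q. \<Sum>i\<in>A. F i q)"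
  using assms(1)
proof (induction A rule: infinite_finite_induct)
  case (insert i A)
  then show ?case
    using qser_arith(1)[of "F i" "\<lambda>q. \<Sum>i\<in>A. F i q" N] assms(2) by (simp add: meromorphic_intros)
qed simp_all

lemma qser_cong_cosparse:
  assumes "F meromorphic_on ball 0 1" "G meromorphic_on ball 0 1" "N > 0" "\<forall>\<^sub>\<approx>q\<in>ball 0 1 - {0}. F q = G q"
  shows "qser N F = qser N G"
proof -
  have "\<forall>\<^sub>\<approx>z\<in>uhp. F (ee (z / of_nat N)) = G (ee (z / of_nat N))"
    unfolding eventually_cosparse_open_eq[OF open_uhp]
  proof
    fix z0 assume z0: "z0 \<in> uhp"
    define q0 where "q0 = ee (z0 / of_nat N)"
    have q0: "q0 \<in> ball 0 1 - {0}" unfolding q0_def using ee_div_in_ball[OF z0 assms(3)] .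
    have "open (ball 0 1 - {0 :: complex})" by auto
    then have ev: "eventually (\<lambda>q. F q = G q) (at q0)"
      using assms(4) q0 by (simp add: eventually_cosparse_open_eq)
    have "isCont (\<lambda>z. ee (z / of_nat N)) z0"
      unfolding ee_def using assms(3) by (intro continuous_intros) auto
    moreover have "eventually (\<lambda>z. z \<in> ball z0 1 - {z0}) (at z0)"
      by (intro eventually_at_in_open) auto
    \<comment> \<open>The periods of e(z/N) are the multiples of N, so points at distance less than
      1 are separated.\<close>
    then have "eventually (\<lambda>z. ee (z / of_nat N) \<noteq> q0) (at z0)"
    proof eventually_elim
      case (elim z)
      show ?case
      proof
        assume "ee (z / of_nat N) = q0"
        then obtain n :: int where "z / of_nat N = z0 / of_nat N + of_int n"
          unfolding q0_def ee_eq_iff by blast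
        then have "(z - z0) / of_nat N = of_int n" by (simp add: diff_divide_distrib)
        then have n: "z - z0 = of_int (n * int N)" using assms(3) by (simp add: divide_eq_eq)
        then have "\<bar>of_int (n * int N)\<bar> < (1::real)"
        proof -
          have "norm (z - z0) < 1" using elim by (simp add: dist_norm norm_minus_commute)
          then show ?thesis unfolding n norm_of_int .
        qed
        then have "n * int N = 0" by linarith
        with n have "z - z0 = of_int 0" by (simp only:)
        then show False using elim by simp
      qed
    qed
    ultimately have "filterlim (\<lambda>z. ee (z / of_nat N)) (at q0) (at z0)"
      by (auto simp: filterlim_at isCont_def q0_def)
    then show "\<forall>\<^sub>F z in at z0. F (ee (z / of_nat N)) = G (ee (z / of_nat N))"
      using ev unfolding filterlim_iff by blast
  qed
  then show ?thesis
    unfolding qser_def using assms by (subst abs_mero_eq_iff) (auto intro!: qcomp_meromorphic)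
qed

text \<open>Otherwise F - G would be invertible as a meromorphic function on the disc, and its
  product with the inverse would be sent both to 1 and, through the factor F - G, to 0.\<close>

lemma qser_eq_imp_cosparse:
  assumes "F meromorphic_on ball 0 1" "G meromorphic_on ball 0 1" "N > 0" "qser N F = qser N G"
  shows "\<forall>\<^sub>\<approx>q\<in>ball 0 1. F q = G q"
proof -
  have mero: "(\<lambda>q. F q - G q) meromorphic_on ball 0 1"
    using assms by (intro meromorphic_intros)
  show ?thesis
  proof (cases "\<forall>\<^sub>\<approx>q\<in>ball 0 1. F q - G q = 0")
    case False
    then have "\<forall>\<^sub>\<approx>q\<in>ball 0 1. F q - G q \<noteq> 0"
      using meromorphic_imp_constant_or_avoid[OF mero, of 0] by auto
    then have *: "\<forall>\<^sub>\<approx>q\<in>ball 0 1. F q \<noteq> G q" by (auto elim: eventually_mono)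
    define H where "H = (\<lambda>q. inverse (F q - G q) * (F q - G q))"
    have H: "H meromorphic_on ball 0 1"
      unfolding H_def using assms by (intro meromorphic_intros)
    have "qser N H = qser N (\<lambda>_. 1)"
    proof (rule qser_cong_cosparse)
      show "\<forall>\<^sub>\<approx>q\<in>ball 0 1 - {0}. H q = 1"
      proof -
        have "\<forall>q0\<in>ball 0 1. eventually (\<lambda>q. F q \<noteq> G q) (at q0)"
          using * by (simp add: eventually_cosparse_open_eq)
        then have "\<forall>q0\<in>ball 0 1 - {0}. eventually (\<lambda>q. H q = 1) (at q0)"
        proof (intro ballI)
          fix q0 :: complex assume "q0 \<in> ball 0 1 - {0}"
          then have "eventually (\<lambda>q. F q \<noteq> G q) (at q0)"
            using \<open>\<forall>q0\<in>ball 0 1. eventually (\<lambda>q. F q \<noteq> G q) (at q0)\<close> by blast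
          then show "eventually (\<lambda>q. H q = 1) (at q0)"
            by eventually_elim (simp add: H_def)
        qed
        moreover have "open (ball 0 1 - {0 :: complex})" by auto
        ultimately show ?thesis
          by (simp add: eventually_cosparse_open_eq)
      qed
    qed (use H assms in auto)
    moreover have "qser N H = qser N (\<lambda>q. inverse (F q - G q)) * qser N (\<lambda>q. F q - G q)"
      unfolding H_def using assms by (intro qser_arith(3)[symmetric] meromorphic_intros) auto
    moreover have "qser N (\<lambda>q. F q - G q) = 0"
      using qser_arith(2)[OF assms(1-3)] assms(4) by simp
    ultimately show ?thesis using assms by simp
  qed (auto elim: eventually_mono)
qed


lemma qser_eq_imp_eq:
  assumes F: "F meromorphic_on ball 0 1" "F holomorphic_on ball 0 1 - {0}"
    and G: "G meromorphic_on ball 0 1" "G holomorphic_on ball 0 1 - {0}"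
    and "N > 0" "qser N F = qser N G" "q \<in> ball 0 1 - {0}"
  shows "F q = G q"
proof -
  have "\<forall>\<^sub>\<approx>q\<in>ball 0 1. F q = G q"
    using assms by (intro qser_eq_imp_cosparse) auto
  then have ev: "eventually (\<lambda>q. F q = G q) (at q)"
    using assms(7) by (simp add: eventually_cosparse_open_eq)
  have "open (ball 0 1 - {0 :: complex})" by auto
  then have "F \<midarrow>q\<rightarrow> F q" "G \<midarrow>q\<rightarrow> G q"
    using assms by (meson continuous_on_eq_continuous_at holomorphic_on_imp_continuous_on isContD)+
  with ev show ?thesis
    by (metis Lim_transform_eventually LIM_unique)
qed

lemma holomorphic_imp_meromorphic: "F holomorphic_on A \<Longrightarrow> open A \<Longrightarrow> F meromorphic_on A"
  by (simp add: analytic_on_imp_meromorphic_on analytic_on_open)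

text \<open>Agreement off 0 extends to 0 by continuity, which makes the constant term at a cusp well
  defined.\<close>

lemma qser_eq_imp_eq_holomorphic:
  assumes "F holomorphic_on ball 0 1" "G holomorphic_on ball 0 1"
    and "N > 0" "qser N F = qser N G" "q \<in> ball 0 1"
  shows "F q = G q"
proof -
  have eq: "F q = G q" if "q \<in> ball 0 1 - {0}" for q
    by (rule qser_eq_imp_eq[OF _ _ _ _ assms(3,4) that])
       (use assms in \<open>auto intro: holomorphic_imp_meromorphic holomorphic_on_subset\<close>)
  have ev: "eventually (\<lambda>q. F q = G q) (at 0)"
    using eventually_at_in_open[of "ball 0 1" "0::complex"] by (auto elim!: eventually_mono intro: eq)
  have "F \<midarrow>0\<rightarrow> F 0" "G \<midarrow>0\<rightarrow> G 0"
    using assms by (auto intro!: isContD holomorphic_on_imp_continuous_on[THEN continuous_on_interior])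
  with ev have "F 0 = G 0"
    by (metis Lim_transform_eventually LIM_unique)
  with eq assms(5) show ?thesis by (cases "q = 0") auto
qed

lemma abs_mero_eq_imp_eq:
  assumes "f holomorphic_on uhp" "g holomorphic_on uhp" "abs_mero f = abs_mero g" "z \<in> uhp"
  shows "f z = g z"
proof -
  have "\<forall>\<^sub>\<approx>z\<in>uhp. f z = g z"
    using assms by (subst (asm) abs_mero_eq_iff) (auto intro: holomorphic_imp_meromorphic)
  then have ev: "eventually (\<lambda>q. f q = g q) (at z)"
    using assms(4) by (simp add: eventually_cosparse_open_eq)
  have "f \<midarrow>z\<rightarrow> f z" "g \<midarrow>z\<rightarrow> g z"
    using assms open_uhp by (meson continuous_on_eq_continuous_at holomorphic_on_imp_continuous_on isContD)+
  with ev show ?thesis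
    by (metis Lim_transform_eventually LIM_unique)
qed

lemma power_map_holomorphic:
  assumes "F holomorphic_on ball 0 1" "norm c = 1" "k > 0"
  shows "(\<lambda>q. F (c * q ^ k)) holomorphic_on ball 0 1"
proof -
  have "(F \<circ> (\<lambda>q. c * q ^ k)) holomorphic_on ball 0 1"
    by (rule holomorphic_on_compose_gen[OF _ assms(1)])
       (use assms(2,3) in \<open>auto intro!: holomorphic_intros simp: norm_mult norm_power power_less_one_iff\<close>)
  then show ?thesis by (simp add: o_def)
qed

lemma qser_reindex:
  assumes "N > 0" "k > 0"
  shows "qser N F = qser (k * N) (\<lambda>q. F (q ^ k))"
proof -
  have "ee (z / of_nat N) = ee (z / of_nat (k * N)) ^ k" for z
    using ee_of_nat_mult[of k "z / of_nat (k * N)"] assms by simp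
  then show ?thesis by (simp add: qser_def)
qed

text \<open>Upper triangular matrices fix the cusp, so they act on the local parameter by a power
  and a root of unity; the lower right entry enlarges N.\<close>

lemma pullback_qser:
  assumes "F meromorphic_on ball 0 1" "N > 0" "a > 0" "e > 0"
  shows "pullback (int a) b 0 (int e) (qser N F) =
           qser (e * N) (\<lambda>q. F (ee (of_int b / of_nat (e * N)) * q ^ a))"
proof -
  have "ee (moebius_transform (int a) b 0 (int e) z / of_nat N) = ee (of_int b / of_nat (e * N)) * ee (z / of_nat (e * N)) ^ a" for z
    by (simp add: moebius_transform_def ee_add[symmetric] ee_of_nat_mult[symmetric] add_divide_distrib add.commute)
  then show ?thesis
    using assms qcomp_meromorphic[OF assms(1,2)] by (simp add: qser_def pullback_abs_mero)
qed

lemma has_q_expansion_iff: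
  "has_q_expansion N f L \<longleftrightarrow> (\<exists>F. F meromorphic_on ball 0 1 \<and> F has_laurent_expansion L \<and> f = qser N F)"
  if "N > 0"
proof -
  obtain g where g: "g meromorphic_on uhp" "f = abs_mero g" by (rule mero_cases)
  have *: "exp (2 * of_real pi * \<i> * z / of_nat N) = ee (z / of_nat N)" for z
    by (simp add: ee_def)
  have "abs_mero g = qser N F \<longleftrightarrow> (\<forall>\<^sub>\<approx>z\<in>uhp. g z = F (ee (z / of_nat N)))" if "F meromorphic_on ball 0 1" for F
    unfolding qser_def using g(1) qcomp_meromorphic[OF that \<open>N > 0\<close>] by (rule abs_mero_eq_iff)
  then show ?thesis
    unfolding g(2) has_q_expansion.abs_eq[OF mero_eq_refl[OF g(1)]] * by blast
qed

text \<open>A function meromorphic at 0 has a Laurent expansion there, so the condition at the cusps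
  is only the existence of F.\<close>

lemma modular_functions_iff:
  assumes "N > 0"
  shows "f \<in> modular_functions N \<longleftrightarrow>
     (\<forall>a b c d. a * d - b * c = 1 \<and> int N dvd c \<longrightarrow> pullback a b c d f = f) \<and>
     (\<forall>a b c d. a * d - b * c = 1 \<longrightarrow> (\<exists>F. F meromorphic_on ball 0 1 \<and> pullback a b c d f = qser N F))"
proof -
  have "(\<exists>L. has_q_expansion N g L) \<longleftrightarrow> (\<exists>F. F meromorphic_on ball 0 1 \<and> g = qser N F)" for g
    unfolding has_q_expansion_iff[OF assms]
    using meromorphic_on_imp_has_laurent_expansion[of _ "ball 0 1" 0] by fastforce
  then show ?thesis by (simp add: modular_functions_def)
qed

section \<open>Reduction theory and Liouville's theorem for the modular group\<close>

lemma reduce_uhp: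
  assumes "z \<in> uhp"
  shows "\<exists>a b c d. a * d - b * c = 1 \<and> Im (moebius_transform a b c d z) \<ge> 1 / 2"
proof -
  \<comment> \<open>If Im z < 1/2, a translation achieves |z|^2 \<le> 1/4 + 1/4, and the inversion
    then at least doubles the imaginary part; n bounds the number of rounds.\<close>
  have "\<exists>a b c d. a * d - b * c = 1 \<and> Im (moebius_transform a b c d z) \<ge> 1 / 2"
    if "z \<in> uhp" "Im z * 2 ^ n \<ge> 1" for n z
    using that
  proof (induction n arbitrary: z)
    case 0
    then show ?case
      by (intro exI[of _ 1] exI[of _ 0]) (simp add: moebius_transform_def)
  next
    case (Suc n)
    show ?case
    proof (cases "Im z \<ge> 1 / 2")
      case True
      then show ?thesis
        by (intro exI[of _ 1] exI[of _ 0]) (simp add: moebius_transform_def)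
    next
      case False
      define k where "k = round (Re z)"
      define z' where "z' = moebius_transform 0 (-1) 1 (- k) z"
      have z': "z' \<in> uhp" unfolding z'_def using Suc.prems by (intro moebius_transform_in_uhp) auto
      have "\<bar>Re z - of_int k\<bar> \<le> 1 / 2"
        using of_int_round_abs_le[of "Re z"] by (simp add: k_def abs_minus_commute)
      then have "(Re z - of_int k) ^ 2 \<le> (1 / 2) ^ 2" by (rule power2_le_iff_abs_le[THEN iffD2, rotated]) simp
      moreover have "(Im z) ^ 2 \<le> (1 / 2) ^ 2"
        using False Suc.prems by (intro power_mono) (auto simp: uhp_def)
      ultimately have le: "(cmod (z - of_int k)) ^ 2 \<le> 1 / 2"
        by (simp add: cmod_power2 power_divide)
      have pos: "(cmod (z - of_int k)) ^ 2 > 0"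
        using Suc.prems by (auto simp: uhp_def)
      have "2 * Im z * (cmod (z - of_int k)) ^ 2 \<le> 2 * Im z * (1 / 2)"
        using le Suc.prems by (intro mult_left_mono) (auto simp: uhp_def)
      then have "2 * Im z \<le> Im z'"
        using pos by (simp add: z'_def Im_moebius_transform field_simps)
      then have "2 * Im z * 2 ^ n \<le> Im z' * 2 ^ n" by (rule mult_right_mono) auto
      moreover have "2 * Im z * 2 ^ n = Im z * 2 ^ Suc n" by simp
      ultimately have "Im z' * 2 ^ n \<ge> 1" using Suc.prems by linarith
      from Suc.IH[OF z' this] obtain a b c d where abcd: "a * d - b * c = 1"
        "Im (moebius_transform a b c d z') \<ge> 1 / 2" by blast
      have "moebius_transform a b c d z' = moebius_transform b (- a - b * k) d (- c - d * k) z"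
        unfolding z'_def using Suc.prems by (subst moebius_transform_comp) auto
      moreover have "b * (- c - d * k) - (- a - b * k) * d = 1"
        using abcd(1) by (simp add: algebra_simps)
      ultimately show ?thesis using abcd(2) by metis
    qed
  qed
  moreover obtain n where "1 / Im z < 2 ^ n"
    using real_arch_pow[of 2 "1 / Im z"] by auto
  then have "Im z * 2 ^ n \<ge> 1" using assms by (simp add: uhp_def field_simps)
  ultimately show ?thesis using assms by blast
qed

definition Gamma0_invariant :: "nat \<Rightarrow> mero \<Rightarrow> bool" where
  "Gamma0_invariant N f \<longleftrightarrow> (\<forall>a b c d. a * d - b * c = 1 \<and> int N dvd c \<longrightarrow> pullback a b c d f = f)"

text \<open>Cosets are recognised by their bottom rows: A, B, C, D are the entries of the second
  matrix times the inverse of the first, and the divisibility condition puts this quotient into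
  \<open>\<Gamma>\<^sub>0(N)\<close>.\<close>

lemma pullback_cong_mod:
  assumes "Gamma0_invariant N f" "a * d - b * c = 1" "a' * d' - b' * c' = 1" "int N dvd c' * d - d' * c"
  shows "pullback a' b' c' d' f = pullback a b c d f"
proof -
  define A B C D where "A = a' * d - b' * c" and "B = b' * a - a' * b" and "C = c' * d - d' * c" and "D = d' * a - c' * b"
  have "A * D - B * C = (a * d - b * c) * (a' * d' - b' * c')"
    unfolding A_def B_def C_def D_def by (simp add: algebra_simps)
  then have det: "A * D - B * C = 1" using assms by simp
  have "pullback a b c d f = pullback a b c d (pullback A B C D f)"
    using assms det by (simp add: Gamma0_invariant_def C_def)
  also have "\<dots> = pullback (A * a + B * c) (A * b + B * d) (C * a + D * c) (C * b + D * d) f"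
    by (rule pullback_pullback) (use assms det in auto)
  finally have *: "pullback a b c d f = pullback (A * a + B * c) (A * b + B * d) (C * a + D * c) (C * b + D * d) f" .
  have "A * a + B * c = a' * (a * d - b * c)" "A * b + B * d = b' * (a * d - b * c)"
    "C * a + D * c = c' * (a * d - b * c)" "C * b + D * d = d' * (a * d - b * c)"
    unfolding A_def B_def C_def D_def by (simp_all add: algebra_simps)
  then show ?thesis unfolding * assms(2) by simp
qed

lemma pullback_inverse:
  assumes "a * d - b * c = 1"
  shows "pullback d (- b) (- c) a (pullback a b c d f) = f"
proof -
  have "pullback d (- b) (- c) a (pullback a b c d f) =
    pullback (a * d + b * (- c)) (a * (- b) + b * a) (c * d + d * (- c)) (c * (- b) + d * a) f"
    using assms by (intro pullback_pullback) (auto simp: algebra_simps)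
  then show ?thesis using assms by (simp add: algebra_simps pullback_id)
qed

definition SL2_orbit :: "mero \<Rightarrow> mero set" where
  "SL2_orbit f = {pullback a b c d f | a b c d. a * d - b * c = 1}"

lemma SL2_orbitI: "a * d - b * c = 1 \<Longrightarrow> pullback a b c d f \<in> SL2_orbit f"
  unfolding SL2_orbit_def by blast

lemma SL2_orbit_self: "f \<in> SL2_orbit f"
  using SL2_orbitI[of 1 1 0 0 f] by (simp add: pullback_id)

lemma SL2_orbit_pullback:
  assumes "g \<in> SL2_orbit f" "a * d - b * c = 1"
  shows "pullback a b c d g \<in> SL2_orbit f"
proof -
  obtain a' b' c' d' where g: "g = pullback a' b' c' d' f" "a' * d' - b' * c' = 1"
    using assms(1) unfolding SL2_orbit_def by blast
  have "(a' * a + b' * c) * (c' * b + d' * d) - (a' * b + b' * d) * (c' * a + d' * c) =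
          (a' * d' - b' * c') * (a * d - b * c)"
    by (simp add: algebra_simps)
  then have "(a' * a + b' * c) * (c' * b + d' * d) - (a' * b + b' * d) * (c' * a + d' * c) = 1"
    using g assms by simp
  moreover have "pullback a b c d g = pullback (a' * a + b' * c) (a' * b + b' * d) (c' * a + d' * c) (c' * b + d' * d) f"
    unfolding g(1) by (rule pullback_pullback) (use assms g in auto)
  ultimately show ?thesis by (simp only: SL2_orbitI)
qed

text \<open>A translate depends only on the bottom row modulo N.\<close>

lemma finite_SL2_orbit:
  assumes "Gamma0_invariant N f" "N > 0"
  shows "finite (SL2_orbit f)"
proof -
  define T where "T = {(a, b, c, d). a * d - b * c = (1 :: int)}"
  define g where "g = (\<lambda>(a, b, c, d). pullback a b c d f)"
  define key where "key = (\<lambda>(a :: int, b :: int, c, d). (c mod int N, d mod int N))"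
  have "finite (key ` T)"
    by (rule finite_subset[of _ "{0..<int N} \<times> {0..<int N}"]) (use assms(2) in \<open>auto simp: key_def\<close>)
  moreover have "SL2_orbit f \<subseteq> (\<lambda>k. g (SOME t. t \<in> T \<and> key t = k)) ` (key ` T)"
  proof
    fix h assume "h \<in> SL2_orbit f"
    then obtain t where t: "t \<in> T" "h = g t"
      by (auto simp: SL2_orbit_def T_def g_def)
    define t' where "t' = (SOME t'. t' \<in> T \<and> key t' = key t)"
    have t': "t' \<in> T \<and> key t' = key t"
      unfolding t'_def by (rule someI[of _ t]) (use t in auto)
    obtain a b c d where abcd: "t = (a, b, c, d)" by (cases t)
    obtain a' b' c' d' where abcd': "t' = (a', b', c', d')" by (cases t')
    have "[c' * d = c * d'] (mod int N)"
      using t' by (intro cong_mult) (auto simp: key_def abcd abcd' cong_def)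
    then have "int N dvd c' * d - d' * c"
      by (simp add: cong_iff_dvd_diff mult.commute)
    then have "g t' = g t"
      using pullback_cong_mod[OF assms(1), of a d b c a' d' b' c'] t t'
      by (simp add: T_def g_def abcd abcd')
    then show "h \<in> (\<lambda>k. g (SOME t. t \<in> T \<and> key t = k)) ` (key ` T)"
      using t unfolding t'_def by (intro image_eqI[of _ _ "key t"]) auto
  qed
  ultimately show ?thesis using finite_surj by blast
qed

lemma qser_SL2_eq:
  assumes "F holomorphic_on ball 0 1" "G holomorphic_on ball 0 1" "N > 0" "a * d - b * c = 1"
    and "qser N F = pullback a b c d (qser N G)" "z \<in> uhp"
  shows "F (ee (z / of_nat N)) = G (ee (moebius_transform a b c d z / of_nat N))"
proof -
  have det: "a * d - b * c > 0" using assms by simp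
  have comp: "(\<lambda>z. H (ee (z / of_nat N))) holomorphic_on uhp" if "H holomorphic_on ball 0 1" for H
  proof -
    have "(H \<circ> (\<lambda>z. ee (z / of_nat N))) holomorphic_on uhp"
      by (rule holomorphic_on_compose_gen[OF _ that])
         (use ee_div_in_ball assms(3) in \<open>auto intro!: holomorphic_intros\<close>)
    then show ?thesis by (simp add: o_def)
  qed
  have "((\<lambda>z. G (ee (z / of_nat N))) \<circ> moebius_transform a b c d) holomorphic_on uhp"
    by (rule holomorphic_on_compose_gen[OF _ comp[OF assms(2)]])
       (use moebius_transform_in_uhp[OF det] analytic_imp_holomorphic[OF moebius_transform_analytic[OF det]] in auto)
  then have "(\<lambda>z. G (ee (moebius_transform a b c d z / of_nat N))) holomorphic_on uhp"
    by (simp add: o_def)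
  moreover have "abs_mero (\<lambda>z. F (ee (z / of_nat N))) = abs_mero (\<lambda>z. G (ee (moebius_transform a b c d z / of_nat N)))"
    using assms(5) comp[OF assms(2)] det unfolding qser_def
    by (subst (asm) pullback_abs_mero) (auto intro: holomorphic_imp_meromorphic)
  ultimately show ?thesis
    using abs_mero_eq_imp_eq[OF comp[OF assms(1)] _ _ assms(6)] by blast
qed

text \<open>Every translate is bounded on the whole half plane by the maximum, over the finitely many
  translates, on the compact disc that corresponds to \<open>Im z \<ge> 1/2\<close>; this maximum is attained at
  an interior point of the unit disc.\<close>

theorem modular_Liouville:
  assumes inv: "Gamma0_invariant N f" and N: "N > 0"
    and hol: "\<And>a b c d. a * d - b * c = 1 \<Longrightarrow> \<exists>F. F holomorphic_on ball 0 1 \<and> pullback a b c d f = qser N F"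
  shows "\<exists>k. f = const_mero k"
proof -
  have "\<forall>g\<in>SL2_orbit f. \<exists>F. F holomorphic_on ball 0 1 \<and> g = qser N F"
    using hol unfolding SL2_orbit_def by blast
  then obtain F where F: "\<And>g. g \<in> SL2_orbit f \<Longrightarrow> F g holomorphic_on ball 0 1" "\<And>g. g \<in> SL2_orbit f \<Longrightarrow> g = qser N (F g)"
    by metis
  \<comment> \<open>The parameter e(z/N) has modulus at most r exactly when Im z \<ge> 1/2.\<close>
  define r where "r = exp (- (pi / of_nat N))"
  have r: "0 < r" "r < 1" using N by (simp_all add: r_def)
  have "\<exists>p\<in>cball 0 r. \<forall>q\<in>cball 0 r. norm (F g q) \<le> norm (F g p)" if "g \<in> SL2_orbit f" for g
  proof -
    have "continuous_on (cball 0 r) (\<lambda>q. norm (F g q))"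
      by (intro continuous_intros holomorphic_on_imp_continuous_on holomorphic_on_subset[OF F(1)[OF that]])
         (use r in auto)
    then show ?thesis using r by (intro continuous_attains_sup) auto
  qed
  then obtain p where p: "\<And>g. g \<in> SL2_orbit f \<Longrightarrow> p g \<in> cball 0 r"
    "\<And>g q. g \<in> SL2_orbit f \<Longrightarrow> q \<in> cball 0 r \<Longrightarrow> norm (F g q) \<le> norm (F g (p g))"
    by metis
  have fin: "finite ((\<lambda>g. norm (F g (p g))) ` SL2_orbit f)" "(\<lambda>g. norm (F g (p g))) ` SL2_orbit f \<noteq> {}"
    using finite_SL2_orbit[OF inv N] SL2_orbit_self[of f] by auto
  obtain g0 where g0: "g0 \<in> SL2_orbit f" "norm (F g0 (p g0)) = Max ((\<lambda>g. norm (F g (p g))) ` SL2_orbit f)"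
    using Max_in[OF fin] by auto
  have max: "norm (F g q) \<le> norm (F g0 (p g0))" if "g \<in> SL2_orbit f" "q \<in> cball 0 r" for g q
  proof -
    have "norm (F g q) \<le> norm (F g (p g))" using p(2) that by blast
    also have "\<dots> \<le> Max ((\<lambda>g. norm (F g (p g))) ` SL2_orbit f)"
      using fin that by (intro Max_ge) auto
    finally show ?thesis using g0 by simp
  qed
  have bound: "norm (F g0 q) \<le> norm (F g0 (p g0))" if q: "q \<in> ball 0 1" for q
  proof (cases "q = 0")
    case True
    then show ?thesis using max[OF g0(1), of q] r by simp
  next
    case False
    with q N obtain z where z: "z \<in> uhp" "q = ee (z / of_nat N)"
      using ball_minus_0_cases[of q N] by auto
    obtain a b c d where abcd: "a * d - b * c = 1" "Im (moebius_transform a b c d z) \<ge> 1 / 2"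
      using reduce_uhp[OF z(1)] by blast
    define g1 where "g1 = pullback d (- b) (- c) a g0"
    have g1: "g1 \<in> SL2_orbit f" unfolding g1_def
      using abcd by (intro SL2_orbit_pullback g0) (auto simp: algebra_simps)
    have "pullback a b c d g1 = g0"
      using pullback_inverse[of d a "- b" "- c" g0] abcd by (simp add: g1_def mult.commute)
    then have "qser N (F g0) = pullback a b c d (qser N (F g1))"
      using F(2) g0(1) g1 by simp
    from qser_SL2_eq[OF F(1)[OF g0(1)] F(1)[OF g1] N abcd(1) this z(1)]
    have eq: "F g0 q = F g1 (ee (moebius_transform a b c d z / of_nat N))" by (simp add: z)
    have "pi * 1 \<le> pi * (2 * Im (moebius_transform a b c d z))"
      using abcd(2) by (intro mult_left_mono) auto
    then have "norm (ee (moebius_transform a b c d z / of_nat N)) \<le> r"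
      using N by (simp add: norm_ee r_def divide_right_mono mult_ac)
    then show ?thesis unfolding eq by (intro max g1) auto
  qed
  have "F g0 constant_on ball 0 1"
    by (rule maximum_modulus_principle[OF F(1)[OF g0(1)], of "ball 0 1" "p g0"])
       (use bound p(1)[OF g0(1)] r in auto)
  then obtain k where k: "\<And>q. q \<in> ball 0 1 \<Longrightarrow> F g0 q = k"
    by (auto simp: constant_on_def)
  have "g0 = qser N (F g0)" using F(2) g0(1) .
  also have "\<dots> = qser N (\<lambda>_. k)"
    by (rule qser_cong) (use N k in auto)
  finally have g0k: "g0 = const_mero k" by simp
  obtain a b c d where "g0 = pullback a b c d f" "a * d - b * c = 1"
    using g0(1) unfolding SL2_orbit_def by blast
  then have "f = pullback d (- b) (- c) a g0"
    using pullback_inverse by simp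
  also have "\<dots> = const_mero k"
    unfolding g0k using \<open>a * d - b * c = 1\<close> by (intro pullback_const) (simp add: algebra_simps)
  finally show ?thesis by blast
qed


section \<open>Eta quotients of level 75\<close>

lemma Gamma0_invariantD: "Gamma0_invariant N f \<Longrightarrow> a * d - b * c = 1 \<Longrightarrow> int N dvd c \<Longrightarrow> pullback a b c d f = f"
  by (auto simp: Gamma0_invariant_def)

text \<open>The order at the cusp is exactly m, and there are neither zeros nor poles in the half
  plane, as for eta quotients. The value of \<open>q powi m\<close> at 0 is irrelevant.\<close>

definition qunit :: "nat \<Rightarrow> int \<Rightarrow> mero \<Rightarrow> bool" where
  "qunit N m f \<longleftrightarrow> (\<exists>U. U holomorphic_on ball 0 1 \<and> (\<forall>q\<in>ball 0 1. U q \<noteq> 0) \<and> f = qser N (\<lambda>q. q powi m * U q))"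

lemma qunit_meromorphic:
  assumes "U holomorphic_on ball 0 1"
  shows "(\<lambda>q. q powi m * U q) meromorphic_on ball 0 1"
  by (intro meromorphic_intros holomorphic_imp_meromorphic assms) auto

lemma qunit_mult:
  assumes "qunit N m f" "qunit N k g" "N > 0"
  shows "qunit N (m + k) (f * g)"
proof -
  obtain U where U: "U holomorphic_on ball 0 1" "\<forall>q\<in>ball 0 1. U q \<noteq> 0" "f = qser N (\<lambda>q. q powi m * U q)"
    using assms(1) unfolding qunit_def by blast
  obtain W where W: "W holomorphic_on ball 0 1" "\<forall>q\<in>ball 0 1. W q \<noteq> 0" "g = qser N (\<lambda>q. q powi k * W q)"
    using assms(2) unfolding qunit_def by blast
  have UW: "(\<lambda>q. U q * W q) holomorphic_on ball 0 1" by (intro holomorphic_intros U W)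
  have "f * g = qser N (\<lambda>q. (q powi m * U q) * (q powi k * W q))"
    unfolding U(3) W(3) by (intro qser_arith qunit_meromorphic U W assms)
  also have "\<dots> = qser N (\<lambda>q. q powi (m + k) * (U q * W q))"
    by (rule qser_cong) (use qunit_meromorphic[OF UW] assms in \<open>auto simp: power_int_add\<close>)
  finally show ?thesis
    unfolding qunit_def using U W UW by (intro exI[of _ "\<lambda>q. U q * W q"]) auto
qed

lemma qunit_inverse:
  assumes "qunit N m f" "N > 0"
  shows "qunit N (- m) (inverse f)"
proof -
  obtain U where U: "U holomorphic_on ball 0 1" "\<forall>q\<in>ball 0 1. U q \<noteq> 0" "f = qser N (\<lambda>q. q powi m * U q)"
    using assms(1) unfolding qunit_def by blast
  have U': "(\<lambda>q. inverse (U q)) holomorphic_on ball 0 1" by (intro holomorphic_intros U) (use U in auto)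
  have "inverse f = qser N (\<lambda>q. inverse (q powi m * U q))"
    unfolding U(3) by (intro qser_arith_unary qunit_meromorphic U assms)
  also have "\<dots> = qser N (\<lambda>q. q powi (- m) * inverse (U q))"
    by (rule qser_cong[OF _ qunit_meromorphic[OF U'] assms(2)]) (simp add: power_int_minus)
  finally show ?thesis
    unfolding qunit_def using U U' by (intro exI[of _ "\<lambda>q. inverse (U q)"]) auto
qed

lemma qunit_const: "k \<noteq> 0 \<Longrightarrow> qunit N 0 (const_mero k)"
  unfolding qunit_def by (intro exI[of _ "\<lambda>_. k"]) auto

lemma qunit_divide: "qunit N m f \<Longrightarrow> qunit N k g \<Longrightarrow> N > 0 \<Longrightarrow> qunit N (m - k) (f / g)"
  using qunit_mult[of N m f "- k" "inverse g"] qunit_inverse[of N k g] by (simp add: divide_inverse)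

lemma qunit_power:
  assumes "qunit N m f" "N > 0"
  shows "qunit N (int n * m) (f ^ n)"
proof (induction n)
  case 0
  then show ?case using qunit_const[of 1 N] by simp
next
  case (Suc n)
  then show ?case using qunit_mult[OF assms(1) Suc assms(2)] by (simp add: algebra_simps)
qed

text \<open>Expressing everything in the common parameter e(z/75) makes orders at cusps of different
  width comparable.\<close>

lemma qunit_reindex:
  assumes "qunit N m f" "N > 0" "k > 0"
  shows "qunit (k * N) (int k * m) f"
proof -
  obtain U where U: "U holomorphic_on ball 0 1" "\<forall>q\<in>ball 0 1. U q \<noteq> 0" "f = qser N (\<lambda>q. q powi m * U q)"
    using assms(1) unfolding qunit_def by blast
  have U': "(\<lambda>q. U (q ^ k)) holomorphic_on ball 0 1"
    using power_map_holomorphic[OF U(1), of 1 k] assms by simp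
  have "f = qser (k * N) (\<lambda>q. (q ^ k) powi m * U (q ^ k))"
    unfolding U(3) by (rule qser_reindex) (use assms in auto)
  also have "\<dots> = qser (k * N) (\<lambda>q. q powi (int k * m) * U (q ^ k))"
    by (simp add: power_int_mult)
  finally show ?thesis
    unfolding qunit_def using U U' assms
    by (intro exI[of _ "\<lambda>q. U (q ^ k)"]) (auto simp: norm_power power_less_one_iff)
qed

lemma qunit_pullback:
  assumes "qunit N m f" "N > 0" "a > 0" "e > 0"
  shows "qunit (e * N) (int a * m) (pullback (int a) b 0 (int e) f)"
proof -
  obtain U where U: "U holomorphic_on ball 0 1" "\<forall>q\<in>ball 0 1. U q \<noteq> 0" "f = qser N (\<lambda>q. q powi m * U q)"
    using assms(1) unfolding qunit_def by blast
  define z where "z = ee (of_int b / of_nat (e * N))"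
  have z: "norm z = 1" by (simp add: z_def norm_ee)
  then have "z \<noteq> 0" by auto
  have zq: "z * q ^ a \<in> ball 0 1" if "q \<in> ball 0 1" for q
    using that assms by (simp add: norm_mult norm_power z power_less_one_iff)
  have "pullback (int a) b 0 (int e) f = qser (e * N) (\<lambda>q. (z * q ^ a) powi m * U (z * q ^ a))"
    unfolding U(3) z_def by (rule pullback_qser) (use assms qunit_meromorphic[OF U(1)] in auto)
  also have "\<dots> = qser (e * N) (\<lambda>q. q powi (int a * m) * (z powi m * U (z * q ^ a)))"
  proof -
    have "(z * q ^ a) powi m = q powi (int a * m) * z powi m" for q
      by (simp add: power_int_mult power_int_mult_distrib)
    then show ?thesis by (simp only: mult.assoc)
  qed
  finally show ?thesis
    unfolding qunit_def using U power_map_holomorphic[OF U(1) z assms(3)] zq \<open>z \<noteq> 0\<close>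
    by (intro exI[of _ "\<lambda>q. z powi m * U (z * q ^ a)"]) (auto intro!: holomorphic_intros)
qed

lemma qunit_nonzero:
  assumes "qunit N m f" "N > 0"
  shows "f \<noteq> 0"
proof
  assume "f = 0"
  have "qunit N (m + - m) (f * inverse f)" by (intro qunit_mult qunit_inverse assms)
  then obtain U where U: "U holomorphic_on ball 0 1" "\<forall>q\<in>ball 0 1. U q \<noteq> 0" "const_mero 0 = qser N (\<lambda>q. U q)"
    unfolding qunit_def using \<open>f = 0\<close> by auto
  have "qser N (\<lambda>q. U q) = qser N (\<lambda>_. 0)" unfolding U(3)[symmetric] by simp
  then have "U 0 = 0"
    by (intro qser_eq_imp_eq_holomorphic[of _ _ N]) (use U assms in auto)
  then show False using U by simp
qed

lemma qunit_expansion: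
  assumes "qunit N m f" "- int n \<le> m" "N > 0"
  obtains F where "F holomorphic_on ball 0 1" "f = qser N (\<lambda>q. F q / q ^ n)"
proof -
  obtain U where U: "U holomorphic_on ball 0 1" "\<forall>q\<in>ball 0 1. U q \<noteq> 0" "f = qser N (\<lambda>q. q powi m * U q)"
    using assms(1) unfolding qunit_def by blast
  define F where "F = (\<lambda>q. q ^ nat (m + int n) * U q)"
  have F: "F holomorphic_on ball 0 1" unfolding F_def by (intro holomorphic_intros U)
  have "qser N (\<lambda>q. q powi m * U q) = qser N (\<lambda>q. F q / q ^ n)"
  proof (rule qser_cong)
    fix q :: complex assume "q \<in> ball 0 1 - {0}"
    then have "q powi m = q powi (m + int n) / q powi int n"
      using power_int_diff[of q "m + int n" "int n"] by auto
    also have "q powi (m + int n) = q ^ nat (m + int n)"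
      using assms(2) power_int_of_nat[of q "nat (m + int n)"] by simp
    finally show "q powi m * U q = F q / q ^ n" by (simp add: F_def)
  next
    show "(\<lambda>q. F q / q ^ n) meromorphic_on ball 0 1"
      by (intro meromorphic_intros holomorphic_imp_meromorphic[OF F]) auto
  qed (use assms in auto)
  with F U that show ?thesis by blast
qed

lemma hq_qunit: "qunit 1 (- 1) (qser 1 hq)"
proof -
  have n: "norm (q ^ 25) < 1" if "norm q < 1" for q :: complex
    using that by (simp add: norm_power power_less_one_iff)
  have "(\<lambda>q. Pq q / Pq (q ^ 25)) holomorphic_on ball 0 1"
    by (intro holomorphic_intros Pq_nonzero) (auto intro: n)
  moreover have "hq = (\<lambda>q. q powi (- 1) * (Pq q / Pq (q ^ 25)))"
    by (auto simp: hq_def fun_eq_iff power_int_minus field_simps)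
  ultimately show ?thesis
    unfolding qunit_def using Pq_nonzero n by (intro exI[of _ "\<lambda>q. Pq q / Pq (q ^ 25)"]) auto
qed

lemma hq_meromorphic: "hq meromorphic_on ball 0 1"
proof -
  have n: "norm (q ^ 25) < 1" if "norm q < 1" for q :: complex
    using that by (simp add: norm_power power_less_one_iff)
  have "Pq holomorphic_on ball 0 1" "(\<lambda>q. Pq (q ^ 25)) holomorphic_on ball 0 1"
    by (intro holomorphic_intros; use n in auto)+
  then show ?thesis
    unfolding hq_def by (intro meromorphic_intros holomorphic_imp_meromorphic) auto
qed

definition ht :: mero where "ht = qser 5 hq"
definition h1 :: mero where "h1 = qser 1 hq"
definition h3 :: mero where "h3 = qser 1 (\<lambda>q. hq (q ^ 3))"

text \<open>The unit that witnesses the order of \<open>hq\<close> in the parameter q serves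
  unchanged for e(z/5).\<close>

lemma ht_qunit: "qunit 5 (- 1) ht"
proof -
  obtain U where U: "U holomorphic_on ball 0 1" "\<forall>q\<in>ball 0 1. U q \<noteq> 0" "qser 1 hq = qser 1 (\<lambda>q. q powi - 1 * U q)"
    using hq_qunit unfolding qunit_def by blast
  have "\<forall>\<^sub>\<approx>q\<in>ball 0 1. hq q = q powi - 1 * U q"
    by (rule qser_eq_imp_cosparse[OF hq_meromorphic qunit_meromorphic[OF U(1)] _ U(3)]) simp
  moreover have "open (ball 0 1 - {0 :: complex})" by auto
  ultimately have "\<forall>\<^sub>\<approx>q\<in>ball 0 1 - {0}. hq q = q powi - 1 * U q"
    by (auto simp: eventually_cosparse_open_eq)
  then have "ht = qser 5 (\<lambda>q. q powi - 1 * U q)"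
    unfolding ht_def by (intro qser_cong_cosparse hq_meromorphic qunit_meromorphic U) auto
  then show ?thesis unfolding qunit_def using U by blast
qed

lemma ht_pullback:
  assumes "a * d - b * c = 1" "G meromorphic_on ball 0 1"
    "\<And>z. z \<in> uhp \<Longrightarrow> hq (ee (moebius_transform a b c d z / 5)) = G (ee (z / 5))"
  shows "pullback a b c d ht = qser 5 G"
proof -
  have "pullback a b c d ht = abs_mero (\<lambda>z. hq (ee (moebius_transform a b c d z / of_nat 5)))"
    unfolding ht_def qser_def using assms(1) hq_meromorphic by (intro pullback_abs_mero qcomp_meromorphic) auto
  also have "\<dots> = qser 5 G"
    unfolding qser_def by (rule abs_mero_cong) (use assms qcomp_meromorphic[of G 5] in auto)
  finally show ?thesis .
qed

lemma ht_invariant: "a * d - b * c = 1 \<Longrightarrow> 5 dvd b \<Longrightarrow> 5 dvd c \<Longrightarrow> pullback a b c d ht = ht"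
  unfolding ht_def[of] by (subst ht_def[symmetric], rule ht_pullback) (use hq_meromorphic hq_invariant in auto)

lemma ht_Fricke: "pullback 0 (- 1) 1 0 ht = 5 / ht"
proof -
  have "pullback 0 (- 1) 1 0 ht = qser 5 (\<lambda>q. 5 / hq q)"
  proof (rule ht_pullback)
    show "hq (ee (moebius_transform 0 (- 1) 1 0 z / 5)) = 5 / hq (ee (z / 5))" if "z \<in> uhp" for z
      using hq_Fricke[OF that] by (simp add: moebius_transform_def)
  qed (auto intro!: meromorphic_intros hq_meromorphic)
  also have "\<dots> = qser 5 (\<lambda>_. 5) / ht"
    unfolding ht_def by (intro qser_arith(4)[symmetric] hq_meromorphic) auto
  finally show ?thesis by (simp add: const_mero_numeral)
qed

lemma ht_unit:
  assumes "a * d - b * c = 1" "\<not> 5 dvd a" "\<not> 5 dvd c"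
  shows "qunit 5 0 (pullback a b c d ht)"
proof -
  obtain U where U: "U holomorphic_on ball 0 1" "\<forall>q\<in>ball 0 1. U q \<noteq> 0"
    "\<forall>\<tau>\<in>uhp. hq (ee (moebius_transform a b c d \<tau> / 5)) = U (ee (\<tau> / 5))"
    using hq_unit[OF assms] by blast
  have "pullback a b c d ht = qser 5 U"
    by (rule ht_pullback) (use assms U in \<open>auto intro: holomorphic_imp_meromorphic\<close>)
  then show ?thesis unfolding qunit_def using U by (intro exI[of _ U]) auto
qed

lemma h1_eq: "h1 = pullback 5 0 0 1 ht"
proof -
  have "pullback (int 5) 0 0 (int 1) ht = qser 5 (\<lambda>q. hq (q ^ 5))"
    unfolding ht_def by (subst pullback_qser) (use hq_meromorphic in auto)
  also have "\<dots> = h1"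
    unfolding h1_def using qser_reindex[of 1 5 hq] by simp
  finally show ?thesis by simp
qed

lemma h3_eq: "h3 = pullback 3 0 0 1 h1"
proof -
  have "pullback (int 3) 0 0 (int 1) h1 = qser 1 (\<lambda>q. hq (q ^ 3))"
    unfolding h1_def by (subst pullback_qser) (use hq_meromorphic in auto)
  then show ?thesis by (simp add: h3_def)
qed

lemma pullback_h1: "a * d - b * c > 0 \<Longrightarrow> pullback a b c d h1 = pullback (5 * a) (5 * b) c d ht"
  unfolding h1_eq by (subst pullback_pullback) auto

text \<open>If 5 divides c, then diag(5, 1) can be moved past the matrix, which becomes (a, 5b; c/5,
  d).\<close>

lemma pullback_h1_factor:
  assumes "a * d - b * c = 1" "c = 5 * c'"
  shows "pullback a b c d h1 = pullback 5 0 0 1 (pullback a (5 * b) c' d ht)"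
proof -
  have "pullback 5 0 0 1 (pullback a (5 * b) c' d ht) =
          pullback (a * 5 + 5 * b * 0) (a * 0 + 5 * b * 1) (c' * 5 + d * 0) (c' * 0 + d * 1) ht"
    by (rule pullback_pullback) (use assms in \<open>auto simp: algebra_simps\<close>)
  then show ?thesis
    using assms by (simp add: pullback_h1 mult.commute)
qed

lemma h1_invariant: "Gamma0_invariant 25 h1"
  unfolding Gamma0_invariant_def
proof safe
  fix a b c d :: int
  assume det: "a * d - b * c = 1" and "int 25 dvd c"
  then obtain c' where c: "c = 5 * (5 * c')" by (auto simp: dvd_def)
  have "pullback a (5 * b) (5 * c') d ht = ht"
    using det c by (intro ht_invariant) (auto simp: algebra_simps)
  then show "pullback a b c d h1 = h1"
    by (simp only: pullback_h1_factor[OF det c] h1_eq[symmetric])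
qed

text \<open>The order of \<open>h1\<close> at the cusp \<open>a/c\<close>, measured in \<open>exp (2 \<pi> i z / 75)\<close>.\<close>

definition ord_h :: "int \<Rightarrow> int" where
  "ord_h c = (if 25 dvd c then - 75 else if 5 dvd c then 0 else 3)"

lemma inverse_mod_exists:
  fixes c d N :: int
  assumes "coprime c N"
  shows "\<exists>k. N dvd c * k - d"
proof -
  obtain x where "[c * x = 1] (mod N)"
    using cong_solve_coprime_int[OF assms] by blast
  then have "[c * x * d = 1 * d] (mod N)" by (intro cong_mult cong_refl)
  then have "[c * (x * d) = d] (mod N)" by (simp add: mult_ac)
  then show ?thesis by (auto simp: cong_iff_dvd_diff)
qed

text \<open>The three kinds of cusps of \<open>\<Gamma>\<^sub>0(25)\<close>, according to whether
  25, only 5, or not even 5 divides c. N is kept small here instead of passing to 75, because it can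
  triple for \<open>h3\<close> and 3 N must still divide 75.\<close>

lemma h1_cusps:
  assumes det: "a * d - b * c = 1"
  shows "\<exists>N m. N \<in> {1, 5, 25} \<and> qunit N m (pullback a b c d h1) \<and> (75 div int N) * m = ord_h c"
proof (cases "5 dvd c")
  case True
  then obtain c' where c: "c = 5 * c'" by (elim dvdE)
  show ?thesis
  proof (cases "5 dvd c'")
    case True
    then have "25 dvd c" using c by auto
    then have "pullback a b c d h1 = h1"
      using h1_invariant det by (auto simp: Gamma0_invariant_def)
    then show ?thesis
      using hq_qunit \<open>25 dvd c\<close> by (intro exI[of _ 1] exI[of _ "-1"]) (simp add: h1_def ord_h_def)
  next
    case False
    have "\<not> 5 dvd a"
    proof
      assume "5 dvd a"
      then have "5 dvd a * d - b * c" using c by simp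
      then show False using det by simp
    qed
    then have "qunit 5 0 (pullback a (5 * b) c' d ht)"
      using False det c by (intro ht_unit) (auto simp: algebra_simps)
    from qunit_pullback[OF this, of 5 1 0]
    have "qunit 5 0 (pullback a b c d h1)"
      by (simp add: pullback_h1_factor[OF det c])
    moreover have "\<not> 25 dvd c" using c False by auto
    ultimately show ?thesis
      using True by (intro exI[of _ 5] exI[of _ 0]) (simp add: ord_h_def)
  qed
next
  case False
  then have "coprime c 5" using prime_imp_coprime[of 5 c] by (simp add: coprime_commute)
  then have "coprime c (5 ^ 2)" by (rule coprime_power_right_iff[THEN iffD2, OF disjI1])
  \<comment> \<open>All these cusps are equivalent to 0: modulo 25 the row (c, d) is proportional to
    (1, k).\<close>
  then obtain k where k: "25 dvd c * k - d" using inverse_mod_exists[of c 25 d] by auto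
  have "pullback a b c d h1 = pullback 0 (- 1) 1 k h1"
    by (rule pullback_cong_mod[OF h1_invariant]) (use det k in auto)
  also have "\<dots> = pullback 0 (- 5) 1 k ht"
    by (simp add: pullback_h1)
  \<comment> \<open>The matrix (0, -5; 1, k) is the inversion times (1, k; 0, 5), and
    \<open>ht_Fricke\<close> evaluates the inversion.\<close>
  also have "\<dots> = pullback 1 k 0 5 (pullback 0 (- 1) 1 0 ht)"
    by (subst pullback_pullback) auto
  also have "\<dots> = 5 / pullback 1 k 0 5 ht"
    by (simp add: ht_Fricke pullback_arith pullback_numeral)
  finally have eq: "pullback a b c d h1 = 5 / pullback 1 k 0 5 ht" .
  have "qunit 25 (0 - (- 1)) (const_mero 5 / pullback 1 k 0 5 ht)"
    using qunit_pullback[OF ht_qunit, of 1 5 k] by (intro qunit_divide qunit_const) auto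
  then have "qunit 25 1 (pullback a b c d h1)" by (simp add: eq const_mero_numeral)
  moreover have "\<not> 25 dvd c" using False by (auto elim: dvd_trans[rotated])
  ultimately show ?thesis
    using False by (intro exI[of _ 25] exI[of _ 1]) (simp add: ord_h_def)
qed

lemma h1_qunit_75:
  assumes "a * d - b * c = 1"
  shows "qunit 75 (ord_h c) (pullback a b c d h1)"
proof -
  obtain N m where N: "N \<in> {1, 5, 25}" "qunit N m (pullback a b c d h1)" "(75 div int N) * m = ord_h c"
    using h1_cusps[OF assms] by blast
  have "qunit ((75 div N) * N) (int (75 div N) * m) (pullback a b c d h1)"
    by (rule qunit_reindex) (use N in auto)
  then show ?thesis using N by auto
qed

text \<open>The matrix diag(3, 1) is moved to the right of a matrix of determinant 1. It stays
  diag(3, 1) if 3 divides c and becomes (1, k; 0, 3) otherwise, so the order is tripled or divided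
  by 3. The division is exact, as all values of \<open>ord_h\<close> are multiples of 3.\<close>

lemma h3_qunit_75:
  assumes det: "a * d - b * c = 1"
  shows "qunit 75 (if 3 dvd c then 3 * ord_h c else ord_h c div 3) (pullback a b c d h3)"
proof (cases "3 dvd c")
  case True
  then obtain c' where c: "c = 3 * c'" by (elim dvdE)
  have "pullback 3 0 0 1 (pullback a (3 * b) c' d h1) =
          pullback (a * 3 + 3 * b * 0) (a * 0 + 3 * b * 1) (c' * 3 + d * 0) (c' * 0 + d * 1) h1"
    by (rule pullback_pullback) (use det c in \<open>auto simp: algebra_simps\<close>)
  moreover have "pullback a b c d h3 = pullback (3 * a) (3 * b) c d h1"
    unfolding h3_eq using det by (subst pullback_pullback) auto
  ultimately have "pullback a b c d h3 = pullback 3 0 0 1 (pullback a (3 * b) c' d h1)"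
    using c by (simp add: mult.commute)
  moreover have "qunit 75 (ord_h c') (pullback a (3 * b) c' d h1)"
    by (rule h1_qunit_75) (use det c in \<open>auto simp: algebra_simps\<close>)
  from qunit_pullback[OF this, of 3 1 0]
  have "qunit 75 (3 * ord_h c') (pullback 3 0 0 1 (pullback a (3 * b) c' d h1))" by simp
  moreover have "ord_h c' = ord_h c"
  proof -
    have "25 dvd 3 * c' \<longleftrightarrow> 25 dvd c'" "5 dvd 3 * c' \<longleftrightarrow> 5 dvd c'" by presburger+
    then show ?thesis unfolding ord_h_def c by simp
  qed
  ultimately show ?thesis using True by simp
next
  case False
  then have "coprime c 3" using prime_imp_coprime[of 3 c] by (simp add: coprime_commute)
  then obtain k where "3 dvd c * k - d" using inverse_mod_exists[of c 3 d] by auto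
  then obtain e where "c * k - d = 3 * (- e)" by (metis dvdE minus_minus)
  then have e: "d - c * k = 3 * e" by simp
  have det': "3 * a * e - (b - a * k) * c = 1"
  proof -
    have "3 * a * e - (b - a * k) * c = a * (d - c * k) - (b - a * k) * c" unfolding e by simp
    also have "\<dots> = 1" using det by (simp add: algebra_simps)
    finally show ?thesis .
  qed
  have "pullback 1 k 0 3 (pullback (3 * a) (b - a * k) c e h1) =
          pullback (3 * a * 1 + (b - a * k) * 0) (3 * a * k + (b - a * k) * 3) (c * 1 + e * 0) (c * k + e * 3) h1"
    by (rule pullback_pullback) (use det' in auto)
  moreover have "c * k + e * 3 = d" using e by simp
  moreover have "pullback a b c d h3 = pullback (3 * a) (3 * b) c d h1"
    unfolding h3_eq using det by (subst pullback_pullback) auto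
  ultimately have eq: "pullback a b c d h3 = pullback 1 k 0 3 (pullback (3 * a) (b - a * k) c e h1)"
    by (simp add: algebra_simps)
  obtain N m where N: "N \<in> {1, 5, 25}" "qunit N m (pullback (3 * a) (b - a * k) c e h1)" "(75 div int N) * m = ord_h c"
    using h1_cusps[OF det'] by blast
  from qunit_pullback[OF N(2), of 1 3 k]
  have "qunit (3 * N) m (pullback a b c d h3)" using N(1) by (auto simp: eq)
  then have "qunit ((25 div N) * (3 * N)) (int (25 div N) * m) (pullback a b c d h3)"
    by (rule qunit_reindex) (use N in auto)
  moreover have "(25 div N) * (3 * N) = 75" "int (25 div N) * m = ord_h c div 3"
    using N(1) by (auto simp flip: N(3))
  ultimately show ?thesis using False by simp
qed

lemma h1_invariant_75: "Gamma0_invariant 75 h1"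
  unfolding Gamma0_invariant_def
proof safe
  fix a b c d :: int
  assume "a * d - b * c = 1" "int 75 dvd c"
  moreover from this have "int 25 dvd c" by (elim dvd_trans[rotated]) simp
  ultimately show "pullback a b c d h1 = h1" by (intro Gamma0_invariantD[OF h1_invariant])
qed

lemma h3_invariant_75: "Gamma0_invariant 75 h3"
  unfolding Gamma0_invariant_def
proof safe
  fix a b c d :: int
  assume det: "a * d - b * c = 1" and "int 75 dvd c"
  then obtain c' where c: "c = 3 * (25 * c')" by (auto simp: dvd_def)
  have "pullback 3 0 0 1 (pullback a (3 * b) (25 * c') d h1) =
          pullback (a * 3 + 3 * b * 0) (a * 0 + 3 * b * 1) (25 * c' * 3 + d * 0) (25 * c' * 0 + d * 1) h1"
    by (rule pullback_pullback) (use det c in \<open>auto simp: algebra_simps\<close>)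
  moreover have "pullback a b c d h3 = pullback (3 * a) (3 * b) c d h1"
    unfolding h3_eq using det by (subst pullback_pullback) auto
  moreover have "pullback a (3 * b) (25 * c') d h1 = h1"
    using det c by (intro Gamma0_invariantD[OF h1_invariant]) (auto simp: algebra_simps)
  ultimately show "pullback a b c d h3 = h3"
    using c by (simp add: h3_eq mult.commute)
qed

lemma pullback_scalar:
  assumes "k \<noteq> 0"
  shows "pullback k 0 0 k f = f"
proof -
  obtain F where F: "F meromorphic_on uhp" "f = abs_mero F" by (rule mero_cases)
  have "k * k > 0" using assms by (auto simp: zero_less_mult_iff neq_iff)
  then show ?thesis
    using F assms by (simp add: pullback_abs_mero moebius_transform_def)
qed

lemma h1_nonzero [simp]: "h1 \<noteq> 0"
  using qunit_nonzero[OF hq_qunit] by (simp add: h1_def)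

text \<open>With h(z) = ht(5 z) the image is ht(-1/(15 z)) = 5 / ht(15 z), and ht(15 z) = h(3
  z).\<close>

lemma h1_Fricke: "pullback 0 (- 1) 75 0 h1 = 5 / h3"
proof -
  have "pullback 0 (- 1) 75 0 h1 = pullback 0 (- 5) 75 0 ht"
    by (simp add: pullback_h1)
  also have "\<dots> = pullback 75 0 0 5 (pullback 0 (- 1) 1 0 ht)"
    by (subst pullback_pullback) auto
  also have "\<dots> = 5 / pullback 75 0 0 5 ht"
    by (simp add: ht_Fricke pullback_arith pullback_numeral)
  also have "pullback (int 75) 0 0 (int 5) ht = qser 25 (\<lambda>q. hq (q ^ 75))"
    unfolding ht_def by (subst pullback_qser) (use hq_meromorphic in auto)
  then have "pullback 75 0 0 5 ht = h3"
    unfolding h3_def using qser_reindex[of 1 25 "\<lambda>q. hq (q ^ 3)"] by (simp flip: power_mult)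
  finally show ?thesis .
qed

text \<open>The matrix of the involution squares to the scalar -75, so \<open>h1_Fricke\<close> can
  be inverted.\<close>

lemma h3_Fricke: "pullback 0 (- 1) 75 0 h3 = 5 / h1"
proof -
  have "h1 = pullback 0 (- 1) 75 0 (pullback 0 (- 1) 75 0 h1)"
    using pullback_scalar[of "- 75" h1] by (subst pullback_pullback) auto
  also have "\<dots> = 5 / pullback 0 (- 1) 75 0 h3"
    by (simp add: h1_Fricke pullback_arith pullback_numeral)
  finally have eq: "h1 = 5 / pullback 0 (- 1) 75 0 h3" .
  then have "pullback 0 (- 1) 75 0 h3 \<noteq> 0" using h1_nonzero by auto
  with eq show ?thesis by (simp add: field_simps)
qed

lemma h3_nonzero [simp]: "h3 \<noteq> 0"
  using qunit_nonzero[OF h3_qunit_75[of 1 1 0 0]] by (simp add: pullback_id)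


section \<open>Functions with poles at two cusps\<close>

text \<open>Poles only at the cusps \<open>\<infinity>\<close> (\<open>75 dvd c\<close>) and \<open>0\<close> (\<open>c\<close> coprime to 75), of order at most \<open>n\<close>.\<close>

definition polar :: "nat \<Rightarrow> mero \<Rightarrow> bool" where
  "polar n f \<longleftrightarrow> Gamma0_invariant 75 f \<and>
     (\<exists>F. F holomorphic_on ball 0 1 \<and> f = qser 1 (\<lambda>q. F q / q ^ n)) \<and>
     (\<exists>F. F holomorphic_on ball 0 1 \<and> pullback 0 (- 1) 1 0 f = qser 75 (\<lambda>q. F q / q ^ n)) \<and>
     (\<forall>a b c d. a * d - b * c = 1 \<and> \<not> 75 dvd c \<and> \<not> coprime c 75 \<longrightarrow>
        (\<exists>F. F holomorphic_on ball 0 1 \<and> pullback a b c d f = qser 75 F))"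

lemma polar_other_cusps:
  assumes "polar n f" "a * d - b * c = 1" "\<not> 75 dvd c" "\<not> coprime c 75"
  obtains F where "F holomorphic_on ball 0 1" "pullback a b c d f = qser 75 F"
proof -
  have *: "\<forall>a b c d. a * d - b * c = 1 \<and> \<not> 75 dvd c \<and> \<not> coprime c 75 \<longrightarrow>
        (\<exists>F. F holomorphic_on ball 0 1 \<and> pullback a b c d f = qser 75 F)"
    using assms(1) unfolding polar_def by (elim conjE)
  show ?thesis
    using *[rule_format, where a = a and b = b and c = c and d = d] assms(2-4) that by blast
qed

lemma divide_power_meromorphic:
  assumes "F holomorphic_on ball 0 1"
  shows "(\<lambda>q. F q / q ^ n) meromorphic_on ball 0 1"
  by (intro meromorphic_intros holomorphic_imp_meromorphic[OF assms]) auto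

lemma qser_pole_mono:
  assumes "F holomorphic_on ball 0 1" "N > 0" "n \<le> m"
  shows "\<exists>G. G holomorphic_on ball 0 1 \<and> qser N (\<lambda>q. F q / q ^ n) = qser N (\<lambda>q. G q / q ^ m)"
proof (intro exI[of _ "\<lambda>q. F q * q ^ (m - n)"] conjI)
  show hol: "(\<lambda>q. F q * q ^ (m - n)) holomorphic_on ball 0 1" by (intro holomorphic_intros assms)
  show "qser N (\<lambda>q. F q / q ^ n) = qser N (\<lambda>q. F q * q ^ (m - n) / q ^ m)"
    by (rule qser_cong[OF _ divide_power_meromorphic[OF hol] assms(2)])
       (use assms(3) in \<open>auto simp: power_diff\<close>)
qed

lemma qser_pole_add:
  assumes "F holomorphic_on ball 0 1" "G holomorphic_on ball 0 1" "N > 0"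
  shows "qser N (\<lambda>q. F q / q ^ n) + qser N (\<lambda>q. G q / q ^ n) = qser N (\<lambda>q. (F q + G q) / q ^ n)"
  using qser_arith(1)[OF divide_power_meromorphic[OF assms(1), of n] divide_power_meromorphic[OF assms(2), of n] assms(3)]
  by (simp add: add_divide_distrib)

lemma qser_pole_mult:
  assumes "F holomorphic_on ball 0 1" "G holomorphic_on ball 0 1" "N > 0"
  shows "qser N (\<lambda>q. F q / q ^ n) * qser N (\<lambda>q. G q / q ^ m) = qser N (\<lambda>q. (F q * G q) / q ^ (n + m))"
  using qser_arith(3)[OF divide_power_meromorphic[OF assms(1), of n] divide_power_meromorphic[OF assms(2), of m] assms(3)]
  by (simp add: power_add)

lemma Gamma0_invariant_arith:
  assumes "Gamma0_invariant N f" "Gamma0_invariant N g"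
  shows "Gamma0_invariant N (f + g)" "Gamma0_invariant N (f * g)"
    "Gamma0_invariant N (f - g)" "Gamma0_invariant N (f / g)"
  using assms by (auto simp: Gamma0_invariant_def pullback_arith)

lemma Gamma0_invariant_const: "Gamma0_invariant N (const_mero k)"
  by (auto simp: Gamma0_invariant_def pullback_const)

lemma Gamma0_invariant_power: "Gamma0_invariant N f \<Longrightarrow> Gamma0_invariant N (f ^ k)"
  using Gamma0_invariant_const[of N 1] by (induction k) (auto intro: Gamma0_invariant_arith)

lemma polar_mono:
  assumes "polar n f" "n \<le> m"
  shows "polar m f"
proof -
  obtain F G where FG: "F holomorphic_on ball 0 1" "f = qser 1 (\<lambda>q. F q / q ^ n)"
    "G holomorphic_on ball 0 1" "pullback 0 (- 1) 1 0 f = qser 75 (\<lambda>q. G q / q ^ n)"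
    using assms(1) unfolding polar_def by blast
  have "\<exists>F. F holomorphic_on ball 0 1 \<and> f = qser 1 (\<lambda>q. F q / q ^ m)"
    unfolding FG(2) by (rule qser_pole_mono) (use FG assms in auto)
  moreover have "\<exists>F. F holomorphic_on ball 0 1 \<and> pullback 0 (- 1) 1 0 f = qser 75 (\<lambda>q. F q / q ^ m)"
    unfolding FG(4) by (rule qser_pole_mono) (use FG assms in auto)
  ultimately show ?thesis using assms(1) unfolding polar_def by (elim conjE) (intro conjI)
qed

lemma polar_add:
  assumes "polar n f" "polar n g"
  shows "polar n (f + g)"
  unfolding polar_def
proof (intro conjI allI impI)
  show "Gamma0_invariant 75 (f + g)"
    using assms by (auto simp: polar_def intro: Gamma0_invariant_arith)
  obtain F G where FG: "F holomorphic_on ball 0 1" "f = qser 1 (\<lambda>q. F q / q ^ n)"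
    "G holomorphic_on ball 0 1" "g = qser 1 (\<lambda>q. G q / q ^ n)"
    using assms unfolding polar_def by blast
  then show "\<exists>F. F holomorphic_on ball 0 1 \<and> f + g = qser 1 (\<lambda>q. F q / q ^ n)"
    using qser_pole_add[OF FG(1,3), of 1 n] by (intro exI[of _ "\<lambda>q. F q + G q"]) (auto intro!: holomorphic_intros)
next
  obtain F G where FG: "F holomorphic_on ball 0 1" "pullback 0 (- 1) 1 0 f = qser 75 (\<lambda>q. F q / q ^ n)"
    "G holomorphic_on ball 0 1" "pullback 0 (- 1) 1 0 g = qser 75 (\<lambda>q. G q / q ^ n)"
    using assms unfolding polar_def by blast
  then show "\<exists>F. F holomorphic_on ball 0 1 \<and> pullback 0 (- 1) 1 0 (f + g) = qser 75 (\<lambda>q. F q / q ^ n)"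
    using qser_pole_add[OF FG(1,3), of 75 n]
    by (intro exI[of _ "\<lambda>q. F q + G q"]) (auto intro!: holomorphic_intros simp: pullback_arith)
next
  fix a b c d :: int
  assume abcd: "a * d - b * c = 1 \<and> \<not> 75 dvd c \<and> \<not> coprime c 75"
  obtain F where F: "F holomorphic_on ball 0 1" "pullback a b c d f = qser 75 F"
    using abcd by (auto elim: polar_other_cusps[OF assms(1)])
  obtain G where G: "G holomorphic_on ball 0 1" "pullback a b c d g = qser 75 G"
    using abcd by (auto elim: polar_other_cusps[OF assms(2)])
  note FG = F G
  have "pullback a b c d (f + g) = qser 75 (\<lambda>q. F q + G q)"
    using abcd FG by (simp add: pullback_arith qser_arith holomorphic_imp_meromorphic)
  then show "\<exists>F. F holomorphic_on ball 0 1 \<and> pullback a b c d (f + g) = qser 75 F"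
    using FG by (intro exI[of _ "\<lambda>q. F q + G q"]) (auto intro!: holomorphic_intros)
qed

lemma polar_mult:
  assumes "polar n f" "polar m g"
  shows "polar (n + m) (f * g)"
  unfolding polar_def
proof (intro conjI allI impI)
  show "Gamma0_invariant 75 (f * g)"
    using assms by (auto simp: polar_def intro: Gamma0_invariant_arith)
  obtain F G where FG: "F holomorphic_on ball 0 1" "f = qser 1 (\<lambda>q. F q / q ^ n)"
    "G holomorphic_on ball 0 1" "g = qser 1 (\<lambda>q. G q / q ^ m)"
    using assms unfolding polar_def by blast
  then show "\<exists>F. F holomorphic_on ball 0 1 \<and> f * g = qser 1 (\<lambda>q. F q / q ^ (n + m))"
    using qser_pole_mult[OF FG(1,3), of 1 n m] by (intro exI[of _ "\<lambda>q. F q * G q"]) (auto intro!: holomorphic_intros)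
next
  obtain F G where FG: "F holomorphic_on ball 0 1" "pullback 0 (- 1) 1 0 f = qser 75 (\<lambda>q. F q / q ^ n)"
    "G holomorphic_on ball 0 1" "pullback 0 (- 1) 1 0 g = qser 75 (\<lambda>q. G q / q ^ m)"
    using assms unfolding polar_def by blast
  then show "\<exists>F. F holomorphic_on ball 0 1 \<and> pullback 0 (- 1) 1 0 (f * g) = qser 75 (\<lambda>q. F q / q ^ (n + m))"
    using qser_pole_mult[OF FG(1,3), of 75 n m]
    by (intro exI[of _ "\<lambda>q. F q * G q"]) (auto intro!: holomorphic_intros simp: pullback_arith)
next
  fix a b c d :: int
  assume abcd: "a * d - b * c = 1 \<and> \<not> 75 dvd c \<and> \<not> coprime c 75"
  obtain F where F: "F holomorphic_on ball 0 1" "pullback a b c d f = qser 75 F"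
    using abcd by (auto elim: polar_other_cusps[OF assms(1)])
  obtain G where G: "G holomorphic_on ball 0 1" "pullback a b c d g = qser 75 G"
    using abcd by (auto elim: polar_other_cusps[OF assms(2)])
  note FG = F G
  have "pullback a b c d (f * g) = qser 75 (\<lambda>q. F q * G q)"
    using abcd FG by (simp add: pullback_arith qser_arith holomorphic_imp_meromorphic)
  then show "\<exists>F. F holomorphic_on ball 0 1 \<and> pullback a b c d (f * g) = qser 75 F"
    using FG by (intro exI[of _ "\<lambda>q. F q * G q"]) (auto intro!: holomorphic_intros)
qed

lemma polar_const: "polar 0 (const_mero k)"
  unfolding polar_def
  by (auto intro!: Gamma0_invariant_const exI[of _ "\<lambda>_. k"] simp: pullback_const)

lemma polar_power: "polar n f \<Longrightarrow> polar (k * n) (f ^ k)"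
proof (induction k)
  case 0
  then show ?case using polar_const[of 1] by simp
next
  case (Suc k)
  then show ?case using polar_mult[of n f "k * n" "f ^ k"] by simp
qed

lemma polar_scale: "polar n f \<Longrightarrow> polar n (const_mero k * f)"
  using polar_mult[OF polar_const, of n f k] by simp

lemma polar_sum:
  "(\<And>i. i \<in> A \<Longrightarrow> polar n (f i)) \<Longrightarrow> polar n (\<Sum>i\<in>A. f i)"
proof (induction A rule: infinite_finite_induct)
  case empty
  then show ?case using polar_mono[OF polar_const[of 0], of n] by simp
next
  case (infinite A)
  then show ?case using polar_mono[OF polar_const[of 0], of n] by simp
next
  case (insert i A)
  then show ?case by (auto intro!: polar_add)
qed

text \<open>Cusps with 75 dvd c or with c coprime to 75 are equivalent to \<infinity> or 0, so all
  translates are holomorphic and \<open>modular_Liouville\<close> gives a constant; its value is F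
  0.\<close>

lemma vanish_of_no_poles:
  assumes inv: "Gamma0_invariant 75 f"
    and F: "F holomorphic_on ball 0 1" "f = qser 1 F" "F 0 = 0"
    and G: "G holomorphic_on ball 0 1" "pullback 0 (- 1) 1 0 f = qser 75 G"
    and other: "\<And>a b c d. a * d - b * c = 1 \<Longrightarrow> \<not> 75 dvd c \<Longrightarrow> \<not> coprime c 75 \<Longrightarrow>
       \<exists>F. F holomorphic_on ball 0 1 \<and> pullback a b c d f = qser 75 F"
  shows "f = 0"
proof -
  have "\<exists>k. f = const_mero k"
  proof (rule modular_Liouville[OF inv])
    fix a b c d :: int
    assume det: "a * d - b * c = 1"
    consider "75 dvd c" | "coprime c 75" | "\<not> 75 dvd c" "\<not> coprime c 75" by blast
    then show "\<exists>F. F holomorphic_on ball 0 1 \<and> pullback a b c d f = qser 75 F"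
    proof cases
      case 1
      then have "pullback a b c d f = qser 75 (\<lambda>q. F (q ^ 75))"
        using Gamma0_invariantD[OF inv det] qser_reindex[of 1 75 F] F(2) by simp
      then show ?thesis
        using power_map_holomorphic[OF F(1), of 1 75] by auto
    next
      case 2
      then obtain k where k: "75 dvd c * k - d" using inverse_mod_exists[of c 75 d] by auto
      have "pullback a b c d f = pullback 0 (- 1) 1 k f"
        by (rule pullback_cong_mod[OF inv]) (use det k in auto)
      also have "\<dots> = pullback (int 1) k 0 (int 1) (pullback 0 (- 1) 1 0 f)"
        by (subst pullback_pullback) auto
      also have "\<dots> = qser (1 * 75) (\<lambda>q. G (ee (of_int k / of_nat (1 * 75)) * q ^ 1))"
        unfolding G(2) by (rule pullback_qser) (use G in \<open>auto intro: holomorphic_imp_meromorphic\<close>)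
      finally have eq: "pullback a b c d f = qser 75 (\<lambda>q. G (ee (of_int k / of_nat 75) * q ^ 1))" by simp
      have "norm (ee (of_int k / of_nat 75)) = 1" by (simp add: norm_ee)
      then show ?thesis
        by (intro exI[of _ "\<lambda>q. G (ee (of_int k / of_nat 75) * q ^ 1)"] conjI eq power_map_holomorphic G(1)) auto
    next
      case 3
      then show ?thesis using other det by blast
    qed
  qed auto
  then obtain k where k: "f = const_mero k" by blast
  have "qser 1 F = qser 1 (\<lambda>_. k)" using F(2) k by simp
  then have "F 0 = k" by (intro qser_eq_imp_eq_holomorphic[of F "\<lambda>_. k" 1]) (use F in auto)
  then show ?thesis using k F(3) by simp
qed

section \<open>Taylor coefficients and linear dependence\<close>

definition dquot :: "(complex \<Rightarrow> complex) \<Rightarrow> complex \<Rightarrow> complex" where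
  "dquot F = (\<lambda>z. if z = 0 then deriv F 0 else (F z - F 0) / z)"

lemma dquot_holomorphic: "F holomorphic_on ball 0 1 \<Longrightarrow> dquot F holomorphic_on ball 0 1"
proof -
  assume "F holomorphic_on ball 0 1"
  then have "(\<lambda>z. if z = 0 then deriv F 0 else (F z - F 0) / (z - 0)) holomorphic_on ball 0 1"
    by (rule pole_lemma) auto
  then show ?thesis by (simp only: dquot_def diff_zero)
qed

lemma dquot_power_holomorphic: "F holomorphic_on ball 0 1 \<Longrightarrow> (dquot ^^ n) F holomorphic_on ball 0 1"
  by (induction n) (simp_all add: dquot_holomorphic)

lemma dquot_eq: "F q = F 0 + q * dquot F q"
  by (simp add: dquot_def)

text \<open>The i-th Taylor coefficient of F at 0 is \<open>(dquot ^^ i) F 0\<close>. Iterated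
  difference quotients are linear and provide the cofactor of q^n directly as a holomorphic
  function.\<close>

lemma dquot_factor:
  assumes "\<And>i. i < n \<Longrightarrow> (dquot ^^ i) F 0 = 0"
  shows "F q = q ^ n * (dquot ^^ n) F q"
  using assms
proof (induction n)
  case (Suc n)
  then have "F q = q ^ n * (dquot ^^ n) F q" by simp
  also have "(dquot ^^ n) F q = q * (dquot ^^ Suc n) F q"
    using dquot_eq[of "(dquot ^^ n) F" q] Suc.prems[of n] by simp
  finally show ?case by simp
qed simp

lemma dquot_linear:
  assumes "\<And>j. j \<in> A \<Longrightarrow> F j holomorphic_on ball 0 1"
  shows "dquot (\<lambda>q. \<Sum>j\<in>A. c j * F j q) = (\<lambda>q. \<Sum>j\<in>A. c j * dquot (F j) q)"
proof
  fix q :: complex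
  have "deriv (\<lambda>q. \<Sum>j\<in>A. c j * F j q) 0 = (\<Sum>j\<in>A. c j * deriv (F j) 0)"
  proof (rule DERIV_imp_deriv, intro derivative_intros)
    fix j assume "j \<in> A"
    then have "(F j has_field_derivative deriv (F j) 0) (at 0)"
      by (intro holomorphic_derivI[OF assms]) auto
    then show "((\<lambda>q. c j * F j q) has_field_derivative c j * deriv (F j) 0) (at 0)"
      by (rule DERIV_cmult)
  qed
  then show "dquot (\<lambda>q. \<Sum>j\<in>A. c j * F j q) q = (\<Sum>j\<in>A. c j * dquot (F j) q)"
    by (auto simp: dquot_def sum_divide_distrib algebra_simps simp flip: sum_subtractf)
qed

lemma dquot_power_linear:
  assumes "\<And>j. j \<in> A \<Longrightarrow> F j holomorphic_on ball 0 1"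
  shows "(dquot ^^ n) (\<lambda>q. \<Sum>j\<in>A. c j * F j q) = (\<lambda>q. \<Sum>j\<in>A. c j * (dquot ^^ n) (F j) q)"
proof (induction n)
  case (Suc n)
  then show ?case
    using dquot_linear[of A "\<lambda>j. (dquot ^^ n) (F j)" c] assms dquot_power_holomorphic by simp
qed simp

text \<open>Gaussian elimination: the last equation is solved for a pivot unknown p, and
  \<open>M'\<close> is the system left for the others.\<close>

lemma homogeneous_system_solution:
  fixes M :: "nat \<Rightarrow> 'a \<Rightarrow> complex"
  assumes "finite J" "k < card J"
  shows "\<exists>c. (\<exists>j\<in>J. c j \<noteq> 0) \<and> (\<forall>i<k. (\<Sum>j\<in>J. M i j * c j) = 0)"
  using assms
proof (induction k arbitrary: J M)
  case 0
  then have "J \<noteq> {}" by auto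
  then show ?case by (intro exI[of _ "\<lambda>_. 1"]) auto
next
  case (Suc k)
  show ?case
  proof (cases "\<forall>j\<in>J. M k j = 0")
    case True
    obtain c where "\<exists>j\<in>J. c j \<noteq> 0" "\<forall>i<k. (\<Sum>j\<in>J. M i j * c j) = 0"
      using Suc.IH[of J M] Suc.prems by auto
    then show ?thesis using True by (intro exI[of _ c]) (auto simp: less_Suc_eq)
  next
    case False
    then obtain p where p: "p \<in> J" "M k p \<noteq> 0" by blast
    define J' where "J' = J - {p}"
    have J': "finite J'" "k < card J'" "p \<notin> J'" "J = insert p J'"
      using Suc.prems p by (auto simp: J'_def)
    define M' where "M' = (\<lambda>i j. M i j - M i p * M k j / M k p)"
    obtain c where c: "\<exists>j\<in>J'. c j \<noteq> 0" "\<And>i. i < k \<Longrightarrow> (\<Sum>j\<in>J'. M' i j * c j) = 0"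
      using Suc.IH[OF J'(1,2), of M'] by blast
    define s where "s = (\<Sum>j\<in>J'. M k j * c j)"
    define c' where "c' = c(p := - s / M k p)"
    have sum: "(\<Sum>j\<in>J. M i j * c' j) = (\<Sum>j\<in>J'. M i j * c j) - M i p * s / M k p" for i
    proof -
      have "(\<Sum>j\<in>J'. M i j * c' j) = (\<Sum>j\<in>J'. M i j * c j)"
        using J'(3) by (intro sum.cong) (auto simp: c'_def)
      then show ?thesis using J' by (simp add: c'_def)
    qed
    have "(\<Sum>j\<in>J. M i j * c' j) = 0" if "i < Suc k" for i
    proof (cases "i = k")
      case True
      then show ?thesis using p by (simp add: sum s_def)
    next
      case False
      with that have "i < k" by simp
      from c(2)[OF this] have "(\<Sum>j\<in>J'. M i j * c j) - (\<Sum>j\<in>J'. M i p * M k j / M k p * c j) = 0"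
        by (simp add: M'_def algebra_simps sum_subtractf)
      moreover have "(\<Sum>j\<in>J'. M i p * M k j / M k p * c j) = M i p * s / M k p"
        by (simp add: s_def sum_distrib_left sum_divide_distrib mult_ac)
      ultimately show ?thesis by (simp add: sum)
    qed
    moreover have "\<exists>j\<in>J. c' j \<noteq> 0"
      using c(1) J' by (auto simp: c'_def)
    ultimately show ?thesis by blast
  qed
qed

text \<open>The 2n + 1 linear conditions are the n polar coefficients and the constant term at
  \<infinity>, and the n polar coefficients at 0. A combination satisfying them has no poles and
  vanishes at \<infinity>.\<close>

theorem polar_dependent:
  fixes f :: "'a \<Rightarrow> mero"
  assumes "finite J" "card J \<ge> 2 * n + 2" and polar: "\<And>j. j \<in> J \<Longrightarrow> polar n (f j)"
  shows "\<exists>c. (\<exists>j\<in>J. c j \<noteq> 0) \<and> (\<Sum>j\<in>J. const_mero (c j) * f j) = 0"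
proof -
  have "\<forall>j\<in>J. \<exists>F. F holomorphic_on ball 0 1 \<and> f j = qser 1 (\<lambda>q. F q / q ^ n)"
    "\<forall>j\<in>J. \<exists>G. G holomorphic_on ball 0 1 \<and> pullback 0 (- 1) 1 0 (f j) = qser 75 (\<lambda>q. G q / q ^ n)"
    using polar unfolding polar_def by blast+
  from this[THEN bchoice] obtain F G where
    FG: "\<forall>j\<in>J. F j holomorphic_on ball 0 1 \<and> f j = qser 1 (\<lambda>q. F j q / q ^ n)"
      "\<forall>j\<in>J. G j holomorphic_on ball 0 1 \<and> pullback 0 (- 1) 1 0 (f j) = qser 75 (\<lambda>q. G j q / q ^ n)"
    by (elim exE)
  have F: "F j holomorphic_on ball 0 1" "f j = qser 1 (\<lambda>q. F j q / q ^ n)" if "j \<in> J" for j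
    using FG(1) that by blast+
  have G: "G j holomorphic_on ball 0 1" "pullback 0 (- 1) 1 0 (f j) = qser 75 (\<lambda>q. G j q / q ^ n)" if "j \<in> J" for j
    using FG(2) that by blast+
  define M where "M = (\<lambda>i j. if i \<le> n then (dquot ^^ i) (F j) 0 else (dquot ^^ (i - n - 1)) (G j) 0)"
  have "\<exists>c. (\<exists>j\<in>J. c j \<noteq> 0) \<and> (\<forall>i<2*n+1. (\<Sum>j\<in>J. M i j * c j) = 0)"
    by (rule homogeneous_system_solution) (use assms in auto)
  then obtain c where c: "\<exists>j\<in>J. c j \<noteq> 0" "\<And>i. i < 2*n+1 \<Longrightarrow> (\<Sum>j\<in>J. M i j * c j) = 0" by blast
  define s where "s = (\<Sum>j\<in>J. const_mero (c j) * f j)"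
  define Fs where "Fs = (\<lambda>q. \<Sum>j\<in>J. c j * F j q)"
  define Gs where "Gs = (\<lambda>q. \<Sum>j\<in>J. c j * G j q)"
  have hol: "Fs holomorphic_on ball 0 1" "Gs holomorphic_on ball 0 1"
    unfolding Fs_def Gs_def by (intro holomorphic_intros F G; assumption)+
  have Fs0: "(dquot ^^ i) Fs 0 = 0" if "i \<le> n" for i
    using c(2)[of i] that unfolding Fs_def by (subst dquot_power_linear[OF F(1)]) (auto simp: M_def mult.commute)
  have Gs0: "(dquot ^^ i) Gs 0 = 0" if "i < n" for i
    using c(2)[of "i + n + 1"] that unfolding Gs_def by (subst dquot_power_linear[OF G(1)]) (auto simp: M_def mult.commute)
  have scaled: "const_mero k * qser N (\<lambda>q. H q / q ^ n) = qser N (\<lambda>q. k * (H q / q ^ n))"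
    if "H holomorphic_on ball 0 1" "N > 0" for H N k
    using qser_arith(3)[OF _ divide_power_meromorphic[OF that(1)] that(2), of "\<lambda>_. k" n] by (simp add: meromorphic_on_const)
  have mero: "(\<lambda>q. k * (H q / q ^ n)) meromorphic_on ball 0 1" if "H holomorphic_on ball 0 1" for H k
    by (intro meromorphic_intros divide_power_meromorphic that)
  have s1: "s = qser 1 (\<lambda>q. Fs q / q ^ n)"
    using F mero by (simp add: s_def scaled qser_sum Fs_def sum_divide_distrib)
  have "pullback 0 (- 1) 1 0 s = (\<Sum>j\<in>J. const_mero (c j) * pullback 0 (- 1) 1 0 (f j))"
    by (simp add: s_def pullback_sum pullback_arith pullback_const)
  also have "\<dots> = qser 75 (\<lambda>q. Gs q / q ^ n)"
    using G mero by (simp add: scaled qser_sum Gs_def sum_divide_distrib)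
  finally have s2: "pullback 0 (- 1) 1 0 s = qser 75 (\<lambda>q. Gs q / q ^ n)" .
  have polar_s: "polar n s"
    unfolding s_def by (intro polar_sum polar_scale polar)
  have hol': "(\<lambda>q. q * (dquot ^^ (n + 1)) Fs q) holomorphic_on ball 0 1" "(dquot ^^ n) Gs holomorphic_on ball 0 1"
    by (intro holomorphic_intros dquot_power_holomorphic hol)+
  have "s = 0"
  proof (rule vanish_of_no_poles[where F = "\<lambda>q. q * (dquot ^^ (n + 1)) Fs q" and G = "(dquot ^^ n) Gs"])
    show "s = qser 1 (\<lambda>q. q * (dquot ^^ (n + 1)) Fs q)"
      unfolding s1
    proof (rule qser_cong)
      fix q :: complex assume "q \<in> ball 0 1 - {0}"
      then show "Fs q / q ^ n = q * (dquot ^^ (n + 1)) Fs q"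
        using dquot_factor[of "n + 1" Fs q] Fs0 by (simp add: field_simps)
    qed (use hol' in \<open>auto intro: holomorphic_imp_meromorphic\<close>)
    show "pullback 0 (- 1) 1 0 s = qser 75 ((dquot ^^ n) Gs)"
      unfolding s2
    proof (rule qser_cong)
      fix q :: complex assume "q \<in> ball 0 1 - {0}"
      then show "Gs q / q ^ n = (dquot ^^ n) Gs q"
        using dquot_factor[of n Gs q] Gs0 by (simp add: field_simps)
    qed (use hol' in \<open>auto intro: holomorphic_imp_meromorphic\<close>)
  qed (use hol' polar_s in \<open>auto simp: polar_def[of n s] elim: polar_other_cusps[OF polar_s]\<close>)
  with c(1) show ?thesis unfolding s_def by blast
qed

section \<open>Monomials in \<open>h1\<close> and \<open>h3\<close>\<close>

definition uX :: mero where "uX = h3 / h1"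
definition sX :: mero where "sX = h3 ^ 2 / h1"
definition sY :: mero where "sY = h3 / h1 ^ 2"

text \<open>The bounds between k and l are the nonnegativity of the orders at the remaining cusps:
  75 l - 25 k if 25 but not 3 divides c, and 9 k - 3 l if 3 but not 5 divides c; if 5 but not 25
  divides c the order is 0. The pole orders at \<infinity> and 0 are 3 k - l and 3 l - k, which n
  bounds.\<close>

lemma monomial_polar:
  fixes a b :: int and k l :: nat
  assumes f: "f = h3 ^ k / h1 ^ l" and kl: "k \<le> 3 * l" "l \<le> 3 * k"
    and n: "3 * int k - int l \<le> int n" "3 * int l - int k \<le> int n"
  shows "polar n f"
proof -
  have orders: "qunit 75 (int k * (if 3 dvd c then 3 * ord_h c else ord_h c div 3) - int l * ord_h c) (pullback a b c d f)"
    if "a * d - b * c = 1" for a b c d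
  proof -
    have e: "pullback a b c d f = pullback a b c d h3 ^ k / pullback a b c d h1 ^ l"
      unfolding f using that by (simp add: pullback_arith pullback_power)
    show ?thesis
      unfolding e by (intro qunit_divide qunit_power h1_qunit_75[OF that] h3_qunit_75[OF that]) auto
  qed
  show ?thesis
    unfolding polar_def
  proof (intro conjI allI impI)
    show "Gamma0_invariant 75 f"
      unfolding f by (intro Gamma0_invariant_arith Gamma0_invariant_power h1_invariant_75 h3_invariant_75)
  next
    have "qunit 1 (- 3) h3"
      using qunit_pullback[OF hq_qunit, of 3 1 0] by (simp add: h3_eq h1_def)
    then have "qunit 1 (int k * (- 3) - int l * (- 1)) f"
      unfolding f by (intro qunit_divide qunit_power hq_qunit[folded h1_def]) auto
    then obtain F where "F holomorphic_on ball 0 1" "f = qser 1 (\<lambda>q. F q / q ^ n)"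
      by (rule qunit_expansion[of _ _ _ n]) (use n in auto)
    then show "\<exists>F. F holomorphic_on ball 0 1 \<and> f = qser 1 (\<lambda>q. F q / q ^ n)" by blast
  next
    have "qunit 75 (int k * 1 - int l * 3) (pullback 0 (- 1) 1 0 f)"
      using orders[of 0 0 "-1" 1] by (simp add: ord_h_def)
    then obtain F where "F holomorphic_on ball 0 1" "pullback 0 (- 1) 1 0 f = qser 75 (\<lambda>q. F q / q ^ n)"
      by (rule qunit_expansion[of _ _ _ n]) (use n in auto)
    then show "\<exists>F. F holomorphic_on ball 0 1 \<and> pullback 0 (- 1) 1 0 f = qser 75 (\<lambda>q. F q / q ^ n)" by blast
  next
    fix a b c d :: int
    assume abcd: "a * d - b * c = 1 \<and> \<not> 75 dvd c \<and> \<not> coprime c 75"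
    define m where "m = int k * (if 3 dvd c then 3 * ord_h c else ord_h c div 3) - int l * ord_h c"
    have "m \<ge> 0"
    proof -
      consider "25 dvd c" "\<not> 3 dvd c" | "5 dvd c" "\<not> 25 dvd c" | "\<not> 5 dvd c" "3 dvd c"
      proof -
        have "coprime c 75" if "\<not> 5 dvd c" "\<not> 3 dvd c"
        proof -
          have "coprime c 5" "coprime c 3"
            using that prime_imp_coprime[of 5 c] prime_imp_coprime[of 3 c] by (auto simp: coprime_commute)
          then have "coprime c (5 * (5 * 3))" by (intro coprime_mult_right_iff[THEN iffD2] conjI)
          then show ?thesis by simp
        qed
        moreover have "75 dvd c" if "25 dvd c" "3 dvd c" using that by presburger
        ultimately show ?thesis using that abcd by blast
      qed
      then show ?thesis
      proof cases
        case 3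
        then have "\<not> 25 dvd c" by presburger
        with 3 kl show ?thesis by (simp add: m_def ord_h_def)
      qed (use kl in \<open>auto simp: m_def ord_h_def\<close>)
    qed
    have "qunit 75 m (pullback a b c d f)" unfolding m_def using orders abcd by blast
    then obtain F where "F holomorphic_on ball 0 1" "pullback a b c d f = qser 75 (\<lambda>q. F q / q ^ 0)"
      by (rule qunit_expansion[of _ _ _ 0]) (use \<open>m \<ge> 0\<close> in auto)
    then show "\<exists>F. F holomorphic_on ball 0 1 \<and> pullback a b c d f = qser 75 F" by auto
  qed
qed

lemma uX_polar: "polar 2 uX"
  by (rule monomial_polar[of _ 1 1]) (auto simp: uX_def)

lemma sX_polar: "polar 5 sX"
  by (rule monomial_polar[of _ 2 1]) (auto simp: sX_def)

lemma sY_polar: "polar 5 sY"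
  by (rule monomial_polar[of _ 1 2]) (auto simp: sY_def)


section \<open>Clearing poles\<close>

text \<open>The value at q itself is ignored, in keeping with the identification of functions up to
  sparse sets.\<close>

definition removable :: "(complex \<Rightarrow> complex) \<Rightarrow> complex \<Rightarrow> bool" where
  "removable F q \<longleftrightarrow> (\<exists>H. H analytic_on {q} \<and> (\<forall>\<^sub>F x in at q. F x = H x))"

lemma removable_analytic: "F analytic_on {q} \<Longrightarrow> removable F q"
  unfolding removable_def by (intro exI[of _ F]) auto

lemma removable_mult:
  assumes "removable F q" "removable G q"
  shows "removable (\<lambda>x. F x * G x) q"
proof -
  obtain H K where HK: "H analytic_on {q}" "\<forall>\<^sub>F x in at q. F x = H x" "K analytic_on {q}" "\<forall>\<^sub>F x in at q. G x = K x"
    using assms unfolding removable_def by blast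
  have "\<forall>\<^sub>F x in at q. F x * G x = H x * K x"
    using HK(2,4) by eventually_elim simp
  moreover have "(\<lambda>x. H x * K x) analytic_on {q}" by (intro analytic_intros HK)
  ultimately show ?thesis unfolding removable_def by blast
qed

lemma removable_cong:
  assumes "removable F q" "\<forall>\<^sub>F x in at q. G x = F x"
  shows "removable G q"
proof -
  obtain H where H: "H analytic_on {q}" "\<forall>\<^sub>F x in at q. F x = H x"
    using assms(1) unfolding removable_def by blast
  have "\<forall>\<^sub>F x in at q. G x = H x" using H(2) assms(2) by eventually_elim simp
  with H(1) show ?thesis unfolding removable_def by blast
qed

lemma removable_compose:
  assumes "removable F (g z)" "g analytic_on {z}" "\<forall>\<^sub>F x in at z. g x \<noteq> g z"
  shows "removable (\<lambda>x. F (g x)) z"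
proof -
  obtain H where H: "H analytic_on {g z}" "\<forall>\<^sub>F x in at (g z). F x = H x"
    using assms(1) unfolding removable_def by blast
  have "g \<midarrow>z\<rightarrow> g z"
    using assms(2) analytic_at_imp_isCont isContD by blast
  then have "filterlim g (at (g z)) (at z)" using assms(3) by (simp add: filterlim_at)
  then have "\<forall>\<^sub>F x in at z. F (g x) = H (g x)"
    using H(2) unfolding filterlim_iff by blast
  moreover have "(H \<circ> g) analytic_on {z}"
    by (rule analytic_on_compose_gen[OF assms(2) H(1)]) auto
  ultimately show ?thesis unfolding removable_def o_def by blast
qed

lemma eventually_ee_neq:
  assumes "N > 0"
  shows "\<forall>\<^sub>F z in at z0. ee (z / of_nat N) \<noteq> ee (z0 / of_nat N)"
proof -
  have "eventually (\<lambda>z. z \<in> ball z0 1 - {z0}) (at z0)"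
    by (intro eventually_at_in_open) auto
  then show ?thesis
  proof eventually_elim
    case (elim z)
    show ?case
    proof
      assume "ee (z / of_nat N) = ee (z0 / of_nat N)"
      then obtain n :: int where "z / of_nat N = z0 / of_nat N + of_int n"
        unfolding ee_eq_iff by blast
      then have "(z - z0) / of_nat N = of_int n" by (simp add: diff_divide_distrib)
      then have n: "z - z0 = of_int (n * int N)" using assms by (simp add: divide_eq_eq)
      have "norm (z - z0) < 1" using elim by (simp add: dist_norm norm_minus_commute)
      then have "\<bar>of_int (n * int N)\<bar> < (1::real)" unfolding n norm_of_int .
      then have "n * int N = 0" by linarith
      with n have "z - z0 = of_int 0" by (simp only:)
      then show False using elim by simp
    qed
  qed
qed

text \<open>A branch of the logarithm inverts e(z/N) near the point, and
  \<open>removable_compose\<close> is applied to this branch.\<close>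

lemma removable_descend:
  assumes "removable (\<lambda>z. F (ee (z / of_nat N))) z0" "N > 0"
  shows "removable F (ee (z0 / of_nat N))"
proof -
  define q0 where "q0 = ee (z0 / of_nat N)"
  have q0: "q0 \<noteq> 0" by (simp add: q0_def)
  define L where "L = (\<lambda>q. z0 + of_nat N / (2 * of_real pi * \<i>) * Ln (q / q0))"
  have L0: "L q0 = z0" using q0 by (simp add: L_def)
  have EL: "ee (L q / of_nat N) = q" if "q \<noteq> 0" for q
  proof -
    have "L q / of_nat N = z0 / of_nat N + Ln (q / q0) / (2 * of_real pi * \<i>)"
      using assms(2) by (simp add: L_def add_divide_distrib)
    then have "ee (L q / of_nat N) = q0 * ee (Ln (q / q0) / (2 * of_real pi * \<i>))"
      by (simp add: ee_add q0_def)
    also have "ee (Ln (q / q0) / (2 * of_real pi * \<i>)) = exp (Ln (q / q0))"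
      by (simp add: ee_def)
    also have "q0 * exp (Ln (q / q0)) = q" using q0 that by simp
    finally show ?thesis .
  qed
  have nz: "\<forall>\<^sub>F q in at q0. q \<noteq> 0 \<and> q \<noteq> q0"
    using eventually_at_in_open[of "- {0}" q0] q0 by (auto elim!: eventually_mono)
  have "removable (\<lambda>q. (\<lambda>z. F (ee (z / of_nat N))) (L q)) q0"
  proof (rule removable_compose[where F = "\<lambda>z. F (ee (z / of_nat N))" and g = L and z = q0])
    show "removable (\<lambda>z. F (ee (z / of_nat N))) (L q0)" using assms(1) by (simp add: L0)
    show "L analytic_on {q0}"
      unfolding L_def using q0 by (intro analytic_intros) auto
    show "\<forall>\<^sub>F q in at q0. L q \<noteq> L q0"
      using nz
    proof eventually_elim
      case (elim q)
      show ?case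
      proof
        assume "L q = L q0"
        then have "ee (L q / of_nat N) = ee (L q0 / of_nat N)" by simp
        then show False using elim EL q0 by simp
      qed
    qed
  qed
  then show ?thesis
    unfolding q0_def[symmetric]
    by (rule removable_cong) (use nz EL in \<open>auto elim!: eventually_mono\<close>)
qed

text \<open>The Moebius map and both exponential maps are analytic and locally injective, so a
  removable singularity at the image point yields one at the original point.\<close>

lemma removable_transfer:
  assumes T: "T1 meromorphic_on ball 0 1" "T2 meromorphic_on ball 0 1" and NM: "N > 0" "M > 0"
    and det: "a * d - b * c = 1"
    and eq: "qser N T1 = pullback a b c d (qser M T2)" and z: "z \<in> uhp"
    and rem: "removable T2 (ee (moebius_transform a b c d z / of_nat M))"
  shows "removable T1 (ee (z / of_nat N))"
proof (rule removable_descend[OF _ NM(1)])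
  have det': "a * d - b * c > 0" using det by simp
  have "\<forall>\<^sub>\<approx>z\<in>uhp. T1 (ee (z / of_nat N)) = T2 (ee (moebius_transform a b c d z / of_nat M))"
    using eq unfolding qser_def
    by (subst (asm) pullback_abs_mero[OF det' qcomp_meromorphic[OF T(2) NM(2)]], subst (asm) abs_mero_eq_iff)
       (auto intro: qcomp_meromorphic T NM moebius_meromorphic[OF det' qcomp_meromorphic[OF T(2) NM(2)]])
  then have ev: "\<forall>\<^sub>F x in at z. T1 (ee (x / of_nat N)) = T2 (ee (moebius_transform a b c d x / of_nat M))"
    using z by (simp add: eventually_cosparse_open_eq)
  define m where "m = moebius_transform a b c d"
  have m: "m analytic_on {z}"
    using moebius_transform_analytic[OF det'] z unfolding m_def by (auto intro: analytic_on_subset)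
  have "eventually (\<lambda>w. w \<in> uhp - {z}) (at z)"
    using z by (intro eventually_at_in_open) auto
  then have m_neq: "\<forall>\<^sub>F x in at z. m x \<noteq> m z"
    by eventually_elim (use moebius_transform_inj[OF det'] z in \<open>auto simp: m_def\<close>)
  have "(\<lambda>x. ee (x / of_nat M)) analytic_on {m z}"
    using NM by (intro analytic_intros) auto
  then have "removable (\<lambda>x. T2 (ee (x / of_nat M))) (m z)"
    using rem eventually_ee_neq[OF NM(2), of "m z"]
    by (intro removable_compose[where F = T2 and g = "\<lambda>x. ee (x / of_nat M)" and z = "m z"]) (auto simp: m_def)
  then have "removable (\<lambda>x. T2 (ee (m x / of_nat M))) z"
    by (rule removable_compose[where F = "\<lambda>x. T2 (ee (x / of_nat M))", OF _ m m_neq])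
  then show "removable (\<lambda>z. T1 (ee (z / of_nat N))) z"
    by (rule removable_cong) (use ev in \<open>simp add: m_def\<close>)
qed

lemma removable_imp_holomorphic:
  assumes F: "F meromorphic_on A" "open A" and rem: "\<And>q. q \<in> A \<Longrightarrow> removable F q"
  shows "\<exists>H. H holomorphic_on A \<and> (\<forall>\<^sub>\<approx>q\<in>A. F q = H q)"
proof (intro exI[of _ "remove_sings F"] conjI)
  have "remove_sings F analytic_on {q}" if q: "q \<in> A" for q
  proof -
    obtain H where H: "H analytic_on {q}" "\<forall>\<^sub>F x in at q. F x = H x"
      using rem[OF q] unfolding removable_def by blast
    have "H \<midarrow>q\<rightarrow> H q" using H(1) analytic_at_imp_isCont isContD by blast
    then have "F \<midarrow>q\<rightarrow> H q"
      by (rule Lim_transform_eventually) (use H(2) in \<open>auto elim!: eventually_mono\<close>)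
    then show ?thesis
      using meromorphic_on_isolated_singularity meromorphic_on_subset[OF F(1), of "{q}"] q
      by (intro remove_sings_analytic_at) auto
  qed
  then have "remove_sings F analytic_on A" using analytic_on_analytic_at by blast
  then show "remove_sings F holomorphic_on A" by (rule analytic_imp_holomorphic)
  show "\<forall>\<^sub>\<approx>q\<in>A. F q = remove_sings F q"
    using eventually_remove_sings_eq[OF F(1)] by (auto elim!: eventually_mono)
qed

text \<open>Stated for all large k, so that a single exponent can serve finitely many poles.\<close>

lemma pole_order_exists:
  assumes "F meromorphic_on {p}"
  shows "\<exists>n. \<forall>k\<ge>n. removable (\<lambda>x. (x - p) ^ k * F x) p"
proof -
  obtain L where L: "(\<lambda>w. F (p + w)) has_laurent_expansion L"
    using assms by (auto simp: meromorphic_on_def)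
  define P where "P = fls_base_factor_to_fps L"
  have conv: "fps_conv_radius P > 0"
    using L by (auto simp: has_laurent_expansion_def fls_conv_radius_altdef P_def)
  have ev: "\<forall>\<^sub>F w in at 0. F (p + w) = eval_fps P w * w powi fls_subdegree L"
    using L by (auto simp: has_laurent_expansion_def eval_fls_def P_def elim!: eventually_mono)
  then have ev': "\<forall>\<^sub>F x in at p. F x = eval_fps P (x - p) * (x - p) powi fls_subdegree L"
    by (subst at_to_0) (simp add: eventually_filtermap add.commute)
  have evp: "\<forall>\<^sub>F x in at p. x \<noteq> p" by (simp add: eventually_at_filter)
  have ana: "(\<lambda>x. (x - p) ^ n * eval_fps P (x - p)) analytic_on {p}" for n
    using conv by (intro analytic_intros) (auto simp: zero_ereal_def[symmetric])
  have "removable (\<lambda>x. (x - p) ^ k * F x) p" if "k \<ge> nat (- fls_subdegree L)" for k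
  proof (rule removable_cong[OF removable_analytic[OF ana[of "nat (int k + fls_subdegree L)"]]])
    show "\<forall>\<^sub>F x in at p. (x - p) ^ k * F x = (x - p) ^ nat (int k + fls_subdegree L) * eval_fps P (x - p)"
      using ev' evp
    proof eventually_elim
      case (elim x)
      have "(x - p) ^ nat (int k + fls_subdegree L) = (x - p) powi (int k + fls_subdegree L)"
        using that by (simp flip: power_int_of_nat)
      also have "\<dots> = (x - p) ^ k * (x - p) powi fls_subdegree L"
        using elim by (simp add: power_int_add)
      finally show ?case using elim by simp
    qed
  qed
  then show ?thesis by blast
qed

text \<open>U x - U p is divisible by x - p, so its k-th power absorbs a pole of order at most
  k.\<close>

lemma removable_zero_times_pole:
  assumes "U analytic_on {p}" "removable (\<lambda>x. (x - p) ^ k * F x) p"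
  shows "removable (\<lambda>x. (U x - U p) ^ k * F x) p"
proof -
  obtain e where e: "e > 0" "U holomorphic_on ball p e"
    using assms(1) by (auto simp: analytic_on_def)
  define W where "W = (\<lambda>x. if x = p then deriv U p else (U x - U p) / (x - p))"
  have "W holomorphic_on ball p e"
    unfolding W_def by (rule pole_lemma) (use e in auto)
  then have "W analytic_on {p}"
    by (rule holomorphic_on_imp_analytic_at) (use e in auto)
  then have "(\<lambda>x. W x ^ k) analytic_on {p}" by (intro analytic_intros)
  from removable_mult[OF removable_analytic[OF this] assms(2)]
  show ?thesis
  proof (rule removable_cong)
    have "U x - U p = W x * (x - p)" for x by (simp add: W_def)
    then show "\<forall>\<^sub>F x in at p. (U x - U p) ^ k * F x = W x ^ k * ((x - p) ^ k * F x)"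
      by (simp add: power_mult_distrib mult_ac)
  qed
qed

lemma uniform_bound_finite:
  assumes "finite A" "\<And>x. x \<in> A \<Longrightarrow> \<exists>n. \<forall>k\<ge>n. P k x"
  shows "\<exists>n::nat. \<forall>x\<in>A. P n x"
proof -
  have "\<exists>n. \<forall>k\<ge>n. \<forall>x\<in>A. P k x"
    using assms
  proof (induction A rule: finite_induct)
    case (insert x A)
    then obtain n m where "\<forall>k\<ge>n. P k x" "\<forall>k\<ge>m. \<forall>x\<in>A. P k x" by blast
    then show ?case by (intro exI[of _ "max n m"]) auto
  qed auto
  then show ?thesis by blast
qed

lemma qser_removable_0:
  assumes "T meromorphic_on ball 0 1" "N > 0" "\<And>q. q \<in> ball 0 1 \<Longrightarrow> removable T q"
  shows "\<exists>H. H holomorphic_on ball 0 1 \<and> qser N T = qser N H"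
proof -
  obtain H where H: "H holomorphic_on ball 0 1" "\<forall>\<^sub>\<approx>q\<in>ball 0 1. T q = H q"
    using removable_imp_holomorphic[OF assms(1) open_ball assms(3)] by blast
  moreover have "open (ball 0 1 - {0 :: complex})" by auto
  ultimately have "\<forall>\<^sub>\<approx>q\<in>ball 0 1 - {0}. T q = H q"
    by (auto simp: eventually_cosparse_open_eq)
  with H show ?thesis
    by (intro exI[of _ H]) (auto intro!: qser_cong_cosparse assms holomorphic_imp_meromorphic)
qed

lemma qser_removable_punctured:
  assumes T: "T meromorphic_on ball 0 1" "N > 0" "\<And>q. q \<in> ball 0 1 - {0} \<Longrightarrow> removable T q"
  shows "\<exists>n H. H holomorphic_on ball 0 1 \<and> qser N T = qser N (\<lambda>q. H q / q ^ n)"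
proof -
  have "T meromorphic_on {0}" using T(1) by (rule meromorphic_on_subset) auto
  then obtain n where n: "removable (\<lambda>x. (x - 0) ^ n * T x) 0"
    using pole_order_exists[of T 0] by blast
  have rem: "removable (\<lambda>x. x ^ n * T x) q" if "q \<in> ball 0 1" for q
  proof (cases "q = 0")
    case False
    have "(\<lambda>x. x ^ n) analytic_on {q}" by (intro analytic_intros)
    then show ?thesis using False that by (intro removable_mult[OF removable_analytic T(3)]) auto
  qed (use n in simp)
  have mero: "(\<lambda>x. x ^ n * T x) meromorphic_on ball 0 1" by (intro meromorphic_intros T)
  obtain H where H: "H holomorphic_on ball 0 1" "\<forall>\<^sub>\<approx>q\<in>ball 0 1. q ^ n * T q = H q"
    using removable_imp_holomorphic[OF mero open_ball rem] by blast
  have "\<forall>\<^sub>\<approx>q\<in>ball 0 1 - {0}. T q = H q / q ^ n"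
  proof -
    have op: "open (ball 0 1 - {0 :: complex})" by auto
    have "\<forall>\<^sub>F q in at q0. T q = H q / q ^ n" if "q0 \<in> ball 0 1 - {0}" for q0
    proof -
      have "\<forall>\<^sub>F q in at q0. q ^ n * T q = H q"
        using H(2) that by (simp add: eventually_cosparse_open_eq)
      moreover have "\<forall>\<^sub>F q in at q0. q \<in> ball 0 1 - {0} - {q0}"
        using that op by (intro eventually_at_in_open)
      ultimately show ?thesis by eventually_elim (auto simp: field_simps)
    qed
    then show ?thesis by (simp add: eventually_cosparse_open_eq[OF op])
  qed
  with H show ?thesis
    by (intro exI[of _ n] exI[of _ H]) (auto intro!: qser_cong_cosparse T divide_power_meromorphic)
qed

lemma pullback_prod:
  "a * d - b * c > 0 \<Longrightarrow> pullback a b c d (prod f A) = (\<Prod>x\<in>A. pullback a b c d (f x))"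
  by (induction A rule: infinite_finite_induct) (simp_all add: pullback_1 pullback_arith)

lemma meromorphic_on_prod':
  "(\<And>x. x \<in> A \<Longrightarrow> f x meromorphic_on S) \<Longrightarrow> (\<lambda>z. \<Prod>x\<in>A. f x z) meromorphic_on S"
  by (induction A rule: infinite_finite_induct) (auto intro!: meromorphic_intros meromorphic_on_const)

lemma analytic_on_prod':
  "(\<And>x. x \<in> A \<Longrightarrow> f x analytic_on S) \<Longrightarrow> (\<lambda>z. \<Prod>x\<in>A. f x z) analytic_on S"
  by (induction A rule: infinite_finite_induct) (auto intro!: analytic_intros)

lemma qser_prod:
  assumes "\<And>i. i \<in> A \<Longrightarrow> F i meromorphic_on ball 0 1" "N > 0"
  shows "(\<Prod>i\<in>A. qser N (F i)) = qser N (\<lambda>q. \<Prod>i\<in>A. F i q)"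
  using assms(1)
proof (induction A rule: infinite_finite_induct)
  case (insert i A)
  then show ?case
    using qser_arith(3)[of "F i" "\<lambda>q. \<Prod>i\<in>A. F i q" N] assms(2) by (simp add: meromorphic_on_prod')
qed simp_all

definition clearing :: "complex set \<Rightarrow> nat \<Rightarrow> mero \<Rightarrow> mero" where
  "clearing C k v = (\<Prod>c\<in>C. (v - const_mero c) ^ k)"

lemma pullback_clearing:
  "a * d - b * c > 0 \<Longrightarrow> pullback a b c d (clearing C k v) = clearing C k (pullback a b c d v)"
  by (simp add: clearing_def pullback_prod pullback_power pullback_arith pullback_const)

lemma clearing_qser:
  assumes "U meromorphic_on ball 0 1" "G meromorphic_on ball 0 1" "N > 0"
  shows "clearing C k (qser N U) * qser N G = qser N (\<lambda>q. (\<Prod>c\<in>C. (U q - c) ^ k) * G q)"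
    and "(\<lambda>q. (\<Prod>c\<in>C. (U q - c) ^ k) * G q) meromorphic_on ball 0 1"
proof -
  have mero: "(\<lambda>q. (U q - c) ^ k) meromorphic_on ball 0 1" for c
    by (intro meromorphic_intros assms)
  have 1: "(qser N U - const_mero c) ^ k = qser N (\<lambda>q. (U q - c) ^ k)" for c
    using qser_arith(2)[OF assms(1) meromorphic_on_const[of c] assms(3)]
    by (simp add: qser_power[OF meromorphic_on_diff[OF assms(1) meromorphic_on_const] assms(3)])
  show "(\<lambda>q. (\<Prod>c\<in>C. (U q - c) ^ k) * G q) meromorphic_on ball 0 1"
    by (intro meromorphic_intros meromorphic_on_prod' mero assms)
  show "clearing C k (qser N U) * qser N G = qser N (\<lambda>q. (\<Prod>c\<in>C. (U q - c) ^ k) * G q)"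
    unfolding clearing_def 1 using mero assms
    by (simp add: qser_prod qser_arith meromorphic_on_prod')
qed

text \<open>On the disc |q| \<le> r each of the finitely many translates of f has finitely many
  poles, and by reduction theory these discs account for the whole half plane. \<open>C\<close>
  collects the values that the corresponding translate of \<open>uX\<close> takes at these poles.
  The cusps other than \<infinity> and 0 are covered as q = 0, because \<open>uX\<close> is finite
  there.\<close>

theorem clear_poles:
  assumes f: "f \<in> modular_functions 75" and L: "has_q_expansion 1 f L"
  shows "\<exists>C k n. finite C \<and> polar n (clearing C k uX * f)"
proof -
  \<comment> \<open>Pairs are recorded because f and \<open>uX\<close> must be moved by the same
    matrix.\<close>
  define S where "S = {(pullback a b c d f, pullback a b c d uX) | a b c d. a * d - b * c = 1}"
  have f_inv: "Gamma0_invariant 75 f"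
    using f by (auto simp: modular_functions_def Gamma0_invariant_def)
  have u_inv: "Gamma0_invariant 75 uX" using uX_polar by (simp add: polar_def)
  have "finite (SL2_orbit f \<times> SL2_orbit uX)"
    using finite_SL2_orbit[OF f_inv] finite_SL2_orbit[OF u_inv] by simp
  moreover have "S \<subseteq> SL2_orbit f \<times> SL2_orbit uX"
    by (auto simp: S_def intro: SL2_orbitI)
  ultimately have S_fin: "finite S" by (rule finite_subset[rotated])
  have S_pullback: "(pullback a b c d (fst p), pullback a b c d (snd p)) \<in> S" if "p \<in> S" "a * d - b * c = 1" for p a b c d
  proof -
    obtain a' b' c' d' where p: "p = (pullback a' b' c' d' f, pullback a' b' c' d' uX)" "a' * d' - b' * c' = 1"
      using \<open>p \<in> S\<close> unfolding S_def by blast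
    have "(a' * a + b' * c) * (c' * b + d' * d) - (a' * b + b' * d) * (c' * a + d' * c) =
            (a' * d' - b' * c') * (a * d - b * c)"
      by (simp add: algebra_simps)
    then have "(a' * a + b' * c) * (c' * b + d' * d) - (a' * b + b' * d) * (c' * a + d' * c) = 1"
      using p that by simp
    moreover have "pullback a b c d (pullback a' b' c' d' g) =
       pullback (a' * a + b' * c) (a' * b + b' * d) (c' * a + d' * c) (c' * b + d' * d) g" for g
      by (rule pullback_pullback) (use p that in auto)
    ultimately show ?thesis unfolding S_def p(1) fst_conv snd_conv by blast
  qed
  \<comment> \<open>Where \<open>uX\<close> has no pole at the cusp, its disc function is chosen
    holomorphic at 0, so that a pole of f at this cusp is cleared like any other.\<close>
  define regular where "regular = (\<lambda>v. \<exists>U. U holomorphic_on ball 0 1 \<and> v = qser 75 U)"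
  have exG: "\<forall>p\<in>S. \<exists>G. G meromorphic_on ball 0 1 \<and> fst p = qser 75 G"
    using f unfolding modular_functions_iff[of 75, simplified] S_def by fastforce
  have exU: "\<forall>p\<in>S. \<exists>U. U meromorphic_on ball 0 1 \<and> U holomorphic_on ball 0 1 - {0} \<and> snd p = qser 75 U \<and>
      (regular (snd p) \<longrightarrow> U holomorphic_on ball 0 1)"
  proof
    fix p assume "p \<in> S"
    then obtain a b c d where p: "snd p = pullback a b c d uX" "a * d - b * c = 1"
      unfolding S_def by auto
    show "\<exists>U. U meromorphic_on ball 0 1 \<and> U holomorphic_on ball 0 1 - {0} \<and> snd p = qser 75 U \<and>
      (regular (snd p) \<longrightarrow> U holomorphic_on ball 0 1)"
    proof (cases "regular (snd p)")
      case True
      then obtain U where "U holomorphic_on ball 0 1" "snd p = qser 75 U" unfolding regular_def by blast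
      then show ?thesis
        by (intro exI[of _ U]) (auto intro: holomorphic_imp_meromorphic holomorphic_on_subset)
    next
      case False
      have "snd p = pullback a b c d h3 / pullback a b c d h1"
        using p by (simp add: uX_def pullback_arith)
      then obtain m where "qunit 75 m (snd p)"
        using qunit_divide[OF h3_qunit_75[OF p(2)] h1_qunit_75[OF p(2)]] by auto
      then obtain U where U: "U holomorphic_on ball 0 1" "snd p = qser 75 (\<lambda>q. q powi m * U q)"
        unfolding qunit_def by blast
      have "(\<lambda>q. q powi m * U q) holomorphic_on ball 0 1 - {0}"
        by (intro holomorphic_intros holomorphic_on_subset[OF U(1)]) auto
      then show ?thesis
        using U qunit_meromorphic[OF U(1), of m] False by (intro exI[of _ "\<lambda>q. q powi m * U q"]) auto
    qed
  qed
  obtain G where G: "\<forall>p\<in>S. G p meromorphic_on ball 0 1 \<and> fst p = qser 75 (G p)"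
    using bchoice[OF exG] by blast
  obtain U where U: "\<forall>p\<in>S. U p meromorphic_on ball 0 1 \<and> U p holomorphic_on ball 0 1 - {0} \<and> snd p = qser 75 (U p) \<and>
      (regular (snd p) \<longrightarrow> U p holomorphic_on ball 0 1)"
    using bchoice[OF exU] by blast
  define r where "r = exp (- (pi / 75))"
  have r: "0 < r" "r < 1" by (simp_all add: r_def)
  define Ps where "Ps = (\<lambda>p. {q \<in> cball 0 r. \<not> removable (G p) q})"
  have Ps_fin: "finite (Ps p)" if "p \<in> S" for p
  proof -
    have "{w. \<not> G p analytic_on {w}} sparse_in ball 0 1"
      using G that meromorphic_on_imp_sparse_singularities by blast
    then have "{w. \<not> G p analytic_on {w}} sparse_in cball 0 r"
      by (rule sparse_in_subset) (use r in auto)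
    from sparse_in_compact_finite[OF this] have "finite (cball 0 r \<inter> {w. \<not> G p analytic_on {w}})"
      by simp
    then show ?thesis
      by (rule finite_subset[rotated]) (auto simp: Ps_def intro: removable_analytic)
  qed
  define C where "C = (\<Union>p\<in>S. U p ` Ps p)"
  have C_fin: "finite C" unfolding C_def using S_fin Ps_fin by auto
  have "\<exists>k::nat. \<forall>x\<in>(SIGMA p:S. Ps p). removable (\<lambda>x'. (x' - snd x) ^ k * G (fst x) x') (snd x)"
  proof (rule uniform_bound_finite)
    show "finite (SIGMA p:S. Ps p)" using S_fin Ps_fin by blast
    fix x assume "x \<in> (SIGMA p:S. Ps p)"
    then have "fst x \<in> S" "snd x \<in> ball 0 1" using r by (auto simp: Ps_def)
    then have "G (fst x) meromorphic_on {snd x}" using G by (auto intro: meromorphic_on_subset)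
    then show "\<exists>n. \<forall>k\<ge>n. removable (\<lambda>x'. (x' - snd x) ^ k * G (fst x) x') (snd x)"
      by (rule pole_order_exists)
  qed
  then obtain k where k: "\<And>p q. p \<in> S \<Longrightarrow> q \<in> Ps p \<Longrightarrow> removable (\<lambda>x. (x - q) ^ k * G p x) q"
    by fastforce
  define T where "T = (\<lambda>p q. (\<Prod>c\<in>C. (U p q - c) ^ k) * G p q)"
  have T_mero: "T p meromorphic_on ball 0 1" if "p \<in> S" for p
    unfolding T_def using clearing_qser(2)[where U = "U p" and G = "G p" and N = 75 and C = C and k = k] U G that by simp
  have T_qser: "qser 75 (T p) = clearing C k (snd p) * fst p" if "p \<in> S" for p
    unfolding T_def using clearing_qser(1)[where U = "U p" and G = "G p" and N = 75 and C = C and k = k] U G that by simp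
  have rem_A: "removable (T p) q" if "p \<in> S" "q \<in> cball 0 r" "U p analytic_on {q}" for p q
  proof (cases "q \<in> Ps p")
    case False
    then have "removable (G p) q" using that by (auto simp: Ps_def)
    moreover have "(\<lambda>q. \<Prod>c\<in>C. (U p q - c) ^ k) analytic_on {q}"
      by (intro analytic_on_prod' analytic_intros that)
    ultimately show ?thesis unfolding T_def by (intro removable_mult[OF removable_analytic])
  next
    case True
    then have UC: "U p q \<in> C" using that(1) unfolding C_def by blast
    have eq: "T p = (\<lambda>x. (\<Prod>c\<in>C - {U p q}. (U p x - c) ^ k) * ((U p x - U p q) ^ k * G p x))"
      unfolding T_def prod.remove[OF C_fin UC] by (simp add: fun_eq_iff mult_ac)
    have "(\<lambda>x. \<Prod>c\<in>C - {U p q}. (U p x - c) ^ k) analytic_on {q}"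
      by (intro analytic_on_prod' analytic_intros that)
    from removable_mult[OF removable_analytic[OF this] removable_zero_times_pole[OF that(3) k[OF that(1) True]]]
    show ?thesis unfolding eq .
  qed
  have U_ana: "U p analytic_on {q}" if "p \<in> S" "q \<in> ball 0 1 - {0}" for p q
    by (rule holomorphic_on_imp_analytic_at[of _ "ball 0 1 - {0}"]) (use U that in auto)
  \<comment> \<open>A point of the punctured disc is moved into |q| \<le> r by a matrix of
    determinant 1, at the price of passing to another pair in \<open>S\<close>.\<close>
  have rem_C: "removable (T p) q" if p: "p \<in> S" and q: "q \<in> ball 0 1 - {0}" for p q
  proof -
    obtain z where z: "z \<in> uhp" "q = ee (z / of_nat 75)"
      using ball_minus_0_cases[OF q, of 75] by auto
    obtain a b c d where abcd: "a * d - b * c = 1" "Im (moebius_transform a b c d z) \<ge> 1 / 2"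
      using reduce_uhp[OF z(1)] by blast
    define p1 where "p1 = (pullback d (- b) (- c) a (fst p), pullback d (- b) (- c) a (snd p))"
    have p1: "p1 \<in> S" unfolding p1_def
      using abcd by (intro S_pullback p) (auto simp: algebra_simps)
    have undo: "pullback a b c d (pullback d (- b) (- c) a g) = g" for g
      using pullback_inverse[of d a "- b" "- c" g] abcd by (simp add: mult.commute)
    have eq: "qser 75 (T p) = pullback a b c d (qser 75 (T p1))"
      unfolding T_qser[OF p] T_qser[OF p1] using abcd
      by (simp add: pullback_arith pullback_clearing p1_def undo)
    have "pi * 1 \<le> pi * (2 * Im (moebius_transform a b c d z))"
      using abcd(2) by (intro mult_left_mono) auto
    then have "norm (ee (moebius_transform a b c d z / of_nat 75)) \<le> r"
      by (simp add: norm_ee r_def divide_right_mono mult_ac)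
    then have "removable (T p1) (ee (moebius_transform a b c d z / of_nat 75))"
      using r by (intro rem_A p1 U_ana) auto
    then show ?thesis unfolding z(2)
      by (intro removable_transfer[OF T_mero[OF p] T_mero[OF p1] _ _ abcd(1) eq z(1)]) auto
  qed
  define g where "g = clearing C k uX * f"
  have pull_g: "pullback a b c d g = qser 75 (T (pullback a b c d f, pullback a b c d uX))"
    "(pullback a b c d f, pullback a b c d uX) \<in> S" if "a * d - b * c = 1" for a b c d
  proof -
    show *: "(pullback a b c d f, pullback a b c d uX) \<in> S" using that unfolding S_def by blast
    show "pullback a b c d g = qser 75 (T (pullback a b c d f, pullback a b c d uX))"
      unfolding T_qser[OF *] g_def using that by (simp add: pullback_arith pullback_clearing)
  qed
  \<comment> \<open>At \<infinity> \<open>polar\<close> requires an expansion in q rather than in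
    e(z/75). The expansion L provides it, and removability of the singularities is imported from
    e(z/75) through the identity matrix.\<close>
  have inf: "\<exists>n H. H holomorphic_on ball 0 1 \<and> g = qser 1 (\<lambda>q. H q / q ^ n)"
  proof -
    obtain F1 where F1: "F1 meromorphic_on ball 0 1" "f = qser 1 F1"
      using L by (auto simp: has_q_expansion_iff)
    obtain U1 where U1: "U1 holomorphic_on ball 0 1" "uX = qser 1 (\<lambda>q. U1 q / q ^ 2)"
      using uX_polar unfolding polar_def by blast
    define T1 where "T1 = (\<lambda>q. (\<Prod>c\<in>C. (U1 q / q ^ 2 - c) ^ k) * F1 q)"
    have T1: "T1 meromorphic_on ball 0 1" "g = qser 1 T1"
      unfolding T1_def g_def U1(2) F1(2)
      using clearing_qser[OF divide_power_meromorphic[OF U1(1), of 2] F1(1), where N = 1 and C = C and k = k] by simp_all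
    have "removable T1 q" if q: "q \<in> ball 0 1 - {0}" for q
    proof -
      obtain z where z: "z \<in> uhp" "q = ee (z / of_nat 1)"
        using ball_minus_0_cases[OF q, of 1] by auto
      have p: "(pullback 1 0 0 1 f, pullback 1 0 0 1 uX) \<in> S" by (rule pull_g) simp
      have "g = qser 75 (T (pullback 1 0 0 1 f, pullback 1 0 0 1 uX))"
        using pull_g(1)[of 1 1 0 0] by (simp add: pullback_id)
      then have eq: "qser 1 T1 = pullback 1 0 0 1 (qser 75 (T (pullback 1 0 0 1 f, pullback 1 0 0 1 uX)))"
        unfolding T1(2)[symmetric] by (simp only: pullback_id)
      have "ee (moebius_transform 1 0 0 1 z / of_nat 75) \<in> ball 0 1 - {0}"
        using ee_div_in_ball[OF z(1), of 75] by (simp add: moebius_transform_def)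
      then show ?thesis unfolding z(2)
        by (intro removable_transfer[OF T1(1) T_mero[OF p] _ _ _ eq z(1)] rem_C p) auto
    qed
    from qser_removable_punctured[OF T1(1) _ this, of 1] show ?thesis
      unfolding T1(2) by auto
  qed
  have zero: "\<exists>n H. H holomorphic_on ball 0 1 \<and> pullback 0 (- 1) 1 0 g = qser 75 (\<lambda>q. H q / q ^ n)"
  proof -
    have det: "0 * 0 - (- 1) * 1 = (1 :: int)" by simp
    show ?thesis
      unfolding pull_g(1)[OF det]
      by (rule qser_removable_punctured[OF T_mero[OF pull_g(2)[OF det]] _ rem_C[OF pull_g(2)[OF det]]]) simp_all
  qed
  have other: "\<exists>H. H holomorphic_on ball 0 1 \<and> pullback a b c d g = qser 75 H"
    if abcd: "a * d - b * c = 1" "\<not> 75 dvd c" "\<not> coprime c 75" for a b c d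
  proof -
    let ?p = "(pullback a b c d f, pullback a b c d uX)"
    have "regular (snd ?p)"
      using polar_other_cusps[OF uX_polar abcd] unfolding regular_def snd_conv by metis
    then have hol: "U ?p holomorphic_on ball 0 1"
      using U pull_g(2)[OF abcd(1)] by blast
    have "removable (T ?p) q" if "q \<in> ball 0 1" for q
    proof (cases "q = 0")
      case True
      have "U ?p analytic_on {q}" by (rule holomorphic_on_imp_analytic_at[OF hol]) (use that in auto)
      then show ?thesis using True r by (intro rem_A pull_g abcd) auto
    qed (use that rem_C pull_g(2)[OF abcd(1)] in auto)
    then show ?thesis
      unfolding pull_g(1)[OF abcd(1)] using T_mero[OF pull_g(2)[OF abcd(1)]]
      by (intro qser_removable_0) auto
  qed
  have inv: "Gamma0_invariant 75 g"
    using f_inv u_inv by (auto simp: Gamma0_invariant_def g_def pullback_arith pullback_clearing)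
  obtain n1 H1 where H1: "H1 holomorphic_on ball 0 1" "g = qser 1 (\<lambda>q. H1 q / q ^ n1)"
    using inf by blast
  obtain n2 H2 where H2: "H2 holomorphic_on ball 0 1" "pullback 0 (- 1) 1 0 g = qser 75 (\<lambda>q. H2 q / q ^ n2)"
    using zero by blast
  have "polar (max n1 n2) g"
    unfolding polar_def
  proof (intro conjI inv allI impI)
    show "\<exists>F. F holomorphic_on ball 0 1 \<and> g = qser 1 (\<lambda>q. F q / q ^ max n1 n2)"
      unfolding H1(2) by (rule qser_pole_mono) (use H1 in auto)
    show "\<exists>F. F holomorphic_on ball 0 1 \<and> pullback 0 (- 1) 1 0 g = qser 75 (\<lambda>q. F q / q ^ max n1 n2)"
      unfolding H2(2) by (rule qser_pole_mono) (use H2 in auto)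
  qed (use other in blast)
  then show ?thesis using C_fin unfolding g_def by blast
qed


section \<open>The equation of the quotient curve\<close>

text \<open>By 1 + t \<le> exp t the product is bounded through a geometric sum, which is at most 2
  for |q| \<le> 1/2. Only boundedness near q = 0 is needed afterwards.\<close>

lemma phi_minus_one_bound:
  assumes "norm q \<le> 1 / 2" "norm a \<le> 1 / 4"
  shows "norm (phi a q - 1) \<le> 4 * norm a"
proof -
  have q: "norm q < 1" using assms by simp
  have bound: "norm ((\<Prod>k<N. 1 - a * q ^ k) - 1) \<le> 4 * norm a" for N
  proof -
    have "norm ((\<Prod>k<N. 1 + - (a * q ^ k)) - 1) \<le> (\<Prod>k<N. 1 + norm (- (a * q ^ k))) - 1"
      by (rule norm_prod_minus1_le_prod_minus1)
    moreover have "(\<Prod>k<N. 1 + norm (- (a * q ^ k))) \<le> 1 + 3 * norm a"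
    proof -
    have "(\<Prod>k<N. 1 + norm (- (a * q ^ k))) \<le> (\<Prod>k<N. exp (norm a * (1 / 2) ^ k))"
    proof (rule prod_mono, safe)
      fix k
      have "norm (- (a * q ^ k)) \<le> norm a * (1 / 2) ^ k"
        using assms(1) by (auto simp: norm_mult norm_power intro!: mult_left_mono power_mono)
      then show "1 + norm (- (a * q ^ k)) \<le> exp (norm a * (1 / 2) ^ k)"
        using exp_ge_add_one_self[of "norm a * (1 / 2) ^ k"] by linarith
    qed auto
    also have "\<dots> = exp (norm a * (\<Sum>k<N. (1 / 2) ^ k))"
      by (simp add: exp_sum sum_distrib_left)
    also have "\<dots> \<le> exp (norm a * 2)"
    proof -
      have "(\<Sum>k<N. (1 / 2 :: real) ^ k) \<le> 2" by (simp add: sum_gp_strict)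
      then show ?thesis by (intro iffD2[OF exp_le_cancel_iff] mult_left_mono) auto
    qed
    also have "\<dots> \<le> 1 + norm a * 2 + (norm a * 2) ^ 2"
      using assms by (intro exp_bound) auto
    also have "(norm a * 2) ^ 2 \<le> norm a"
    proof -
      have "(norm a * 2) ^ 2 = (norm a * 4) * norm a" by (simp add: power2_eq_square)
      also have "\<dots> \<le> 1 * norm a" using assms by (intro mult_right_mono) auto
      finally show ?thesis by simp
    qed
    finally show ?thesis by simp
    qed
    ultimately have "norm ((\<Prod>k<N. 1 - a * q ^ k) - 1) \<le> 3 * norm a" by simp
    with norm_ge_zero[of a] show ?thesis by linarith
  qed
  have "(\<lambda>N. norm ((\<Prod>k<N. 1 - a * q ^ k) - 1)) \<longlonglongrightarrow> norm (phi a q - 1)"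
    by (intro tendsto_intros phi_limit q)
  then show ?thesis
    by (rule LIMSEQ_le_const2) (use bound in auto)
qed

lemma phi_zero [simp]: "phi 0 q = 1"
  by (simp add: phi_def)

text \<open>The quotient of phi - 1 by q^n is bounded near 0, so its singularity is
  removable.\<close>

lemma phi_power_expansion:
  assumes "n > 0"
  shows "\<exists>g. g holomorphic_on ball 0 1 \<and> (\<forall>q\<in>ball 0 1. phi (q ^ n) q = 1 + q ^ n * g q)"
proof -
  define F where "F = (\<lambda>q. (phi (q ^ n) q - 1) / q ^ n)"
  have hol: "F holomorphic_on ball 0 1 - {0}"
    unfolding F_def by (intro holomorphic_intros open_delete) auto
  have "eventually (\<lambda>q::complex. q \<in> ball 0 (1 / 4) - {0}) (at 0)"
    by (intro eventually_at_in_open) auto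
  then have "eventually (\<lambda>q. norm (F q) \<le> 4) (at 0)"
  proof eventually_elim
    case (elim q)
    then have q: "norm q \<le> 1 / 4" "q \<noteq> 0" by auto
    have "norm (q ^ n) \<le> norm q ^ 1"
      unfolding norm_power using q assms by (intro power_decreasing) auto
    then have "norm (phi (q ^ n) q - 1) \<le> 4 * norm (q ^ n)"
      using q by (intro phi_minus_one_bound) auto
    then show ?case using q by (simp add: F_def norm_divide divide_simps)
  qed
  then have "\<exists>B. eventually (\<lambda>q. norm (F q) \<le> B) (at 0)" by blast
  then obtain g where g: "g holomorphic_on ball 0 1" "\<forall>q\<in>ball 0 1 - {0}. g q = F q"
    using holomorphic_on_extend_bounded[OF hol] by auto
  have "phi (q ^ n) q = 1 + q ^ n * g q" if "q \<in> ball 0 1" for q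
    using g(2) that by (cases "q = 0") (auto simp: F_def zero_power[OF assms])
  with g(1) show ?thesis by blast
qed

text \<open>Splitting off n factors by \<open>phi_shift\<close> leaves a tail 1 + O(q^(n+1)). This
  serves both the numerical expansions and the rationality of all coefficients.\<close>

lemma Pq_expansion:
  "\<exists>g. g holomorphic_on ball 0 1 \<and> (\<forall>q\<in>ball 0 1. Pq q = (\<Prod>k<n. 1 - q ^ Suc k) * (1 + q ^ Suc n * g q))"
proof -
  obtain g where g: "g holomorphic_on ball 0 1" "\<forall>q\<in>ball 0 1. phi (q ^ Suc n) q = 1 + q ^ Suc n * g q"
    using phi_power_expansion[of "Suc n"] by blast
  have eq: "Pq q = (\<Prod>k<n. 1 - q ^ Suc k) * phi (q ^ Suc n) q" if "norm q < 1" for q n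
  proof (induction n)
    case (Suc n)
    then show ?case
      using phi_shift[OF that, of "q ^ Suc n"] by (simp add: mult_ac)
  qed (simp add: Pq_def)
  show ?thesis
    by (intro exI[of _ g] conjI ballI g(1), subst eq[of _ n]) (use g(2) in \<open>auto simp del: power_Suc\<close>)
qed

section \<open>Congruences modulo powers of q\<close>

definition congr_q :: "nat \<Rightarrow> (complex \<Rightarrow> complex) \<Rightarrow> (complex \<Rightarrow> complex) \<Rightarrow> bool" where
  "congr_q n F G \<longleftrightarrow> F holomorphic_on ball 0 1 \<and> G holomorphic_on ball 0 1 \<and>
     (\<exists>H. H holomorphic_on ball 0 1 \<and> (\<forall>q\<in>ball 0 1. F q = G q + q ^ n * H q))"

lemma congr_qI:
  assumes "F holomorphic_on ball 0 1" "G holomorphic_on ball 0 1" "H holomorphic_on ball 0 1"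
    "\<And>q. q \<in> ball 0 1 \<Longrightarrow> F q = G q + q ^ n * H q"
  shows "congr_q n F G"
  using assms unfolding congr_q_def by blast

lemma congr_q_refl: "F holomorphic_on ball 0 1 \<Longrightarrow> congr_q n F F"
  by (rule congr_qI[where H = "\<lambda>_. 0"]) auto

lemma congr_q_trans:
  assumes "congr_q n F G" "congr_q n G K"
  shows "congr_q n F K"
proof -
  obtain H1 H2 where H: "H1 holomorphic_on ball 0 1" "\<forall>q\<in>ball 0 1. F q = G q + q ^ n * H1 q"
    "H2 holomorphic_on ball 0 1" "\<forall>q\<in>ball 0 1. G q = K q + q ^ n * H2 q"
    using assms unfolding congr_q_def by blast
  show ?thesis
    by (rule congr_qI[where H = "\<lambda>q. H1 q + H2 q"])
       (use assms H in \<open>auto simp: congr_q_def algebra_simps intro!: holomorphic_intros\<close>)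
qed

lemma congr_q_add:
  assumes "congr_q n F G" "congr_q n F' G'"
  shows "congr_q n (\<lambda>q. F q + F' q) (\<lambda>q. G q + G' q)"
proof -
  obtain H H' where H: "H holomorphic_on ball 0 1" "\<forall>q\<in>ball 0 1. F q = G q + q ^ n * H q"
    "H' holomorphic_on ball 0 1" "\<forall>q\<in>ball 0 1. F' q = G' q + q ^ n * H' q"
    using assms unfolding congr_q_def by blast
  show ?thesis
    by (rule congr_qI[where H = "\<lambda>q. H q + H' q"])
       (use assms H in \<open>auto simp: congr_q_def algebra_simps intro!: holomorphic_intros\<close>)
qed

lemma congr_q_mult:
  assumes "congr_q n F G" "congr_q n F' G'"
  shows "congr_q n (\<lambda>q. F q * F' q) (\<lambda>q. G q * G' q)"
proof -
  obtain H H' where H: "H holomorphic_on ball 0 1" "\<forall>q\<in>ball 0 1. F q = G q + q ^ n * H q"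
    "H' holomorphic_on ball 0 1" "\<forall>q\<in>ball 0 1. F' q = G' q + q ^ n * H' q"
    using assms unfolding congr_q_def by blast
  show ?thesis
    by (rule congr_qI[where H = "\<lambda>q. G q * H' q + H q * G' q + q ^ n * (H q * H' q)"])
       (use assms H in \<open>auto simp: congr_q_def algebra_simps intro!: holomorphic_intros\<close>)
qed

lemma congr_q_power: "congr_q n F G \<Longrightarrow> congr_q n (\<lambda>q. F q ^ k) (\<lambda>q. G q ^ k)"
  by (induction k) (auto intro!: congr_q_refl congr_q_mult)

lemma congr_q_diff:
  assumes "congr_q n F G" "congr_q n F' G'"
  shows "congr_q n (\<lambda>q. F q - F' q) (\<lambda>q. G q - G' q)"
  using congr_q_add[OF assms(1) congr_q_mult[OF congr_q_refl[of "\<lambda>_. - 1"] assms(2)]] by simp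

definition Aq :: "complex \<Rightarrow> complex" where "Aq q = Pq q / Pq (q ^ 25)"

lemma norm_power_less_one: "norm (q :: complex) < 1 \<Longrightarrow> n > 0 \<Longrightarrow> norm (q ^ n) < 1"
  by (simp add: norm_power power_less_one_iff)

lemma Aq_holomorphic: "Aq holomorphic_on ball 0 1"
  unfolding Aq_def by (intro holomorphic_intros Pq_nonzero) (auto intro: norm_power_less_one)

lemma Aq_nonzero: "norm q < 1 \<Longrightarrow> Aq q \<noteq> 0"
  using Pq_nonzero[of q] Pq_nonzero[of "q ^ 25"] norm_power_less_one[of q 25] by (simp add: Aq_def)

lemma Aq_cube_holomorphic: "(\<lambda>q. Aq (q ^ 3)) holomorphic_on ball 0 1"
  using power_map_holomorphic[OF Aq_holomorphic, of 1 3] by simp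

text \<open>Euler's pentagonal number theorem to the required precision.\<close>

lemma Aq_congr: "congr_q 11 Aq (\<lambda>q. 1 - q - q ^ 2 + q ^ 5 + q ^ 7)"
proof -
  obtain g where g: "g holomorphic_on ball 0 1" "\<forall>q\<in>ball 0 1. Pq q = (\<Prod>k<10. 1 - q ^ Suc k) * (1 + q ^ 11 * g q)"
    using Pq_expansion[of 10] by auto
  obtain k where k: "k holomorphic_on ball 0 1" "\<forall>q\<in>ball 0 1. Pq q = 1 + q * k q"
    using Pq_expansion[of 0] by auto
  have k': "(\<lambda>q. k (q ^ 25)) holomorphic_on ball 0 1"
    using power_map_holomorphic[OF k(1), of 1 25] by simp
  \<comment> \<open>\<open>z\<close> collects the terms of degrees 11 to 55 of the product of the
    first ten factors, divided by q^11.\<close>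
  define z :: "complex \<Rightarrow> complex" where "z = poly [:1, - 1, - 1, - 1, - 2, 0, 0, 1, 1, 1, 1, 3, 0, 0, - 1, - 1, - 2, - 2, - 1, - 1, 0, 0, 3, 1, 1, 1, 1, 0, 0, - 2, - 1, - 1, - 1, 1, 0, 0, 0, 1, 0, 1, 0, 0, - 1, - 1, 1:]"
  have "([:1, - 1:] :: complex poly) * [:1, 0, - 1:] * [:1, 0, 0, - 1:] * [:1, 0, 0, 0, - 1:] * [:1, 0, 0, 0, 0, - 1:] * [:1, 0, 0, 0, 0, 0, - 1:] * [:1, 0, 0, 0, 0, 0, 0, - 1:] * [:1, 0, 0, 0, 0, 0, 0, 0, - 1:] * [:1, 0, 0, 0, 0, 0, 0, 0, 0, - 1:] * [:1, 0, 0, 0, 0, 0, 0, 0, 0, 0, - 1:] = [:1, - 1, - 1, 0, 0, 1, 0, (1 :: complex):] + [:0, 0, 0, 0, 0, 0, 0, 0, 0, 0, 0, 1:] * [:1, - 1, - 1, - 1, - 2, 0, 0, 1, 1, 1, 1, 3, 0, 0, - 1, - 1, - 2, - 2, - 1, - 1, 0, 0, 3, 1, 1, 1, 1, 0, 0, - 2, - 1, - 1, - 1, 1, 0, 0, 0, 1, 0, 1, 0, 0, - 1, - 1, 1:]"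
    by simp
  from arg_cong[OF this, of "\<lambda>p. poly p q" for q]
  have pent': "poly [:1, - 1:] q * poly [:1, 0, - 1:] q * poly [:1, 0, 0, - 1:] q * poly [:1, 0, 0, 0, - 1:] q * poly [:1, 0, 0, 0, 0, - 1:] q * poly [:1, 0, 0, 0, 0, 0, - 1:] q * poly [:1, 0, 0, 0, 0, 0, 0, - 1:] q * poly [:1, 0, 0, 0, 0, 0, 0, 0, - 1:] q * poly [:1, 0, 0, 0, 0, 0, 0, 0, 0, - 1:] q * poly [:1, 0, 0, 0, 0, 0, 0, 0, 0, 0, - 1:] q = poly [:1, - 1, - 1, 0, 0, 1, 0, 1:] q + poly [:0, 0, 0, 0, 0, 0, 0, 0, 0, 0, 0, 1:] q * z q" for q
    unfolding z_def by (simp only: poly_mult poly_add)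
  have pent: "(\<Prod>k<10. 1 - q ^ Suc k) = 1 - q - q ^ 2 + q ^ 5 + q ^ 7 + q ^ 11 * z q" for q
  proof -
    have set: "{..<10::nat} = {0, 1, 2, 3, 4, 5, 6, 7, 8, 9}" by auto
    have "(\<Prod>k<10. 1 - q ^ Suc k) = poly [:1, - 1, - 1, 0, 0, 1, 0, 1:] q + poly [:0, 0, 0, 0, 0, 0, 0, 0, 0, 0, 0, 1:] q * z q"
      unfolding set pent'[symmetric] by (simp add: eval_nat_numeral mult.assoc)
    also have "poly [:1, - 1, - 1, 0, 0, 1, 0, 1:] q = 1 - q - q ^ 2 + q ^ 5 + q ^ 7"
      by (simp add: algebra_simps eval_nat_numeral)
    also have "poly [:0, 0, 0, 0, 0, 0, 0, 0, 0, 0, 0, 1:] q = q ^ 11"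
      by (simp add: eval_nat_numeral)
    finally show ?thesis .
  qed
  show ?thesis
  \<comment> \<open>The denominator is 1 + O(q^25) and contributes only to the remainder; 14 = 25 -
    11.\<close>
  proof (rule congr_qI[where H = "\<lambda>q. z q + (\<Prod>k<10. 1 - q ^ Suc k) * g q - q ^ 14 * k (q ^ 25) * Aq q"])
    fix q :: complex assume q: "q \<in> ball 0 1"
    then have q25: "q ^ 25 \<in> ball 0 1" using norm_power_less_one[of q 25] by simp
    have "Aq q * Pq (q ^ 25) = Pq q"
      using Pq_nonzero[of "q ^ 25"] q25 by (simp add: Aq_def)
    then have "Aq q * (1 + q ^ 25 * k (q ^ 25)) = (\<Prod>k<10. 1 - q ^ Suc k) * (1 + q ^ 11 * g q)"
      using g(2) k(2) q q25 by simp
    then have "Aq q = (\<Prod>k<10. 1 - q ^ Suc k) + q ^ 11 * ((\<Prod>k<10. 1 - q ^ Suc k) * g q) - q ^ 25 * k (q ^ 25) * Aq q"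
      by (simp add: algebra_simps)
    moreover have "q ^ 25 = q ^ 11 * q ^ 14" by (simp flip: power_add)
    ultimately show "Aq q = 1 - q - q ^ 2 + q ^ 5 + q ^ 7 +
        q ^ 11 * (z q + (\<Prod>k<10. 1 - q ^ Suc k) * g q - q ^ 14 * k (q ^ 25) * Aq q)"
      using pent[of q] by Groebner_Basis.algebra
  qed (auto simp: z_def intro!: holomorphic_intros g Aq_holomorphic k')
qed

text \<open>Under q \<mapsto> q^3 the term q^5 becomes q^15, beyond the precision.\<close>

lemma Aq_cube_congr: "congr_q 11 (\<lambda>q. Aq (q ^ 3)) (\<lambda>q. 1 - q ^ 3 - q ^ 6)"
proof -
  obtain H where H: "H holomorphic_on ball 0 1"
    "\<forall>q\<in>ball 0 1. Aq q = 1 - q - q ^ 2 + q ^ 5 + q ^ 7 + q ^ 11 * H q"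
    using Aq_congr unfolding congr_q_def by blast
  have H': "(\<lambda>q. H (q ^ 3)) holomorphic_on ball 0 1"
    using power_map_holomorphic[OF H(1), of 1 3] by simp
  show ?thesis
  proof (rule congr_qI[where H = "\<lambda>q. q ^ 4 + q ^ 10 + q ^ 22 * H (q ^ 3)"])
    fix q :: complex assume "q \<in> ball 0 1"
    then have "q ^ 3 \<in> ball 0 1" using norm_power_less_one[of q 3] by simp
    then have "Aq (q ^ 3) = 1 - q ^ 3 - q ^ 6 + q ^ 15 + q ^ 21 + q ^ 33 * H (q ^ 3)"
      using H(2) by (simp flip: power_mult)
    then show "Aq (q ^ 3) = 1 - q ^ 3 - q ^ 6 + q ^ 11 * (q ^ 4 + q ^ 10 + q ^ 22 * H (q ^ 3))"
      by (simp add: ring_distribs flip: power_add mult.assoc)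
  qed (auto intro!: holomorphic_intros Aq_cube_holomorphic H')
qed

text \<open>The equation between \<open>uX\<close> and \<open>vX\<close>, with \<open>h1 = a / q\<close>, \<open>h3 = b / q\<^sup>3\<close> and denominators cleared.\<close>

definition Psi :: "complex \<Rightarrow> complex \<Rightarrow> complex \<Rightarrow> complex" where
  "Psi q a b = a * b * (a * b + 5 * q ^ 4) ^ 2 + 3 * (a * b) * (a * q ^ 2 + b) * (a * b + 5 * q ^ 4) * q
     - (b ^ 4 - 6 * q ^ 2 * b ^ 3 * a + q ^ 4 * a ^ 2 * b ^ 2 - 6 * q ^ 6 * b * a ^ 3 + q ^ 8 * a ^ 4)"

text \<open>All coefficients below q^11 cancel. The intermediate products are expanded to
  coefficient lists one at a time, which keeps each multiplication small.\<close>

lemma Psi_truncated: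
  "Psi q (1 - q - q ^ 2 + q ^ 5 + q ^ 7) (1 - q ^ 3 - q ^ 6) = q ^ 11 * poly [:0, 3, 0, - 3, 4, 3, 0, 0, - 3, - 3, 1, - 3, - 4, - 6, - 2, - 6, 3, - 4, 5, - 7, 4, - 3, - 1, - 1, - 3, - 1, - 3, 0, - 1:] q"
proof -
  define a b :: "complex poly" where "a = [:1, - 1, - 1, 0, 0, 1, 0, 1:]" and "b = [:1, 0, 0, - 1, 0, 0, - 1:]"
  have ab: "a * b = [:1, - 1, - 1, - 1, 1, 2, - 1, 2, 0, 0, - 1, - 1, 0, - 1:]"
    by (simp add: a_def b_def)
  have t: "a * b + [:0, 0, 0, 0, 5:] = [:1, - 1, - 1, - 1, 6, 2, - 1, 2, 0, 0, - 1, - 1, 0, - 1:]"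
    by (simp add: ab)
  have t2: "(a * b + [:0, 0, 0, 0, 5:]) ^ 2 = [:1, - 2, - 1, 0, 15, - 6, - 17, - 10, 30, 22, - 14, 20, 13, - 2, - 4, - 14, 0, - 14, - 8, 2, - 3, 2, 1, 2, 2, 0, 1:]"
    by (simp add: t power2_eq_square)
  have s: "a * [:0, 0, 1:] + b = [:1, 0, 1, - 2, - 1, 0, - 1, 1, 0, 1:]"
    by (simp add: a_def b_def)
  have st: "(a * [:0, 0, 1:] + b) * (a * b + [:0, 0, 0, 0, 5:]) = [:1, - 1, 0, - 4, 6, 4, 7, - 5, - 11, 3, - 12, 0, 1, 3, 7, - 1, 5, 1, - 1, 0, - 2, 0, - 1:]"
    unfolding s t by simp
  have b2: "b ^ 2 = [:1, 0, 0, - 2, 0, 0, - 1, 0, 0, 2, 0, 0, 1:]"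
    by (simp add: b_def power2_eq_square)
  have b4: "(b ^ 2) ^ 2 = [:1, 0, 0, - 4, 0, 0, 2, 0, 0, 8, 0, 0, - 5, 0, 0, - 8, 0, 0, 2, 0, 0, 4, 0, 0, 1:]"
    by (simp add: b2 power2_eq_square[of "[:_, _:]"] power2_eq_square[of "pCons _ _"])
  have a2: "a ^ 2 = [:1, - 2, - 1, 2, 1, 2, - 2, 0, - 2, - 2, 1, 0, 2, 0, 1:]"
    by (simp add: a_def power2_eq_square)
  have a4: "(a ^ 2) ^ 2 = [:1, - 4, 2, 8, - 5, - 4, - 10, 8, 9, 0, 14, - 16, - 6, - 16, 0, 16, 2, 20, - 6, 0, - 11, - 8, 0, - 4, 6, 0, 4, 0, 1:]"
    by (simp add: a2 power2_eq_square[of "pCons _ _"])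
  have "a * b * (a * b + [:0, 0, 0, 0, 5:]) ^ 2 + [:0, 3:] * (a * b * ((a * [:0, 0, 1:] + b) * (a * b + [:0, 0, 0, 0, 5:])))
     - (b ^ 2) ^ 2 + [:0, 0, 6:] * (b ^ 2 * (a * b)) - [:0, 0, 0, 0, 1:] * (a * b * (a * b))
     + [:0, 0, 0, 0, 0, 0, 6:] * (a * b * a ^ 2) - [:0, 0, 0, 0, 0, 0, 0, 0, 1:] * (a ^ 2) ^ 2 = [:0, 0, 0, 0, 0, 0, 0, 0, 0, 0, 0, 1:] * [:0, 3, 0, - 3, 4, 3, 0, 0, - 3, - 3, 1, - 3, - 4, - 6, - 2, - 6, 3, - 4, 5, - 7, 4, - 3, - 1, - 1, - 3, - 1, - 3, 0, - 1:]"
    unfolding t2 st b4 a4 unfolding a2 b2 unfolding ab by simp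
  from arg_cong[OF this, of "\<lambda>p. poly p q"]
  have "poly a q * poly b q * (poly a q * poly b q + poly [:0, 0, 0, 0, 5:] q) ^ 2
     + poly [:0, 3:] q * (poly a q * poly b q * ((poly a q * poly [:0, 0, 1:] q + poly b q) * (poly a q * poly b q + poly [:0, 0, 0, 0, 5:] q)))
     - (poly b q ^ 2) ^ 2 + poly [:0, 0, 6:] q * (poly b q ^ 2 * (poly a q * poly b q))
     - poly [:0, 0, 0, 0, 1:] q * (poly a q * poly b q * (poly a q * poly b q))
     + poly [:0, 0, 0, 0, 0, 0, 6:] q * (poly a q * poly b q * poly a q ^ 2)
     - poly [:0, 0, 0, 0, 0, 0, 0, 0, 1:] q * (poly a q ^ 2) ^ 2
     = poly [:0, 0, 0, 0, 0, 0, 0, 0, 0, 0, 0, 1:] q * poly [:0, 3, 0, - 3, 4, 3, 0, 0, - 3, - 3, 1, - 3, - 4, - 6, - 2, - 6, 3, - 4, 5, - 7, 4, - 3, - 1, - 1, - 3, - 1, - 3, 0, - 1:] q"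
    by (simp only: poly_mult poly_add poly_diff poly_power)
  moreover have "poly [:0, 0, 0, 0, 5:] q = 5 * q ^ 4" "poly [:0, 3:] q = 3 * q" "poly [:0, 0, 1:] q = q ^ 2"
    "poly [:0, 0, 6:] q = 6 * q ^ 2" "poly [:0, 0, 0, 0, 1:] q = q ^ 4" "poly [:0, 0, 0, 0, 0, 0, 6:] q = 6 * q ^ 6"
    "poly [:0, 0, 0, 0, 0, 0, 0, 0, 1:] q = q ^ 8" "poly [:0, 0, 0, 0, 0, 0, 0, 0, 0, 0, 0, 1:] q = q ^ 11"
    by (simp_all add: eval_nat_numeral)
  moreover have "Psi q x y = x * y * (x * y + 5 * q ^ 4) ^ 2 + 3 * q * (x * y * ((x * q ^ 2 + y) * (x * y + 5 * q ^ 4)))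
     - (y ^ 2) ^ 2 + 6 * q ^ 2 * (y ^ 2 * (x * y)) - q ^ 4 * (x * y * (x * y)) + 6 * q ^ 6 * (x * y * x ^ 2) - q ^ 8 * (x ^ 2) ^ 2" for x y
    unfolding Psi_def by Groebner_Basis.algebra
  ultimately have "Psi q (poly a q) (poly b q) = q ^ 11 * poly [:0, 3, 0, - 3, 4, 3, 0, 0, - 3, - 3, 1, - 3, - 4, - 6, - 2, - 6, 3, - 4, 5, - 7, 4, - 3, - 1, - 1, - 3, - 1, - 3, 0, - 1:] q" by (simp only:)
  moreover have "poly a q = 1 - q - q ^ 2 + q ^ 5 + q ^ 7" "poly b q = 1 - q ^ 3 - q ^ 6"
    by (simp_all add: a_def b_def algebra_simps eval_nat_numeral)
  ultimately show ?thesis by simp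
qed

text \<open>The precision 11 is dictated by \<open>curve_relation\<close>, where \<open>Psi\<close>
  gets divided by q^10: one further power of q gives a zero at \<infinity>.\<close>

lemma Psi_vanishes:
  "\<exists>H. H holomorphic_on ball 0 1 \<and> (\<forall>q\<in>ball 0 1. Psi q (Aq q) (Aq (q ^ 3)) = q ^ 11 * H q)"
proof -
  have "congr_q 11 (\<lambda>q. Psi q (Aq q) (Aq (q ^ 3))) (\<lambda>q. Psi q (1 - q - q ^ 2 + q ^ 5 + q ^ 7) (1 - q ^ 3 - q ^ 6))"
    unfolding Psi_def
    by (intro congr_q_add congr_q_diff congr_q_mult congr_q_power Aq_congr Aq_cube_congr congr_q_refl holomorphic_intros)
  moreover have "congr_q 11 (\<lambda>q. Psi q (1 - q - q ^ 2 + q ^ 5 + q ^ 7) (1 - q ^ 3 - q ^ 6)) (\<lambda>_. 0)"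
    unfolding Psi_truncated
    by (rule congr_qI[where H = "poly [:0, 3, 0, - 3, 4, 3, 0, 0, - 3, - 3, 1, - 3, - 4, - 6, - 2, - 6, 3, - 4, 5, - 7, 4, - 3, - 1, - 1, - 3, - 1, - 3, 0, - 1:]"]) (auto intro!: holomorphic_intros)
  ultimately have "congr_q 11 (\<lambda>q. Psi q (Aq q) (Aq (q ^ 3))) (\<lambda>_. 0)"
    by (rule congr_q_trans)
  then show ?thesis by (auto simp: congr_q_def)
qed

lemma h1_eq_Aq: "h1 = qser 1 (\<lambda>q. Aq q / q)"
  by (simp add: h1_def hq_def[abs_def] Aq_def field_simps)

lemma h3_eq_Aq: "h3 = qser 1 (\<lambda>q. Aq (q ^ 3) / q ^ 3)"
  by (simp add: h3_def hq_def[abs_def] Aq_def field_simps)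

definition vX :: mero where "vX = sX + 5 * sY"
definition dX :: mero where "dX = sX - 5 * sY"

lemma pullback_scale:
  assumes "k \<noteq> 0" "a * d - b * c > 0"
  shows "pullback (k * a) (k * b) (k * c) (k * d) f = pullback a b c d f"
proof -
  have "k * k > 0" using assms(1) by (auto simp: zero_less_mult_iff neq_iff)
  then have "pullback a b c d (pullback k 0 0 k f) = pullback (k * a) (k * b) (k * c) (k * d) f"
    using assms by (subst pullback_pullback) auto
  then show ?thesis by (simp add: pullback_scalar assms)
qed

section \<open>The involution and its eigenfunctions\<close>

definition Fricke :: "mero \<Rightarrow> mero" where
  "Fricke f = pullback 0 (- 1) 75 0 f"

lemma Fricke_arith:
  "Fricke (f + g) = Fricke f + Fricke g" "Fricke (f - g) = Fricke f - Fricke g"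
  "Fricke (f * g) = Fricke f * Fricke g" "Fricke (f / g) = Fricke f / Fricke g"
  "Fricke (- f) = - Fricke f" "Fricke (f ^ n) = Fricke f ^ n"
  "Fricke (numeral k) = numeral k" "Fricke 1 = 1" "Fricke 0 = 0" "Fricke (const_mero c) = const_mero c"
  by (simp_all add: Fricke_def pullback_arith pullback_power pullback_numeral pullback_1 pullback_0 pullback_const)

lemma Fricke_uX: "Fricke uX = uX"
  by (simp add: uX_def Fricke_arith) (simp add: Fricke_def h1_Fricke h3_Fricke)

lemma Fricke_sX: "Fricke sX = 5 * sY"
  by (simp add: sX_def sY_def Fricke_arith) (simp add: Fricke_def h1_Fricke h3_Fricke power_divide power2_eq_square)

lemma Fricke_sY: "5 * Fricke sY = sX"
  by (simp add: sX_def sY_def Fricke_arith) (simp add: Fricke_def h1_Fricke h3_Fricke power_divide power2_eq_square)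

lemma Fricke_vX: "Fricke vX = vX"
  using Fricke_sX Fricke_sY by (simp add: vX_def Fricke_arith)

lemma Fricke_dX: "Fricke dX = - dX"
  using Fricke_sX Fricke_sY by (simp add: dX_def Fricke_arith)

lemma polar_numeral_mult: "polar n f \<Longrightarrow> polar n (numeral k * f)"
  using polar_scale[of n f "numeral k"] by (simp add: const_mero_numeral)

lemma vX_polar: "polar 5 vX"
  unfolding vX_def by (intro polar_add polar_numeral_mult sX_polar sY_polar)

lemma polar_diff: "polar n f \<Longrightarrow> polar n g \<Longrightarrow> polar n (f - g)"
  using polar_add[of n f "- g"] polar_scale[of n g "- 1"] by (simp add: const_mero_minus)

lemma dX_polar: "polar 5 dX"
  unfolding dX_def by (intro polar_diff polar_numeral_mult sX_polar sY_polar)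

lemma uX_power_polar: "polar (2 * k) (uX ^ k)"
  using polar_power[OF uX_polar, of k] by (simp add: mult.commute)

theorem curve_relation:
  "vX ^ 2 + 3 * uX * (1 + uX) * vX = uX ^ 5 - 6 * uX ^ 4 + uX ^ 3 - 6 * uX ^ 2 + uX"
proof -
  define f where "f = vX ^ 2 + 3 * uX * (1 + uX) * vX - (uX ^ 5 - 6 * uX ^ 4 + uX ^ 3 - 6 * uX ^ 2 + uX)"
  \<comment> \<open>This is f h1^5 / h3; \<open>Psi\<close> is the same form with h1 = a/q, h3 =
    b/q^3, multiplied by q^12.\<close>
  define Ph where "Ph = h1 * h3 * (h1 * h3 + 5) ^ 2 + 3 * (h1 * h3) * (h1 + h3) * (h1 * h3 + 5)
     - (h3 ^ 4 - 6 * h3 ^ 3 * h1 + h3 ^ 2 * h1 ^ 2 - 6 * h3 * h1 ^ 3 + h1 ^ 4)"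
  have f_Ph: "f = Ph * h3 / h1 ^ 5"
  proof -
    have k: "h3 = uX * h1" by (simp add: uX_def)
    have V: "vX * h1 = uX * (h1 ^ 2 * uX + 5)"
      by (simp add: vX_def sX_def sY_def uX_def field_simps power2_eq_square)
    have "f * h1 ^ 5 = (vX * h1) ^ 2 * h1 ^ 3 + 3 * uX * (1 + uX) * (vX * h1) * h1 ^ 4
        - (uX ^ 5 - 6 * uX ^ 4 + uX ^ 3 - 6 * uX ^ 2 + uX) * h1 ^ 5"
      unfolding f_def by Groebner_Basis.algebra
    also have "\<dots> = Ph * h3"
      unfolding V Ph_def k by Groebner_Basis.algebra
    finally show ?thesis by (simp add: field_simps)
  qed
  have mono: "polar 10 (uX ^ k)" if "k \<le> 5" for k
    by (rule polar_mono[OF uX_power_polar]) (use that in simp)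
  have f_polar: "polar 10 f"
  proof -
    have "polar 10 (vX ^ 2)" using polar_power[OF vX_polar, of 2] by simp
    moreover have "polar 10 (3 * uX * (1 + uX) * vX)"
    proof -
      have "polar 2 (1 + uX)" using polar_add[OF polar_mono[OF polar_const[of 1]] uX_polar] by simp
      then have "polar 9 (uX * (1 + uX) * vX)"
        using polar_mult[OF polar_mult[OF uX_polar] vX_polar] by fastforce
      then have "polar 10 (uX * (1 + uX) * vX)" by (rule polar_mono) simp
      from polar_numeral_mult[OF this] show ?thesis by (simp add: mult_ac)
    qed
    ultimately show ?thesis
      unfolding f_def using mono[of 5] mono[of 4] mono[of 3] mono[of 2] mono[of 1]
      by (intro polar_add polar_diff polar_numeral_mult) auto
  qed
  obtain H where H: "H holomorphic_on ball 0 1" "\<And>q. q \<in> ball 0 1 \<Longrightarrow> Psi q (Aq q) (Aq (q ^ 3)) = q ^ 11 * H q"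
    using Psi_vanishes by blast
  define F where "F = (\<lambda>q. q * (H q * Aq (q ^ 3) / Aq q ^ 5))"
  have F: "F holomorphic_on ball 0 1"
    unfolding F_def by (intro holomorphic_intros H Aq_holomorphic Aq_cube_holomorphic) (auto simp: Aq_nonzero)
  define ph where "ph = (\<lambda>h k :: complex. (h * k * (h * k + 5) ^ 2 + 3 * (h * k) * (h + k) * (h * k + 5)
     - (k ^ 4 - 6 * k ^ 3 * h + k ^ 2 * h ^ 2 - 6 * k * h ^ 3 + h ^ 4)) * k / h ^ 5)"
  define a b where "a = (\<lambda>q. Aq q / q)" and "b = (\<lambda>q. Aq (q ^ 3) / q ^ 3)"
  have ab: "a meromorphic_on ball 0 1" "b meromorphic_on ball 0 1"
    unfolding a_def b_def
    by (intro meromorphic_intros holomorphic_imp_meromorphic[OF Aq_holomorphic] holomorphic_imp_meromorphic[OF Aq_cube_holomorphic] open_ball)+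
  have "f = qser 1 (\<lambda>q. ph (a q) (b q))"
  proof -
    \<comment> \<open>\<open>I\<close> relates an element of \<open>mero\<close> to a function on
      the disc, so that the expression is transferred operation by operation.\<close>
    define I where "I = (\<lambda>f F. F meromorphic_on ball 0 1 \<and> f = qser 1 F)"
    have I: "I (f + g) (\<lambda>q. F q + G q)" "I (f - g) (\<lambda>q. F q - G q)" "I (f * g) (\<lambda>q. F q * G q)"
      "I (f / g) (\<lambda>q. F q / G q)" "I (f ^ k) (\<lambda>q. F q ^ k)" if "I f F" "I g G" for f g F G k
      using that by (auto simp: I_def qser_arith qser_power intro!: meromorphic_intros)
    have num: "I (numeral n) (\<lambda>_. numeral n)" for n
      by (simp add: I_def const_mero_numeral meromorphic_on_const)
    have h: "I h1 a" "I h3 b"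
      using ab by (simp_all add: I_def h1_eq_Aq h3_eq_Aq a_def b_def)
    note intros = I(1-4) I(5)[OF _ num[of num.One]] num h
    have "I f (\<lambda>q. ph (a q) (b q))"
      unfolding f_Ph Ph_def ph_def by (intro intros)
    then show ?thesis by (simp add: I_def)
  qed
  also have "\<dots> = qser 1 F"
  proof (rule qser_cong)
    fix q :: complex assume q: "q \<in> ball 0 1 - {0}"
    have nz: "Aq q \<noteq> 0" "q \<noteq> 0" using q Aq_nonzero[of q] by auto
    have "ph (x / q) (y / q ^ 3) = Psi q x y * y / (x ^ 5 * q ^ 10)" if "x \<noteq> 0" for x y
    proof -
      define h k where "h = x / q" and "k = y / q ^ 3"
      have hk: "x = h * q" "y = k * q ^ 3" "h \<noteq> 0" using nz that by (simp_all add: h_def k_def)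
      have "Psi q (h * q) (k * q ^ 3) = q ^ 12 * (h * k * (h * k + 5) ^ 2 + 3 * (h * k) * (h + k) * (h * k + 5)
              - (k ^ 4 - 6 * k ^ 3 * h + k ^ 2 * h ^ 2 - 6 * k * h ^ 3 + h ^ 4))" (is "_ = q ^ 12 * ?B")
        unfolding Psi_def by Groebner_Basis.algebra
      then have "Psi q x y * y / (x ^ 5 * q ^ 10) = (q ^ 15 * (?B * k)) / (q ^ 15 * h ^ 5)"
        unfolding hk(1,2) by (simp add: power_mult_distrib mult_ac flip: power_add)
      also have "\<dots> = ?B * k / h ^ 5" using nz by simp
      finally show ?thesis unfolding ph_def h_def[symmetric] k_def[symmetric] by (rule sym)
    qed
    then have "ph (a q) (b q) = Psi q (Aq q) (Aq (q ^ 3)) * Aq (q ^ 3) / (Aq q ^ 5 * q ^ 10)"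
      using nz by (simp add: a_def b_def)
    also have "\<dots> = F q"
    proof -
      have "q ^ 11 = q * q ^ 10" using power_add[of q 1 10] by simp
      then show ?thesis using H(2)[of q] q nz by (simp add: F_def)
    qed
    finally show "ph (a q) (b q) = F q" .
  qed (use F in \<open>auto intro: holomorphic_imp_meromorphic\<close>)
  finally have f_F: "f = qser 1 F" .
  have "Fricke f = f"
    by (simp add: f_def Fricke_arith Fricke_uX Fricke_vX)
  \<comment> \<open>Up to a scalar the inversion is the involution times (1, 0; 0, 75). Since f is
    invariant, its expansion at 0 in e(z/75) is the expansion at \<infinity> in q.\<close>
  then have "pullback 0 (- 1) 1 0 f = pullback (int 1) 0 0 (int 75) f"
  proof -
    have "pullback (int 1) 0 0 (int 75) (pullback 0 (- 1) 75 0 f) = pullback (75 * 0) (75 * (- 1)) (75 * 1) (75 * 0) f"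
      by (subst pullback_pullback) auto
    also have "\<dots> = pullback 0 (- 1) 1 0 f" by (rule pullback_scale) auto
    finally show ?thesis using \<open>Fricke f = f\<close> by (simp add: Fricke_def)
  qed
  also have "\<dots> = qser 75 F"
    unfolding f_F by (subst pullback_qser) (use F in \<open>auto intro: holomorphic_imp_meromorphic\<close>)
  finally have "pullback 0 (- 1) 1 0 f = qser 75 F" .
  then have "f = 0"
    by (intro vanish_of_no_poles[OF _ F f_F _ F])
       (use f_polar in \<open>auto simp: F_def polar_def[of 10 f] elim: polar_other_cusps[OF f_polar]\<close>)
  then show ?thesis by (simp add: f_def)
qed


section \<open>Algebraic relations and descent to the rationals\<close>

text \<open>The exact pole order at \<infinity>. It concerns only the expansion in q and presupposes
  no modularity.\<close>

definition lord :: "nat \<Rightarrow> mero \<Rightarrow> bool" where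
  "lord n f \<longleftrightarrow> (\<exists>F. F holomorphic_on ball 0 1 \<and> F 0 \<noteq> 0 \<and> f = qser 1 (\<lambda>q. F q / q ^ n))"

lemma lord_const: "c \<noteq> 0 \<Longrightarrow> lord 0 (const_mero c)"
  unfolding lord_def by (intro exI[of _ "\<lambda>_. c"]) auto

lemma lord_mult:
  assumes "lord n f" "lord m g"
  shows "lord (n + m) (f * g)"
proof -
  obtain F G where FG: "F holomorphic_on ball 0 1" "F 0 \<noteq> 0" "f = qser 1 (\<lambda>q. F q / q ^ n)"
    "G holomorphic_on ball 0 1" "G 0 \<noteq> 0" "g = qser 1 (\<lambda>q. G q / q ^ m)"
    using assms unfolding lord_def by blast
  then show ?thesis
    unfolding lord_def using qser_pole_mult[OF FG(1,4), of 1 n m]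
    by (intro exI[of _ "\<lambda>q. F q * G q"]) (auto intro!: holomorphic_intros)
qed

lemma lord_add:
  assumes "lord n f" "G holomorphic_on ball 0 1" "g = qser 1 (\<lambda>q. G q / q ^ m)" "m < n"
  shows "lord n (f + g)"
proof -
  obtain F where F: "F holomorphic_on ball 0 1" "F 0 \<noteq> 0" "f = qser 1 (\<lambda>q. F q / q ^ n)"
    using assms unfolding lord_def by blast
  have hol: "(\<lambda>q. G q * q ^ (n - m)) holomorphic_on ball 0 1" by (intro holomorphic_intros assms)
  have "g = qser 1 (\<lambda>q. G q * q ^ (n - m) / q ^ n)"
    unfolding assms(3)
    by (rule qser_cong[OF _ divide_power_meromorphic[OF hol]]) (use assms(4) in \<open>auto simp: power_diff\<close>)
  then have "f + g = qser 1 (\<lambda>q. (F q + G q * q ^ (n - m)) / q ^ n)"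
    unfolding F(3) using qser_pole_add[OF F(1) hol, of 1 n] by simp
  then show ?thesis
    unfolding lord_def using F hol assms(4)
    by (intro exI[of _ "\<lambda>q. F q + G q * q ^ (n - m)"]) (auto intro!: holomorphic_intros simp: zero_power)
qed

lemma lord_shift:
  assumes "lord n f"
  obtains F where "F holomorphic_on ball 0 1" "F 0 \<noteq> 0" "f * qser 1 (\<lambda>q. q ^ n) = qser 1 F"
proof -
  obtain F where F: "F holomorphic_on ball 0 1" "F 0 \<noteq> 0" "f = qser 1 (\<lambda>q. F q / q ^ n)"
    using assms unfolding lord_def by blast
  have "f * qser 1 (\<lambda>q. q ^ n) = qser 1 (\<lambda>q. F q / q ^ n * q ^ n)"
    unfolding F(3) by (intro qser_arith divide_power_meromorphic F meromorphic_intros) auto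
  also have "\<dots> = qser 1 F"
    by (rule qser_cong) (use F in \<open>auto intro: holomorphic_imp_meromorphic\<close>)
  finally show ?thesis using that F by blast
qed

lemma lord_nonzero: "lord n f \<Longrightarrow> f \<noteq> 0"
proof
  assume "lord n f" "f = 0"
  then obtain F where F: "F holomorphic_on ball 0 1" "F 0 \<noteq> 0" "qser 1 F = qser 1 (\<lambda>_. 0)"
    by (auto elim: lord_shift)
  have "F 0 = 0"
    by (rule qser_eq_imp_eq_holomorphic[of F "\<lambda>_. 0" 1]) (use F in auto)
  then show False using F by simp
qed

lemma lord_unique_aux:
  assumes "lord n f" "lord m f" "n < m"
  shows False
proof -
  obtain F where F: "F holomorphic_on ball 0 1" "F 0 \<noteq> 0" "f * qser 1 (\<lambda>q. q ^ n) = qser 1 F"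
    using assms(1) by (rule lord_shift)
  obtain G where G: "G holomorphic_on ball 0 1" "G 0 \<noteq> 0" "f * qser 1 (\<lambda>q. q ^ m) = qser 1 G"
    using assms(2) by (rule lord_shift)
  have mero: "(\<lambda>q. q ^ k) meromorphic_on ball 0 1" for k :: nat and q :: complex
    by (intro meromorphic_intros)
  have pow: "qser 1 (\<lambda>q. q ^ n) * qser 1 (\<lambda>q. q ^ (m - n)) = qser 1 (\<lambda>q. q ^ m)"
    using assms(3) by (subst qser_arith) (auto intro!: meromorphic_intros simp flip: power_add)
  have "qser 1 G = (f * qser 1 (\<lambda>q. q ^ n)) * qser 1 (\<lambda>q. q ^ (m - n))"
    unfolding G(3)[symmetric] pow[symmetric] by (simp add: mult_ac)
  also have "\<dots> = qser 1 (\<lambda>q. F q * q ^ (m - n))"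
    unfolding F(3) by (intro qser_arith holomorphic_imp_meromorphic F meromorphic_intros) auto
  finally have "G 0 = F 0 * 0 ^ (m - n)"
    by (intro qser_eq_imp_eq_holomorphic[of G "\<lambda>q. F q * q ^ (m - n)" 1]) (auto intro!: holomorphic_intros F G)
  then show False using G(2) assms(3) by simp
qed

lemma lord_unique: "lord n f \<Longrightarrow> lord m f \<Longrightarrow> n = m"
  using lord_unique_aux[of n f m] lord_unique_aux[of m f n] by (cases n m rule: linorder_cases) auto

lemma lord_of_qunit:
  assumes "qunit 1 (- int n) f"
  shows "lord n f"
proof -
  obtain U where U: "U holomorphic_on ball 0 1" "\<forall>q\<in>ball 0 1. U q \<noteq> 0" "f = qser 1 (\<lambda>q. q powi (- int n) * U q)"
    using assms unfolding qunit_def by blast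
  have "(\<lambda>q. q powi (- int n) * U q) = (\<lambda>q. U q / q ^ n)"
    by (simp add: power_int_minus fun_eq_iff field_simps)
  with U show ?thesis unfolding lord_def by (intro exI[of _ U]) auto
qed

lemma h1_qunit: "qunit 1 (- 1) h1"
  using hq_qunit by (simp add: h1_def)

lemma h3_qunit: "qunit 1 (- 3) h3"
  using qunit_pullback[OF h1_qunit, of 3 1 0] by (simp add: h3_eq)

lemma uX_lord: "lord 2 uX"
  using qunit_divide[OF h3_qunit h1_qunit] by (intro lord_of_qunit) (simp add: uX_def)

lemma sX_lord: "lord 5 sX"
  using qunit_divide[OF qunit_power[OF h3_qunit, of 2] h1_qunit] by (intro lord_of_qunit) (simp add: sX_def)

lemma sY_lord: "lord 1 sY"
  using qunit_divide[OF h3_qunit qunit_power[OF h1_qunit, of 2]] by (intro lord_of_qunit) (simp add: sY_def)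

lemma lord_add_lord: "lord n f \<Longrightarrow> lord m g \<Longrightarrow> m < n \<Longrightarrow> lord n (f + g)"
  using lord_add unfolding lord_def[of m g] by blast

text \<open>At \<infinity> \<open>sX\<close> has a pole of order 5 and \<open>sY\<close> only one of
  order 1, so their sum and difference keep the order 5.\<close>

lemma vX_lord: "lord 5 vX"
  using lord_add_lord[OF sX_lord lord_mult[OF lord_const[of 5] sY_lord]]
  by (simp add: vX_def const_mero_numeral)

lemma dX_lord: "lord 5 dX"
  using lord_add_lord[OF sX_lord lord_mult[OF lord_const[of "- 5"] sY_lord]]
  by (simp add: dX_def const_mero_numeral const_mero_minus)

text \<open>The ring \<complex>[X], realised inside the polynomials over \<open>mero\<close> so that
  \<open>poly\<close> can evaluate at modular functions.\<close>

definition cpoly :: "mero poly set" where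
  "cpoly = {p. \<forall>i. Polynomial.coeff p i \<in> range const_mero}"

lemma const_range_sum: "(\<And>i. i \<in> A \<Longrightarrow> f i \<in> range const_mero) \<Longrightarrow> sum f A \<in> range const_mero"
proof (induction A rule: infinite_finite_induct)
  case (insert i A)
  then have "f i \<in> range const_mero" "sum f A \<in> range const_mero" by simp_all
  then obtain a b where "f i = const_mero a" "sum f A = const_mero b" by blast
  then have "sum f (insert i A) = const_mero (a + b)" using insert by (simp add: const_mero_add)
  then show ?case by simp
qed (auto intro: range_eqI[of _ _ 0])

lemma cpoly_mult: "p \<in> cpoly \<Longrightarrow> r \<in> cpoly \<Longrightarrow> p * r \<in> cpoly"
  unfolding cpoly_def mem_Collect_eq coeff_mult
proof (intro allI const_range_sum)
  fix n i assume "\<forall>i. Polynomial.coeff p i \<in> range const_mero" "\<forall>i. Polynomial.coeff r i \<in> range const_mero"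
  then obtain a b where "Polynomial.coeff p i = const_mero a" "Polynomial.coeff r (n - i) = const_mero b" by (meson rangeE)
  then have "Polynomial.coeff p i * Polynomial.coeff r (n - i) = const_mero (a * b)" by (simp add: const_mero_mult)
  then show "Polynomial.coeff p i * Polynomial.coeff r (n - i) \<in> range const_mero" by simp
qed

lemma cpoly_1: "1 \<in> cpoly"
  by (auto simp: cpoly_def intro: range_eqI[of _ _ 0] range_eqI[of _ _ 1] simp: coeff_1)

lemma cpoly_power: "p \<in> cpoly \<Longrightarrow> p ^ k \<in> cpoly"
  by (induction k) (auto intro: cpoly_1 cpoly_mult)

lemma cpoly_prod: "(\<And>i. i \<in> A \<Longrightarrow> f i \<in> cpoly) \<Longrightarrow> prod f A \<in> cpoly"
  by (induction A rule: infinite_finite_induct) (auto intro: cpoly_1 cpoly_mult)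

lemma cpoly_monom_sum: "(\<Sum>i\<le>n. Polynomial.monom (const_mero (c i)) i) \<in> cpoly"
  unfolding cpoly_def mem_Collect_eq coeff_sum
  by (intro allI const_range_sum) (auto simp: intro: range_eqI[of _ _ 0])

text \<open>The powers of x have distinct pole orders, so the leading term dominates.\<close>

lemma lord_poly:
  assumes "p \<in> cpoly" "p \<noteq> 0" and x: "lord 2 x"
  shows "lord (2 * Polynomial.degree p) (poly p x)"
  using assms(1,2)
proof (induction p)
  case (pCons a p)
  have "a \<in> range const_mero" using pCons.prems(1) by (auto simp: cpoly_def dest: spec[of _ 0])
  then obtain c where c: "a = const_mero c" by blast
  have p: "p \<in> cpoly"
    using pCons.prems(1) unfolding cpoly_def mem_Collect_eq by (metis coeff_pCons_Suc)
  show ?case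
  proof (cases "p = 0")
    case True
    then have "c \<noteq> 0" using pCons.prems c by auto
    then show ?thesis using True c lord_const by simp
  next
    case False
    have "lord (2 + 2 * Polynomial.degree p) (x * poly p x)"
      using pCons.IH p False by (intro lord_mult x) auto
    then have "lord (2 + 2 * Polynomial.degree p) (x * poly p x + const_mero c)"
      by (rule lord_add[where G = "\<lambda>_. c" and m = 0]) auto
    then show ?thesis using False c by (simp add: add.commute)
  qed
qed simp

text \<open>Parity: the first summand has even pole order at \<infinity> and the second odd, so they
  cannot cancel.\<close>

lemma cpoly_independent_2:
  assumes "P \<in> cpoly" "Q \<in> cpoly" and x: "lord 2 x" and eq: "poly P x + poly Q x * vX = 0"
  shows "P = 0" "Q = 0"
proof -
  show Q: "Q = 0"
  proof (rule ccontr)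
    assume Q: "Q \<noteq> 0"
    have l: "lord (2 * Polynomial.degree Q + 5) (poly Q x * vX)"
      by (intro lord_mult lord_poly vX_lord assms(1,2) x Q)
    have P: "P \<noteq> 0" using eq lord_nonzero[OF l] by auto
    have "poly P x = const_mero (- 1) * (poly Q x * vX)"
      using eq by (simp add: const_mero_minus eq_neg_iff_add_eq_0)
    moreover have "lord (0 + (2 * Polynomial.degree Q + 5)) (const_mero (- 1) * (poly Q x * vX))"
      by (intro lord_mult[OF lord_const l]) simp
    ultimately have "2 * Polynomial.degree P = 2 * Polynomial.degree Q + 5"
      using lord_unique[OF lord_poly[OF assms(1) P x]] by simp
    then show False by presburger
  qed
  show "P = 0"
  proof (rule ccontr)
    assume "P \<noteq> 0"
    from lord_nonzero[OF lord_poly[OF assms(1) this x]] eq Q show False by simp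
  qed
qed

lemma Fricke_sum: "Fricke (sum f A) = (\<Sum>x\<in>A. Fricke (f x))"
  by (simp add: Fricke_def pullback_sum)

lemma Fricke_cpoly:
  assumes "p \<in> cpoly" "Fricke x = x"
  shows "Fricke (poly p x) = poly p x"
proof -
  have "Fricke (Polynomial.coeff p i) = Polynomial.coeff p i" for i
  proof -
    have "Polynomial.coeff p i \<in> range const_mero" using assms(1) by (simp add: cpoly_def)
    then show ?thesis by (auto simp: Fricke_arith)
  qed
  then show ?thesis
    unfolding poly_altdef by (simp add: Fricke_sum Fricke_arith assms(2))
qed

text \<open>Adding the relation to its image under the involution separates the part without
  \<open>dX\<close> from the part with it.\<close>

lemma cpoly_independent_4:
  assumes "P1 \<in> cpoly" "P2 \<in> cpoly" "P3 \<in> cpoly" "P4 \<in> cpoly"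
    and x: "lord 2 x" "Fricke x = x"
    and eq: "poly P1 x + poly P2 x * vX + poly P3 x * dX + poly P4 x * vX * dX = 0"
  shows "P1 = 0" "P2 = 0" "P3 = 0" "P4 = 0"
proof -
  define A B where "A = poly P1 x + poly P2 x * vX" and "B = poly P3 x + poly P4 x * vX"
  have 1: "A + B * dX = 0" using eq by (simp add: A_def B_def algebra_simps)
  have "Fricke (A + B * dX) = A - B * dX"
    by (simp add: A_def B_def Fricke_arith Fricke_vX Fricke_dX Fricke_cpoly assms(1-4) x)
  then have 2: "A - B * dX = 0" using 1 by (simp add: Fricke_arith)
  have "2 * A = 0" using 1 2 by (simp add: algebra_simps)
  then have A: "A = 0" by simp
  then have B: "B = 0" using 1 lord_nonzero[OF dX_lord] by simp
  show "P1 = 0" "P2 = 0" using cpoly_independent_2[OF assms(1,2) x(1)] A by (auto simp: A_def)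
  show "P3 = 0" "P4 = 0" using cpoly_independent_2[OF assms(3,4) x(1)] B by (auto simp: B_def)
qed

text \<open>The numbering starts at 1, because index 0 is reserved for the function to be
  expressed.\<close>

definition gens :: "nat \<Rightarrow> mero" where
  "gens j = (if j = 1 then 1 else if j = 2 then vX else if j = 3 then dX else vX * dX)"

lemma gens_polar: "polar 10 (gens j)"
  using polar_mono[OF polar_const[of 1], of 10] polar_mono[OF vX_polar, of 10] polar_mono[OF dX_polar, of 10]
    polar_mult[OF vX_polar dX_polar]
  by (simp add: gens_def)

lemma algebraic_relation:
  assumes f: "f \<in> modular_functions 75" and L: "has_q_expansion 1 f L"
  shows "\<exists>P. (\<forall>j<5. P j \<in> cpoly) \<and> (\<exists>j<5. P j \<noteq> 0) \<and>
     (\<Sum>j<5. poly (P j) uX * (if j = 0 then f else gens j)) = 0"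
proof -
  obtain C k n where C: "finite C" "polar n (clearing C k uX * f)"
    using clear_poles[OF f L] by blast
  define W where "W = (\<Prod>c\<in>C. [:- const_mero c, 1:] ^ k)"
  have W: "W \<in> cpoly"
    unfolding W_def
  proof (intro cpoly_prod cpoly_power)
    fix c show "[:- const_mero c, 1:] \<in> cpoly"
      by (auto simp: cpoly_def coeff_pCons split: nat.split simp flip: const_mero_minus)
         (metis const_mero_0 const_mero_1 rangeI)+
  qed
  have W0: "W \<noteq> 0" unfolding W_def using C(1) by simp
  have Wu: "poly W uX = clearing C k uX"
    by (simp add: W_def clearing_def poly_prod)
  define e where "e = (\<lambda>j::nat. if j = 0 then clearing C k uX * f else gens j)"
  define m where "m = max n 10"
  have e: "polar m (e j)" for j
    using polar_mono[OF C(2), of m] polar_mono[OF gens_polar, of m] by (simp add: e_def m_def)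
  define J where "J = {..<5::nat} \<times> {..2*m}"
  define g where "g = (\<lambda>(j, i). uX ^ i * e j)"
  have "\<exists>c. (\<exists>x\<in>J. c x \<noteq> 0) \<and> (\<Sum>x\<in>J. const_mero (c x) * g x) = 0"
  proof (rule polar_dependent)
    \<comment> \<open>The cardinality is 5 (2 m + 1) = 10 m + 5, against the bound 10 m + 2.\<close>
    show "finite J" "2 * (5 * m) + 2 \<le> card J" by (simp_all add: J_def)
    show "polar (5 * m) (g x)" if xJ: "x \<in> J" for x
    proof -
      obtain j i where x: "x = (j, i)" "i \<le> 2 * m" using xJ by (auto simp: J_def)
      have "polar (2 * i + m) (uX ^ i * e j)" by (intro polar_mult uX_power_polar e)
      then show ?thesis using x by (simp add: g_def polar_mono)
    qed
  qed
  then obtain c where c: "\<exists>x\<in>J. c x \<noteq> 0" "(\<Sum>x\<in>J. const_mero (c x) * g x) = 0" by blast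
  define P where "P = (\<lambda>j. \<Sum>i\<le>2*m. Polynomial.monom (const_mero (c (j, i))) i)"
  have P_cpoly: "P j \<in> cpoly" for j unfolding P_def by (rule cpoly_monom_sum)
  have P_poly: "poly (P j) uX = (\<Sum>i\<le>2*m. const_mero (c (j, i)) * uX ^ i)" for j
    by (simp add: P_def poly_sum poly_monom)
  have P_coeff: "Polynomial.coeff (P j) i = const_mero (c (j, i))" if "i \<le> 2 * m" for i j
    using that by (simp add: P_def coeff_sum)
  have P_nz: "\<exists>j<5. P j \<noteq> 0"
  proof -
    obtain j i where ji: "j < 5" "i \<le> 2 * m" "c (j, i) \<noteq> 0" using c(1) by (auto simp: J_def)
    then have "Polynomial.coeff (P j) i \<noteq> 0" using const_mero_eq_iff[of "c (j, i)" 0] by (simp add: P_coeff)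
    with ji show ?thesis by auto
  qed
  have "(\<Sum>x\<in>J. const_mero (c x) * g x) = (\<Sum>j<5. poly (P j) uX * e j)"
    unfolding J_def P_poly sum_distrib_right sum.cartesian_product g_def
    by (intro sum.cong) (auto simp: mult.assoc)
  then have rel: "(\<Sum>j<5. poly (P j) uX * e j) = 0" using c(2) by simp
  \<comment> \<open>The factor that cleared the poles is a polynomial in \<open>uX\<close> and is
    absorbed into the coefficient of f.\<close>
  define P' where "P' = (\<lambda>j. if j = 0 then P 0 * W else P j)"
  have "(\<Sum>j<5. poly (P' j) uX * (if j = 0 then f else gens j)) = (\<Sum>j<5. poly (P j) uX * e j)"
    by (intro sum.cong) (auto simp: P'_def e_def Wu mult.assoc)
  moreover have "P' j \<in> cpoly" for j using P_cpoly W by (simp add: P'_def cpoly_mult)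
  moreover have "\<exists>j<5. P' j \<noteq> 0"
  proof -
    obtain j where "j < 5" "P j \<noteq> 0" using P_nz by blast
    then show ?thesis using W0 by (intro exI[of _ j]) (auto simp: P'_def)
  qed
  ultimately show ?thesis using rel by (intro exI[of _ P']) auto
qed

section \<open>Descent to rational coefficients\<close>

lemma rational_functional:
  assumes "a \<noteq> (0 :: complex)"
  shows "\<exists>\<phi> :: complex \<Rightarrow> rat. (\<forall>x y. \<phi> (x + y) = \<phi> x + \<phi> y) \<and> (\<forall>r x. \<phi> (of_rat r * x) = r * \<phi> x) \<and> \<phi> a \<noteq> 0"
proof -
  interpret V: vector_space "\<lambda>r::rat. \<lambda>x::complex. of_rat r * x"
    by unfold_locales (simp_all add: algebra_simps of_rat_add of_rat_mult)
  have ind: "V.independent {a}"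
    using assms V.independent_insert[of a "{}"] by simp
  \<comment> \<open>\<open>a\<close> is completed to a basis of \<complex> over \<rat>; the
    functional is the coordinate belonging to \<open>a\<close>.\<close>
  define B where "B = V.extend_basis {a}"
  have B: "V.independent B" "V.span B = UNIV" "a \<in> B"
    using V.extend_basis_superset[OF ind] V.independent_extend_basis[OF ind] V.span_extend_basis[OF ind]
    by (auto simp: B_def)
  show ?thesis
  proof (intro exI[of _ "\<lambda>x. V.representation B x a"] conjI allI)
    show "V.representation B (x + y) a = V.representation B x a + V.representation B y a" for x y
      using V.representation_add[OF B(1)] B(2) by simp
    show "V.representation B (of_rat r * x) a = r * V.representation B x a" for r x
      using V.representation_scale[OF B(1)] B(2) by simp
    show "V.representation B a a \<noteq> 0"
      using V.representation_basis[OF B(1,3)] by simp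
  qed
qed

definition ratq :: "mero \<Rightarrow> bool" where
  "ratq f \<longleftrightarrow> (\<exists>L. has_q_expansion 1 f L \<and> (\<forall>n. fls_nth L n \<in> \<rat>))"

lemma laurent_0_imp_eventually:
  assumes "F has_laurent_expansion 0"
  shows "eventually (\<lambda>q. F q = 0) (at 0)"
  using assms by (auto simp: has_laurent_expansion_def elim: eventually_mono)

text \<open>By the identity theorem a meromorphic function on the disc that vanishes near 0 vanishes
  everywhere, so the Laurent coefficients determine it.\<close>

lemma qser_eq_0_iff_laurent:
  assumes F: "F meromorphic_on ball 0 1" "F has_laurent_expansion L"
  shows "qser 1 F = 0 \<longleftrightarrow> L = 0"
proof
  assume "qser 1 F = 0"
  then have "qser 1 F = qser 1 (\<lambda>_. 0)" by simp
  then have "\<forall>\<^sub>\<approx>q\<in>ball 0 1. F q = 0"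
    by (rule qser_eq_imp_cosparse[rotated 3]) (use F in auto)
  then have ev: "eventually (\<lambda>q. F q = 0) (at 0)"
    by (simp add: eventually_cosparse_open_eq)
  have "F has_laurent_expansion 0"
    by (subst has_laurent_expansion_cong[OF ev refl]) auto
  with F(2) show "L = 0" by (rule has_laurent_expansion_unique)
next
  assume "L = 0"
  then have ev: "eventually (\<lambda>q. F q = 0) (at 0)" using F laurent_0_imp_eventually by simp
  have "\<forall>\<^sub>\<approx>q\<in>ball 0 1. F q = 0"
  proof (rule ccontr)
    assume "\<not> ?thesis"
    then have "\<forall>\<^sub>\<approx>q\<in>ball 0 1. F q \<noteq> 0"
      using meromorphic_imp_constant_or_avoid[OF F(1), of 0] by auto
    then have "eventually (\<lambda>q. F q \<noteq> 0) (at 0)"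
      by (simp add: eventually_cosparse_open_eq)
    with ev have "eventually (\<lambda>q::complex. False) (at 0)" by eventually_elim simp
    then show False by simp
  qed
  moreover have "open (ball 0 1 - {0 :: complex})" by auto
  ultimately have "\<forall>\<^sub>\<approx>q\<in>ball 0 1 - {0}. F q = 0" by (auto simp: eventually_cosparse_open_eq)
  then have "qser 1 F = qser 1 (\<lambda>_. 0)" by (intro qser_cong_cosparse F) auto
  then show "qser 1 F = 0" by simp
qed

text \<open>A linear relation with complex coefficients between functions with rational \<open>q\<close>-expansions
  becomes a rational one after applying a \<open>\<rat>\<close>-linear functional to the coefficients.\<close>

lemma rational_descent:
  fixes g :: "'a \<Rightarrow> mero"
  assumes I: "finite I" and g: "\<And>i. i \<in> I \<Longrightarrow> ratq (g i)"
    and rel: "(\<Sum>i\<in>I. const_mero (a i) * g i) = 0" and i0: "i0 \<in> I" "a i0 \<noteq> 0"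
  shows "\<exists>b :: 'a \<Rightarrow> rat. b i0 \<noteq> 0 \<and> (\<forall>i. a i = 0 \<longrightarrow> b i = 0) \<and> (\<Sum>i\<in>I. of_rat (b i) * g i) = 0"
proof -
  have "\<forall>i\<in>I. \<exists>F L l. F meromorphic_on ball 0 1 \<and> F has_laurent_expansion L \<and> g i = qser 1 F \<and> (\<forall>n. fls_nth L n = of_rat (l n))"
  proof
    fix i assume "i \<in> I"
    then obtain L where L: "has_q_expansion 1 (g i) L" "\<forall>n. fls_nth L n \<in> \<rat>"
      using g unfolding ratq_def by blast
    then obtain F where F: "F meromorphic_on ball 0 1" "F has_laurent_expansion L" "g i = qser 1 F"
      by (auto simp: has_q_expansion_iff)
    from L(2) have "\<forall>n. \<exists>r. fls_nth L n = of_rat r" by (auto simp: Rats_def)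
    then obtain l where "\<forall>n. fls_nth L n = of_rat (l n)" by metis
    with F show "\<exists>F L l. F meromorphic_on ball 0 1 \<and> F has_laurent_expansion L \<and> g i = qser 1 F \<and> (\<forall>n. fls_nth L n = of_rat (l n))"
      by blast
  qed
  then obtain F L l where FL: "\<And>i. i \<in> I \<Longrightarrow> F i meromorphic_on ball 0 1" "\<And>i. i \<in> I \<Longrightarrow> F i has_laurent_expansion L i"
    "\<And>i. i \<in> I \<Longrightarrow> g i = qser 1 (F i)" "\<And>i n. i \<in> I \<Longrightarrow> fls_nth (L i) n = of_rat (l i n)"
    by metis
  \<comment> \<open>The relation amounts to one linear equation for each exponent n, with rational
    numbers \<open>l i n\<close> as its coefficients.\<close>
  have key: "(\<Sum>i\<in>I. const_mero (k i) * g i) = 0 \<longleftrightarrow> (\<forall>n. (\<Sum>i\<in>I. k i * of_rat (l i n)) = 0)" for k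
  proof -
    have cm: "const_mero (k i) * g i = qser 1 (\<lambda>q. k i * F i q)" if "i \<in> I" for i
      using qser_arith(3)[OF meromorphic_on_const[of "k i"] FL(1)[OF that], of 1] FL(3)[OF that] by simp
    have mero: "(\<lambda>q. k i * F i q) meromorphic_on ball 0 1" if "i \<in> I" for i
      using FL(1)[OF that] by (intro meromorphic_intros)
    have "(\<Sum>i\<in>I. const_mero (k i) * g i) = qser 1 (\<lambda>q. \<Sum>i\<in>I. k i * F i q)"
      using cm mero by (simp add: qser_sum)
    moreover have "(\<lambda>q. \<Sum>i\<in>I. k i * F i q) has_laurent_expansion (\<Sum>i\<in>I. fls_const (k i) * L i)"
      by (intro laurent_expansion_intros FL)
    moreover have "(\<lambda>q. \<Sum>i\<in>I. k i * F i q) meromorphic_on ball 0 1"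
      by (intro meromorphic_on_sum mero)
    ultimately have "(\<Sum>i\<in>I. const_mero (k i) * g i) = 0 \<longleftrightarrow> (\<Sum>i\<in>I. fls_const (k i) * L i) = 0"
      using qser_eq_0_iff_laurent by metis
    also have "\<dots> \<longleftrightarrow> (\<forall>n. (\<Sum>i\<in>I. k i * of_rat (l i n)) = 0)"
      unfolding fls_eq_iff using FL(4) by (simp add: fls_nth_sum)
    finally show ?thesis .
  qed
  obtain \<phi> :: "complex \<Rightarrow> rat" where \<phi>: "\<And>x y. \<phi> (x + y) = \<phi> x + \<phi> y" "\<And>r x. \<phi> (of_rat r * x) = r * \<phi> x" "\<phi> (a i0) \<noteq> 0"
    using rational_functional[OF i0(2)] by blast
  have \<phi>0: "\<phi> 0 = 0" using \<phi>(1)[of 0 0] by simp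
  have \<phi>_sum: "\<phi> (sum h A) = (\<Sum>i\<in>A. \<phi> (h i))" for h and A :: "'a set"
    by (induction A rule: infinite_finite_induct) (simp_all add: \<phi>0 \<phi>(1))
  have "(\<Sum>i\<in>I. of_rat (\<phi> (a i)) * (of_rat (l i n) :: complex)) = 0" for n
  proof -
    have "(\<Sum>i\<in>I. a i * of_rat (l i n)) = 0" using key[of a] rel by blast
    then have "0 = \<phi> (\<Sum>i\<in>I. of_rat (l i n) * a i)" by (simp add: mult.commute \<phi>0)
    also have "\<dots> = (\<Sum>i\<in>I. l i n * \<phi> (a i))" by (simp add: \<phi>_sum \<phi>(2))
    finally have "of_rat (\<Sum>i\<in>I. \<phi> (a i) * l i n) = (0 :: complex)" by (simp add: mult.commute)
    then show ?thesis by (simp add: of_rat_sum of_rat_mult)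
  qed
  then have "(\<Sum>i\<in>I. const_mero (of_rat (\<phi> (a i))) * g i) = 0" using key[of "\<lambda>i. of_rat (\<phi> (a i))"] by blast
  then show ?thesis
    using \<phi>(3) \<phi>0 by (intro exI[of _ "\<lambda>i. \<phi> (a i)"]) (simp add: const_mero_of_rat)
qed


section \<open>Rational Fourier expansions\<close>

definition rat_fps :: "complex fps \<Rightarrow> bool" where
  "rat_fps A \<longleftrightarrow> (\<forall>n. fps_nth A n \<in> \<rat>)"

definition rat_fls :: "complex fls \<Rightarrow> bool" where
  "rat_fls L \<longleftrightarrow> (\<forall>n. fls_nth L n \<in> \<rat>)"

lemma rat_fps_arith:
  assumes "rat_fps A" "rat_fps B"
  shows "rat_fps (A - B)" "rat_fps (A * B)"
  using assms by (auto simp: rat_fps_def fps_mult_nth)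

lemma rat_fps_basic [simp]: "rat_fps 1" "rat_fps (fps_X ^ k)"
  by (auto simp: rat_fps_def fps_X_power_nth)

lemma rat_fps_prod: "(\<And>i. i \<in> I \<Longrightarrow> rat_fps (f i)) \<Longrightarrow> rat_fps (prod f I)"
  by (induction I rule: infinite_finite_induct) (auto intro: rat_fps_arith)

text \<open>The recursion for the coefficients of the inverse involves only field
  operations.\<close>

lemma rat_fps_inverse:
  assumes "rat_fps A"
  shows "rat_fps (inverse A)"
proof -
  have "natfun_inverse A n \<in> \<rat>" for n
  proof (induction n rule: less_induct)
    case (less n)
    show ?case
    proof (cases n)
      case 0
      then show ?thesis using assms by (auto simp: rat_fps_def)
    next
      case (Suc m)
      have "natfun_inverse A (n - i) \<in> \<rat>" if "i \<in> {1..n}" for i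
        using less[of "n - i"] that by auto
      then have "- inverse (fps_nth A 0) * (\<Sum>i\<in>{1..n}. fps_nth A i * natfun_inverse A (n - i)) \<in> \<rat>"
        using assms by (intro Rats_mult Rats_sum) (auto simp: rat_fps_def simp del: One_nat_def)
      then show ?thesis using Suc by simp
    qed
  qed
  then show ?thesis by (simp add: rat_fps_def fps_inverse_def)
qed

lemma rat_fls_of_fps: "rat_fps A \<Longrightarrow> rat_fls (fps_to_fls A)"
  by (simp add: rat_fps_def rat_fls_def)

lemma rat_fls_arith:
  assumes "rat_fls L" "rat_fls M"
  shows "rat_fls (L - M)" "rat_fls (L * M)"
  using assms by (auto simp: rat_fls_def fls_times_nth(2))

lemma rat_fls_inverse:
  assumes "rat_fls L"
  shows "rat_fls (inverse L)"
proof -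
  have "rat_fps (fls_base_factor_to_fps L)"
    using assms by (simp add: rat_fps_def rat_fls_def fls_base_factor_to_fps_nth)
  then have "rat_fls (fps_to_fls (inverse (fls_base_factor_to_fps L)))"
    by (intro rat_fls_of_fps rat_fps_inverse)
  then show ?thesis by (simp add: fls_inverse_def rat_fls_def)
qed

lemma ratq_iff:
  "ratq f \<longleftrightarrow> (\<exists>F L. F meromorphic_on ball 0 1 \<and> F has_laurent_expansion L \<and> rat_fls L \<and> f = qser 1 F)"
  unfolding ratq_def rat_fls_def by (auto simp: has_q_expansion_iff)

lemma ratq_arith:
  assumes "ratq f" "ratq g"
  shows "ratq (f - g)" "ratq (f * g)" "ratq (inverse f)"
proof -
  obtain F L where F: "F meromorphic_on ball 0 1" "F has_laurent_expansion L" "rat_fls L" "f = qser 1 F"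
    using assms(1) unfolding ratq_iff by blast
  obtain G M where G: "G meromorphic_on ball 0 1" "G has_laurent_expansion M" "rat_fls M" "g = qser 1 G"
    using assms(2) unfolding ratq_iff by blast
  show "ratq (f - g)"
    unfolding ratq_iff using F G
    by (intro exI[of _ "\<lambda>q. F q - G q"] exI[of _ "L - M"])
       (auto intro!: meromorphic_intros laurent_expansion_intros rat_fls_arith simp: qser_arith)
  show "ratq (f * g)"
    unfolding ratq_iff using F G
    by (intro exI[of _ "\<lambda>q. F q * G q"] exI[of _ "L * M"])
       (auto intro!: meromorphic_intros laurent_expansion_intros rat_fls_arith simp: qser_arith)
  show "ratq (inverse f)"
    unfolding ratq_iff using F
    by (intro exI[of _ "\<lambda>q. inverse (F q)"] exI[of _ "inverse L"])
       (auto intro!: meromorphic_intros laurent_expansion_intros rat_fls_inverse simp: qser_arith_unary)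
qed

lemma ratq_1: "ratq 1"
proof -
  have "rat_fls 1" by (auto simp: rat_fls_def fls_one_nth)
  then show ?thesis
    unfolding ratq_iff by (intro exI[of _ "\<lambda>_. 1"] exI[of _ 1]) auto
qed

text \<open>The n-th coefficient equals that of a product of n explicit factors, since the tail
  starts only at exponent k (n + 1).\<close>

lemma Pq_power_expansion:
  assumes "k > 0"
  shows "\<exists>A. rat_fps A \<and> (\<lambda>q. Pq (q ^ k)) has_fps_expansion A"
proof -
  have n: "q ^ k \<in> ball 0 1" if "q \<in> ball 0 1" for q :: complex
    using that norm_power_less_one[of q k] assms by simp
  have hol: "(\<lambda>q. Pq (q ^ k)) holomorphic_on ball 0 1"
    by (intro holomorphic_intros) (use n in auto)
  define A where "A = fps_expansion (\<lambda>q. Pq (q ^ k)) 0"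
  have A: "(\<lambda>q. Pq (q ^ k)) has_fps_expansion A"
    unfolding A_def by (rule has_fps_expansion_fps_expansion[OF _ _ hol]) auto
  have "fps_nth A n \<in> \<rat>" for n
  proof -
    obtain g where g: "g holomorphic_on ball 0 1"
      "\<forall>q\<in>ball 0 1. Pq q = (\<Prod>i<n. 1 - q ^ Suc i) * (1 + q ^ Suc n * g q)"
      using Pq_expansion by blast
    define G where "G = fps_expansion (\<lambda>q. g (q ^ k)) 0"
    have "(\<lambda>q. g (q ^ k)) holomorphic_on ball 0 1"
      by (rule holomorphic_on_compose_gen[OF _ g(1), unfolded o_def]) (use n in \<open>auto intro!: holomorphic_intros\<close>)
    then have G: "(\<lambda>q. g (q ^ k)) has_fps_expansion G"
      unfolding G_def by (intro has_fps_expansion_fps_expansion[of "ball 0 1"]) auto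
    define P where "P = (\<Prod>i<n. 1 - (fps_X ^ k) ^ Suc i :: complex fps)"
    have P: "rat_fps P"
      unfolding P_def by (intro rat_fps_prod rat_fps_arith) (auto simp flip: power_mult power_Suc)
    have "(\<lambda>q. (\<Prod>i<n. 1 - (q ^ k) ^ Suc i) * (1 + (q ^ k) ^ Suc n * g (q ^ k)))
            has_fps_expansion P * (1 + (fps_X ^ k) ^ Suc n * G)"
      (is ?exp) unfolding P_def by (intro fps_expansion_intros G)
    have "eventually (\<lambda>q::complex. q \<in> ball 0 1) (nhds 0)"
      by (intro eventually_nhds_in_open) auto
    then have ev: "eventually (\<lambda>q. Pq (q ^ k) = (\<Prod>i<n. 1 - (q ^ k) ^ Suc i) * (1 + (q ^ k) ^ Suc n * g (q ^ k))) (nhds 0)"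
      by eventually_elim (use g(2) n in blast)
    with \<open>?exp\<close> have "(\<lambda>q. Pq (q ^ k)) has_fps_expansion P * (1 + (fps_X ^ k) ^ Suc n * G)"
      by (simp only: has_fps_expansion_cong[OF ev refl])
    with A have "A = P * (1 + (fps_X ^ k) ^ Suc n * G)" by (rule fps_expansion_unique_complex)
    also have "\<dots> = P + fps_X ^ (k * Suc n) * (P * G)"
      by (simp add: algebra_simps flip: power_mult power_Suc)
    finally have "fps_nth A n = fps_nth P n + fps_nth (fps_X ^ (k * Suc n) * (P * G)) n" by simp
    moreover have "n < k * Suc n" using assms by (cases k) auto
    ultimately have "fps_nth A n = fps_nth P n" by (simp only: fps_X_power_mult_nth if_True add_0_right)
    then show ?thesis using P by (simp add: rat_fps_def)
  qed
  then show ?thesis using A unfolding rat_fps_def by blast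
qed

lemma ratq_eta_quotient:
  assumes "k > 0" "m > 0"
  shows "ratq (qser 1 (\<lambda>q. Pq (q ^ k) / (q ^ r * Pq (q ^ m))))"
proof -
  obtain A where A: "rat_fps A" "(\<lambda>q. Pq (q ^ k)) has_fps_expansion A" using Pq_power_expansion[OF assms(1)] by blast
  obtain B where B: "rat_fps B" "(\<lambda>q. Pq (q ^ m)) has_fps_expansion B" using Pq_power_expansion[OF assms(2)] by blast
  have n: "norm (q ^ i) < 1" if "norm q < 1" "i > 0" for q :: complex and i
    using that norm_power_less_one by blast
  have mero: "(\<lambda>q. Pq (q ^ i)) meromorphic_on ball 0 1" if i: "i > 0" for i
    by (intro holomorphic_imp_meromorphic holomorphic_intros) (use n i in auto)
  have X: "rat_fls (fls_X_intpow (int r))" by (auto simp: rat_fls_def)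
  have "(\<lambda>q. Pq (q ^ k) * inverse (q ^ r * Pq (q ^ m))) has_laurent_expansion
          (fps_to_fls A * inverse (fls_X_intpow (int r) * fps_to_fls B))"
    by (intro laurent_expansion_intros has_laurent_expansion_fps A B)
  moreover have "rat_fls (fps_to_fls A * inverse (fls_X_intpow (int r) * fps_to_fls B))"
    by (intro rat_fls_arith rat_fls_inverse rat_fls_of_fps A B X)
  moreover have "(\<lambda>q. Pq (q ^ k) * inverse (q ^ r * Pq (q ^ m))) meromorphic_on ball 0 1"
    by (intro meromorphic_intros mero assms)
  ultimately show ?thesis unfolding ratq_iff divide_inverse by blast
qed

section \<open>Closure of the function fields under field operations\<close>

lemma modular_functions_arith:
  assumes "f \<in> modular_functions N" "g \<in> modular_functions N" "N > 0"
  shows "f - g \<in> modular_functions N" "f * g \<in> modular_functions N" "inverse f \<in> modular_functions N"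
proof -
  have inv: "pullback a b c d h = h" if "h \<in> modular_functions N" "a * d - b * c = 1" "int N dvd c" for a b c d h
    using that by (auto simp: modular_functions_def)
  have q: "\<exists>F. F meromorphic_on ball 0 1 \<and> pullback a b c d h = qser N F"
    if "h \<in> modular_functions N" "a * d - b * c = 1" for a b c d h
    using that modular_functions_iff[OF assms(3)] by blast
  note f = inv[OF assms(1)] q[OF assms(1)] and g = inv[OF assms(2)] q[OF assms(2)]
  have "\<exists>H. H meromorphic_on ball 0 1 \<and> pullback a b c d (f - g) = qser N H"
    "\<exists>H. H meromorphic_on ball 0 1 \<and> pullback a b c d (f * g) = qser N H"
    "\<exists>H. H meromorphic_on ball 0 1 \<and> pullback a b c d (inverse f) = qser N H"
    if det: "a * d - b * c = 1" for a b c d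
  proof -
    obtain F where F: "F meromorphic_on ball 0 1" "pullback a b c d f = qser N F" using f(2)[OF det] by blast
    obtain G where G: "G meromorphic_on ball 0 1" "pullback a b c d g = qser N G" using g(2)[OF det] by blast
    show "\<exists>H. H meromorphic_on ball 0 1 \<and> pullback a b c d (f - g) = qser N H"
      using F G det assms(3) by (intro exI[of _ "\<lambda>q. F q - G q"]) (auto intro!: meromorphic_intros simp: pullback_arith qser_arith)
    show "\<exists>H. H meromorphic_on ball 0 1 \<and> pullback a b c d (f * g) = qser N H"
      using F G det assms(3) by (intro exI[of _ "\<lambda>q. F q * G q"]) (auto intro!: meromorphic_intros simp: pullback_arith qser_arith)
    show "\<exists>H. H meromorphic_on ball 0 1 \<and> pullback a b c d (inverse f) = qser N H"
      using F det assms(3) by (intro exI[of _ "\<lambda>q. inverse (F q)"]) (auto intro!: meromorphic_intros simp: pullback_arith qser_arith_unary)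
  qed
  then show "f - g \<in> modular_functions N" "f * g \<in> modular_functions N" "inverse f \<in> modular_functions N"
    unfolding modular_functions_iff[OF assms(3)] using f(1) g(1) by (simp_all add: pullback_arith)
qed

lemma modular_functions_1: "1 \<in> modular_functions N" if "N > 0"
  unfolding modular_functions_iff[OF that]
  by (auto simp: pullback_1 intro!: exI[of _ "\<lambda>_. 1"])

lemma rat_modular_functions_eq: "rat_modular_functions N = {f \<in> modular_functions N. ratq f}"
  by (simp add: rat_modular_functions_def ratq_def)

lemma rat_modular_functions_closed:
  assumes "N > 0"
  shows "1 \<in> rat_modular_functions N"
    and "f \<in> rat_modular_functions N \<Longrightarrow> g \<in> rat_modular_functions N \<Longrightarrow> f - g \<in> rat_modular_functions N"
    and "f \<in> rat_modular_functions N \<Longrightarrow> g \<in> rat_modular_functions N \<Longrightarrow> f * g \<in> rat_modular_functions N"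
    and "f \<in> rat_modular_functions N \<Longrightarrow> inverse f \<in> rat_modular_functions N"
  using assms by (auto simp: rat_modular_functions_eq modular_functions_1 modular_functions_arith ratq_1 ratq_arith)

lemma modular_of_qunit:
  assumes "Gamma0_invariant N f" "\<And>a b c d. a * d - b * c = 1 \<Longrightarrow> qunit N (m a b c d) (pullback a b c d f)" "N > 0"
  shows "f \<in> modular_functions N"
  unfolding modular_functions_iff[OF assms(3)]
proof (intro conjI allI impI)
  fix a b c d :: int
  assume "a * d - b * c = 1"
  from assms(2)[OF this] show "\<exists>F. F meromorphic_on ball 0 1 \<and> pullback a b c d f = qser N F"
    unfolding qunit_def using qunit_meromorphic by blast
qed (use Gamma0_invariantD[OF assms(1)] in blast)

lemma h1_rat_modular: "h1 \<in> rat_modular_functions 75"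
proof -
  have "h1 \<in> modular_functions 75"
    by (rule modular_of_qunit[OF h1_invariant_75 h1_qunit_75]) auto
  moreover have "hq = (\<lambda>q. Pq (q ^ 1) / (q ^ 1 * Pq (q ^ 25)))" by (simp add: hq_def fun_eq_iff)
  then have "ratq h1" unfolding h1_def using ratq_eta_quotient[of 1 25 1] by simp
  ultimately show ?thesis by (simp add: rat_modular_functions_eq)
qed

lemma h3_rat_modular: "h3 \<in> rat_modular_functions 75"
proof -
  have "h3 \<in> modular_functions 75"
    by (rule modular_of_qunit[OF h3_invariant_75 h3_qunit_75]) auto
  moreover have "(\<lambda>q. hq (q ^ 3)) = (\<lambda>q. Pq (q ^ 3) / (q ^ 3 * Pq (q ^ 75)))"
    by (simp add: hq_def fun_eq_iff flip: power_mult)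
  then have "ratq h3" unfolding h3_def using ratq_eta_quotient[of 3 75 3] by simp
  ultimately show ?thesis by (simp add: rat_modular_functions_eq)
qed


section \<open>Fields of fractions\<close>

lemma type_algebra_simps [simp]:
  "carrier ring_of_type_algebra = UNIV"
  "monoid.mult ring_of_type_algebra = (*)"
  "monoid.one ring_of_type_algebra = 1"
  "ring.zero ring_of_type_algebra = 0"
  "ring.add ring_of_type_algebra = (+)"
  by (simp_all add: ring_of_type_algebra_def fun_eq_iff)

lemma type_algebra_a_inv [simp]: "a_inv (ring_of_type_algebra :: 'a :: comm_ring_1 ring) x = - x"
proof -
  interpret R: cring "ring_of_type_algebra :: 'a ring" by (rule cring_from_type_algebra)
  show ?thesis by (rule R.minus_equality) auto
qed

lemma type_algebra_inv [simp]:
  fixes x :: "'a :: Fields.field"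
  assumes "x \<noteq> 0"
  shows "m_inv ring_of_type_algebra x = inverse x"
proof -
  interpret R: field "ring_of_type_algebra :: 'a ring" by (rule field_from_type_algebra)
  show ?thesis by (rule R.comm_inv_char) (use assms in auto)
qed

text \<open>Differences yield 0, negatives and sums; the convention inverse 0 = 0 lets the last
  clause range over all of E.\<close>

lemma subfield_type_algebra_iff:
  fixes E :: "'a :: Fields.field set"
  shows "subfield E ring_of_type_algebra \<longleftrightarrow>
     1 \<in> E \<and> (\<forall>f\<in>E. \<forall>g\<in>E. f - g \<in> E) \<and> (\<forall>f\<in>E. \<forall>g\<in>E. f * g \<in> E) \<and> (\<forall>f\<in>E. inverse f \<in> E)"
  (is "?l \<longleftrightarrow> ?r")
proof -
  interpret R: field "ring_of_type_algebra :: 'a ring" by (rule field_from_type_algebra)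
  show ?thesis
  proof
    assume l: ?l
    note E = subringE[OF subfieldE(1)[OF l], simplified]
    have "f - g \<in> E" if "f \<in> E" "g \<in> E" for f g
      using E(7)[OF that(1) E(5)[OF that(2)]] by simp
    moreover have "inverse f \<in> E" if "f \<in> E" for f
    proof (cases "f = 0")
      case False
      then show ?thesis using R.subfield_m_inv(1)[OF l, of f] that by simp
    qed (use E in auto)
    ultimately show ?r using E by auto
  next
    assume r: ?r
    then have 0: "0 \<in> E" by (metis diff_self)
    then have m: "- f \<in> E" if "f \<in> E" for f using r that by (metis diff_0)
    then have "f + g \<in> E" if "f \<in> E" "g \<in> E" for f g
      using r that by (metis diff_minus_eq_add)
    with r m show ?l
      by (intro R.subfieldI' R.subringI) auto
  qed
qed

lemma subfield_closed:
  assumes "subfield E (mero_field)"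
  shows "0 \<in> E" "1 \<in> E" "f \<in> E \<Longrightarrow> g \<in> E \<Longrightarrow> f + g \<in> E" "f \<in> E \<Longrightarrow> g \<in> E \<Longrightarrow> f - g \<in> E"
    "f \<in> E \<Longrightarrow> g \<in> E \<Longrightarrow> f * g \<in> E" "f \<in> E \<Longrightarrow> g \<in> E \<Longrightarrow> f / g \<in> E" "f \<in> E \<Longrightarrow> - f \<in> E"
    "f \<in> E \<Longrightarrow> f ^ n \<in> E" "numeral k \<in> E" "of_rat r \<in> E"
    "(\<And>i. i \<in> I \<Longrightarrow> h i \<in> E) \<Longrightarrow> sum h I \<in> E"
proof -
  note E = assms[unfolded subfield_type_algebra_iff]
  show 0: "0 \<in> E" and 1: "1 \<in> E" using E by (metis diff_self)+
  show m: "- f \<in> E" if "f \<in> E" for f using E 0 that by (metis diff_0)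
  show add: "f + g \<in> E" if "f \<in> E" "g \<in> E" for f g
    using E m that by (metis diff_minus_eq_add)
  show "f - g \<in> E" "f * g \<in> E" if "f \<in> E" "g \<in> E" for f g using E that by auto
  show div: "f / g \<in> E" if "f \<in> E" "g \<in> E" for f g using E that unfolding divide_inverse by auto
  show "f ^ n \<in> E" if "f \<in> E" for f using E that by (induction n) auto
  have nat: "of_nat n \<in> E" for n using 0 1 add by (induction n) auto
  show "numeral k \<in> E" using nat[of "numeral k"] by simp
  have int: "of_int i \<in> E" for i using nat[of "nat \<bar>i\<bar>"] m by (cases "i \<ge> 0") force+
  show "of_rat r \<in> E"
    by (cases r) (use int div in \<open>auto simp: of_rat_rat\<close>)
  show "sum h I \<in> E" if "\<And>i. i \<in> I \<Longrightarrow> h i \<in> E"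
    using that 0 add by (induction I rule: infinite_finite_induct) auto
qed

section \<open>Evaluation homomorphisms and quotient rings\<close>

definition is_hom :: "('a :: comm_ring_1 \<Rightarrow> 'b :: comm_ring_1) \<Rightarrow> bool" where
  "is_hom f \<longleftrightarrow> f 1 = 1 \<and> (\<forall>x y. f (x + y) = f x + f y) \<and> (\<forall>x y. f (x * y) = f x * f y)"

lemma is_hom_simps:
  assumes "is_hom f"
  shows "f 0 = 0" "f 1 = 1" "f (x + y) = f x + f y" "f (x * y) = f x * f y" "f (- x) = - f x"
    "f (x - y) = f x - f y" "f (x ^ n) = f x ^ n" "f (numeral k) = numeral k"
proof -
  show 1: "f 1 = 1" and add: "f (x + y) = f x + f y" and mult: "f (x * y) = f x * f y" for x y
    using assms by (auto simp: is_hom_def)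
  show 0: "f 0 = 0" using add[of 0 0] by simp
  show m: "f (- x) = - f x" for x using add[of x "- x"] 0 by (simp add: eq_neg_iff_add_eq_0 add.commute)
  show "f (x - y) = f x - f y" using add[of x "- y"] m by simp
  show "f (x ^ n) = f x ^ n" by (induction n) (simp_all add: 1 mult)
  have "f (of_nat n) = of_nat n" for n by (induction n) (simp_all add: 0 1 add)
  from this[of "numeral k"] show "f (numeral k) = numeral k" by simp
qed

definition eval_hom :: "('a :: comm_ring_1 \<Rightarrow> 'b :: comm_ring_1) \<Rightarrow> 'b \<Rightarrow> 'a poly \<Rightarrow> 'b" where
  "eval_hom f a p = poly (map_poly f p) a"

lemma eval_hom_pCons:
  "is_hom f \<Longrightarrow> eval_hom f a (pCons c p) = f c + a * eval_hom f a p"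
  by (simp add: eval_hom_def map_poly_pCons is_hom_simps)

lemma eval_hom_0 [simp]: "eval_hom f a 0 = 0"
  by (simp add: eval_hom_def)

lemma is_hom_eval_hom:
  assumes f: "is_hom f"
  shows "is_hom (eval_hom f a)"
proof -
  have add: "eval_hom f a (p + q) = eval_hom f a p + eval_hom f a q" for p q
    by (induction p q rule: poly_induct2) (simp_all add: eval_hom_pCons f is_hom_simps[OF f] algebra_simps)
  have smult: "eval_hom f a (Polynomial.smult c q) = f c * eval_hom f a q" for c q
    by (induction q) (simp_all add: eval_hom_pCons f is_hom_simps[OF f] algebra_simps)
  have "eval_hom f a (p * q) = eval_hom f a p * eval_hom f a q" for p q
    by (induction p) (simp_all add: eval_hom_pCons f is_hom_simps[OF f] algebra_simps add smult)
  moreover have "eval_hom f a 1 = 1"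
    unfolding one_pCons by (simp add: eval_hom_pCons f is_hom_simps[OF f])
  ultimately show ?thesis using add by (simp add: is_hom_def)
qed

lemma is_hom_of_rat: "is_hom (of_rat :: rat \<Rightarrow> 'a :: field_char_0)"
  by (simp add: is_hom_def of_rat_add of_rat_mult)

text \<open>Dividing by a monic polynomial involves no division of coefficients, so the coefficients
  may themselves be polynomials.\<close>

lemma monic_quadratic_division:
  fixes p m :: "'a :: comm_ring_1 poly"
  assumes m: "m = [:b0, b1, 1:]"
  shows "\<exists>q r0 r1. p = q * m + [:r0, r1:]"
proof (induction p)
  case 0
  show ?case by (intro exI[of _ 0]) simp
next
  case (pCons a p)
  then obtain q r0 r1 where p: "p = q * m + [:r0, r1:]" by blast
  have "pCons a p = pCons 0 (q * m) + [:a, r0, r1:]" by (simp add: p)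
  also have "[:a, r0, r1:] = [:r1:] * m + [:a - r1 * b0, r0 - r1 * b1:]" by (simp add: m)
  also have "pCons 0 (q * m) + ([:r1:] * m + [:a - r1 * b0, r0 - r1 * b1:]) =
      (pCons 0 q + [:r1:]) * m + [:a - r1 * b0, r0 - r1 * b1:]"
    by (simp add: distrib_right)
  finally show ?case by blast
qed

text \<open>The quotient field of the image of an evaluation homomorphism is generated by the images of
  the variables, so it is enough to compute the kernel.\<close>

lemma fraction_field_of_quotient:
  fixes h :: "'a :: comm_ring_1 \<Rightarrow> 'b :: Fields.field"
  assumes h: "is_hom h" and ker: "{a. h a = 0} = Idl\<^bsub>ring_of_type_algebra\<^esub> S"
    and K: "subfield K ring_of_type_algebra" "range h \<subseteq> K"
    and fr: "\<And>f. f \<in> K \<Longrightarrow> \<exists>a b. h b \<noteq> 0 \<and> f = h a / h b"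
  shows "fraction_field_of (ring_of_type_algebra Quot (Idl\<^bsub>ring_of_type_algebra\<^esub> S))
           ((ring_of_type_algebra :: 'b ring)\<lparr>carrier := K\<rparr>)"
proof -
  let ?R = "ring_of_type_algebra :: 'a ring" and ?F = "ring_of_type_algebra :: 'b ring"
  interpret R: cring ?R by (rule cring_from_type_algebra)
  interpret F: field ?F by (rule field_from_type_algebra)
  interpret hom: ring_hom_ring ?R ?F h
    by unfold_locales (auto simp: ring_hom_def is_hom_simps[OF h])
  define I where "I = a_kernel ?R ?F h"
  have I: "Idl\<^bsub>?R\<^esub> S = I"
    unfolding ker[symmetric] I_def a_kernel_def' by simp
  define Q where "Q = ?R Quot I"
  \<comment> \<open>The induced map on cosets: h is constant on each of them.\<close>
  define \<psi> where "\<psi> = (\<lambda>c. the_elem (h ` c))"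
  have \<psi>: "\<psi> \<in> ring_hom Q ?F" unfolding \<psi>_def Q_def I_def by (rule hom.the_elem_hom)
  have inj: "inj_on \<psi> (carrier Q)"
    unfolding \<psi>_def Q_def I_def by (intro inj_onI hom.the_elem_inj)
  have img: "\<psi> ` carrier Q = range h"
    unfolding \<psi>_def Q_def I_def using hom.the_elem_surj by simp
  interpret I: ideal I ?R unfolding I_def by (rule hom.kernel_is_ideal)
  interpret Q: ring Q unfolding Q_def by (rule I.quotient_is_ring)
  interpret \<psi>: ring_hom_ring Q ?F \<psi>
    by (intro ring_hom_ringI2 Q.ring_axioms F.ring_axioms \<psi>)
  have dom: "domain Q"
    using \<psi>.inj_on_domain[OF inj F.domain_axioms] .
  interpret K: field "?F\<lparr>carrier := K\<rparr>" using F.subfield_iff(2)[OF K(1)] .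
  have inv: "inv\<^bsub>?F\<lparr>carrier := K\<rparr>\<^esub> f = inverse f" if "f \<in> K" "f \<noteq> 0" for f
  proof (rule K.comm_inv_char)
    show "inverse f \<in> carrier (?F\<lparr>carrier := K\<rparr>)"
      using K(1) that unfolding subfield_type_algebra_iff by simp
  qed (use that in auto)
  have \<psi>K: "\<psi> a \<in> K" if "a \<in> carrier Q" for a using img K(2) that by blast
  have \<psi>nz: "\<psi> b \<noteq> 0" if "b \<in> carrier Q - {\<zero>\<^bsub>Q\<^esub>}" for b
  proof
    assume "\<psi> b = 0"
    then have "\<psi> b = \<psi> \<zero>\<^bsub>Q\<^esub>" using \<psi>.hom_zero by simp
    from inj_onD[OF inj this] that show False by simp
  qed
  have "carrier (?F\<lparr>carrier := K\<rparr>) = {\<psi> a \<otimes>\<^bsub>?F\<lparr>carrier := K\<rparr>\<^esub> inv\<^bsub>?F\<lparr>carrier := K\<rparr>\<^esub> (\<psi> b) |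
      a b. a \<in> carrier Q \<and> b \<in> carrier Q - {\<zero>\<^bsub>Q\<^esub>}}" (is "_ = ?B")
  proof (intro equalityI subsetI)
    fix f assume "f \<in> carrier (?F\<lparr>carrier := K\<rparr>)"
    then have "f \<in> K" by simp
    from fr[OF this] obtain a b where ab: "h b \<noteq> 0" "f = h a / h b" by blast
    have "h a \<in> \<psi> ` carrier Q" unfolding img by simp
    then obtain a' where a': "a' \<in> carrier Q" "h a = \<psi> a'" by blast
    have "h b \<in> \<psi> ` carrier Q" unfolding img by simp
    then obtain b' where b': "b' \<in> carrier Q" "h b = \<psi> b'" by blast
    have "b' \<noteq> \<zero>\<^bsub>Q\<^esub>" using ab b' \<psi>.hom_zero by auto
    moreover have "f = \<psi> a' * inverse (\<psi> b')" using ab a' b' by (simp add: divide_inverse)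
    ultimately have "f = \<psi> a' \<otimes>\<^bsub>?F\<lparr>carrier := K\<rparr>\<^esub> inv\<^bsub>?F\<lparr>carrier := K\<rparr>\<^esub> (\<psi> b')"
      using inv[OF \<psi>K[OF b'(1)]] ab b' by simp
    then show "f \<in> ?B" using a' b' \<open>b' \<noteq> \<zero>\<^bsub>Q\<^esub>\<close> by blast
  next
    fix f assume "f \<in> ?B"
    then obtain a b where ab: "a \<in> carrier Q" "b \<in> carrier Q - {\<zero>\<^bsub>Q\<^esub>}"
      "f = \<psi> a \<otimes>\<^bsub>?F\<lparr>carrier := K\<rparr>\<^esub> inv\<^bsub>?F\<lparr>carrier := K\<rparr>\<^esub> (\<psi> b)" by blast
    have "inverse (\<psi> b) \<in> K" "inv\<^bsub>?F\<lparr>carrier := K\<rparr>\<^esub> (\<psi> b) = inverse (\<psi> b)"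
      using K(1) \<psi>K inv[OF \<psi>K \<psi>nz] ab(2) unfolding subfield_type_algebra_iff by auto
    then show "f \<in> carrier (?F\<lparr>carrier := K\<rparr>)"
      using ab(1,3) \<psi>K K(1) unfolding subfield_type_algebra_iff by simp
  qed
  moreover have "\<psi> \<in> ring_hom Q (?F\<lparr>carrier := K\<rparr>)"
    using \<psi> \<psi>K by (auto simp: ring_hom_def)
  ultimately show ?thesis
    unfolding fraction_field_of_def I Q_def[symmetric] using dom inj K.field_axioms by blast
qed


section \<open>Generators of the function field\<close>

definition xX :: mero where "xX = uX - 1"
text \<open>At the singular point of the curve of \<open>uX\<close> and \<open>vX\<close> both x = 0
  and v + 3 = 0, so the quotient (v + 3) / x resolves it. The other terms only add x + 4, which
  brings the cubic into the stated form.\<close>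

definition yX :: mero where "yX = (vX + 3 + 4 * xX + xX ^ 2) / xX"
text \<open>Like \<open>dX\<close> this is anti-invariant. Division by \<open>uX\<close> still
  leaves a polynomial for the square: modulo \<open>curve_relation\<close> both vX^2 and vX^2 - 20
  uX^3 are divisible by \<open>uX\<close>.\<close>

definition tX :: mero where "tX = dX * vX / uX"

lemma xX_lord: "lord 2 xX"
  using lord_add[OF uX_lord, of "\<lambda>_. - 1" "- 1" 0] by (simp add: xX_def const_mero_minus)

lemma xX_nonzero: "xX \<noteq> 0" and uX_nonzero: "uX \<noteq> 0" and vX_nonzero: "vX \<noteq> 0" and dX_nonzero: "dX \<noteq> 0"
  using lord_nonzero xX_lord uX_lord vX_lord dX_lord by blast+

lemma tX_nonzero: "tX \<noteq> 0"
  by (simp add: tX_def uX_nonzero vX_nonzero dX_nonzero)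

lemma uX_eq: "uX = xX + 1"
  by (simp add: xX_def)

lemma vX_eq: "vX = xX * yX - 3 - 4 * xX - xX ^ 2"
  using xX_nonzero by (simp add: yX_def)

lemma dX_eq: "dX = tX * uX / vX"
  using uX_nonzero vX_nonzero by (simp add: tX_def)

text \<open>Substituting for u and v in \<open>curve_relation\<close> produces x^2 times the
  equation; the extra factor comes from the singular point.\<close>

lemma curve_equation: "yX ^ 2 + xX * yX + yX = xX ^ 3 + xX ^ 2"
proof -
  have "xX ^ 2 * (yX ^ 2 + xX * yX + yX - (xX ^ 3 + xX ^ 2)) =
      vX ^ 2 + 3 * uX * (1 + uX) * vX - (uX ^ 5 - 6 * uX ^ 4 + uX ^ 3 - 6 * uX ^ 2 + uX)"
    unfolding uX_eq vX_eq by Groebner_Basis.algebra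
  also have "\<dots> = 0" using curve_relation by simp
  finally show ?thesis using xX_nonzero by simp
qed

lemma dX_square: "dX ^ 2 = vX ^ 2 - 20 * uX ^ 3"
proof -
  have "sX * sY = uX ^ 3"
    by (simp add: sX_def sY_def uX_def power2_eq_square power3_eq_cube)
  then show ?thesis unfolding dX_def vX_def by Groebner_Basis.algebra
qed

lemma double_cover_equation:
  "tX ^ 2 = - 99 - 390 * xX - 569 * xX ^ 2 - 372 * xX ^ 3 - 67 * xX ^ 4 + 56 * xX ^ 5 + 40 * xX ^ 6 + 11 * xX ^ 7 + xX ^ 8
     - 3 * xX * (2 + xX) * (- 2 - 4 * xX + 3 * xX ^ 2 + 5 * xX ^ 3 + 2 * xX ^ 4) * yX" (is "_ = ?r")
proof -
  have "tX * uX = dX * vX" using uX_nonzero by (simp add: tX_def)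
  then have "uX ^ 2 * tX ^ 2 = (vX ^ 2 - 20 * uX ^ 3) * vX ^ 2"
    using dX_square by Groebner_Basis.algebra
  also have "\<dots> = uX ^ 2 * ?r"
    using curve_equation unfolding uX_eq vX_eq by Groebner_Basis.algebra
  finally show ?thesis using uX_nonzero by simp
qed

lemma Fricke_xX: "Fricke xX = xX"
proof -
  have "Fricke 1 = 1" by (simp add: Fricke_def pullback_1)
  then show ?thesis by (simp add: xX_def Fricke_arith Fricke_uX)
qed

lemma Fricke_yX: "Fricke yX = yX"
proof -
  have "xX * yX = vX + 3 + 4 * xX + xX ^ 2" using xX_nonzero by (simp add: yX_def)
  then have "xX * Fricke yX = Fricke (vX + 3 + 4 * xX + xX ^ 2)"
    by (metis Fricke_arith(3) Fricke_xX)
  also have "\<dots> = xX * yX"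
    unfolding \<open>xX * yX = _\<close> by (simp add: Fricke_arith Fricke_vX Fricke_xX)
  finally show ?thesis using xX_nonzero by simp
qed

lemma Fricke_tX: "Fricke tX = - tX"
  by (simp add: tX_def Fricke_arith Fricke_vX Fricke_uX Fricke_dX)

text \<open>The representative has A = D = 0, B = -1 and C = 1.\<close>

lemma atkin_lehner_75: "f \<in> modular_functions 75 \<Longrightarrow> atkin_lehner 75 75 f = Fricke f"
  using atkin_lehner_eq[of f 75 75 0 0 "- 1" 1] by (simp add: Fricke_def)

lemma subfield_rat_modular: "N > 0 \<Longrightarrow> subfield (rat_modular_functions N) mero_field"
  unfolding subfield_type_algebra_iff by (simp add: rat_modular_functions_closed)

lemma generators_rat_modular:
  "uX \<in> rat_modular_functions 75" "vX \<in> rat_modular_functions 75" "dX \<in> rat_modular_functions 75"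
  "xX \<in> rat_modular_functions 75" "yX \<in> rat_modular_functions 75" "tX \<in> rat_modular_functions 75"
proof -
  have K: "subfield (rat_modular_functions 75) mero_field" by (rule subfield_rat_modular) simp
  note closed = subfield_closed[OF K]
  show u: "uX \<in> rat_modular_functions 75" and v: "vX \<in> rat_modular_functions 75" and d: "dX \<in> rat_modular_functions 75"
    unfolding uX_def vX_def dX_def sX_def sY_def by (intro closed h1_rat_modular h3_rat_modular)+
  show x: "xX \<in> rat_modular_functions 75" unfolding xX_def by (intro closed u)
  show "yX \<in> rat_modular_functions 75" "tX \<in> rat_modular_functions 75"
    unfolding yX_def tX_def by (intro closed u v d x)+
qed

lemma poly_eq_sum_le:
  fixes x :: "'a :: comm_semiring_1"
  shows "Polynomial.degree p \<le> N \<Longrightarrow> poly p x = (\<Sum>i\<le>N. Polynomial.coeff p i * x ^ i)"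
  unfolding poly_altdef by (rule sum.mono_neutral_left) (auto simp: coeff_eq_0)

text \<open>The field E is arbitrary, so that the same decomposition gives both generation by x, y,
  t and the fixed field generated by x, y.\<close>

lemma rat_modular_decomposition:
  assumes f: "f \<in> rat_modular_functions 75" and E: "subfield E mero_field" "uX \<in> E" "vX \<in> E"
  shows "\<exists>A\<in>E. \<exists>B\<in>E. f = A + B * dX"
proof -
  note closed = subfield_closed[OF E(1)]
  have K: "subfield (rat_modular_functions 75) mero_field" by (rule subfield_rat_modular) simp
  note K_closed = subfield_closed[OF K]
  obtain L where "has_q_expansion 1 f L" "f \<in> modular_functions 75"
    using f by (auto simp: rat_modular_functions_def)
  then obtain P where P: "\<And>j. j < 5 \<Longrightarrow> P j \<in> cpoly" "\<exists>j<5. P j \<noteq> 0"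
    "(\<Sum>j<5. poly (P j) uX * (if j = 0 then f else gens j)) = 0"
    using algebraic_relation by blast
  have sum5: "(\<Sum>j<5::nat. g j) = g 0 + g 1 + g 2 + g 3 + g 4" for g :: "nat \<Rightarrow> mero"
    by (simp add: eval_nat_numeral)
  \<comment> \<open>Otherwise the relation would involve only 1, vX, dX and vX dX, which are
    independent.\<close>
  have "P 0 \<noteq> 0"
  proof
    assume 0: "P 0 = 0"
    have "poly (P 1) uX + poly (P 2) uX * vX + poly (P 3) uX * dX + poly (P 4) uX * vX * dX = 0"
      using P(3) 0 unfolding sum5 by (simp add: gens_def mult_ac)
    from cpoly_independent_4[OF P(1) P(1) P(1) P(1) uX_lord Fricke_uX this]
    have "P 1 = 0" "P 2 = 0" "P 3 = 0" "P 4 = 0" by simp_all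
    moreover obtain j where "j < 5" "P j \<noteq> 0" using P(2) by blast
    moreover from this have "j = 0 \<or> j = 1 \<or> j = 2 \<or> j = 3 \<or> j = 4" by presburger
    ultimately show False using 0 by auto
  qed
  \<comment> \<open>The functional is chosen not to kill this coefficient, so the coefficient of f
    stays nonzero after descent.\<close>
  then obtain i0 where i0: "Polynomial.coeff (P 0) i0 \<noteq> 0" by (auto simp: poly_eq_iff)
  define a where "a = (\<lambda>j i. inv_into UNIV const_mero (Polynomial.coeff (P j) i))"
  have a: "Polynomial.coeff (P j) i = const_mero (a j i)" if "j < 5" for j i
    using P(1)[OF that] by (simp add: a_def cpoly_def f_inv_into_f)
  define N where "N = (\<Sum>j<5. Polynomial.degree (P j))"
  have N: "Polynomial.degree (P j) \<le> N" if "j < 5" for j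
    unfolding N_def by (rule member_le_sum) (use that in auto)
  define e where "e = (\<lambda>j. if j = 0 then f else gens j)"
  define J where "J = {..<5::nat} \<times> {..N}"
  define g where "g = (\<lambda>(j, i). uX ^ i * e j)"
  have split: "(\<Sum>x\<in>J. c x * g x) = (\<Sum>j<5. (\<Sum>i\<le>N. c (j, i) * uX ^ i) * e j)" for c
    unfolding J_def g_def sum_distrib_right sum.cartesian_product
    by (intro sum.cong) (auto simp: mult.assoc)
  have "(\<Sum>x\<in>J. const_mero (case x of (j, i) \<Rightarrow> a j i) * g x) = 0"
    unfolding split P(3)[symmetric] by (intro sum.cong) (auto simp: e_def poly_eq_sum_le[OF N] a)
  moreover have "ratq (g x)" for x
  proof -
    have "gens j \<in> rat_modular_functions 75" for j
      unfolding gens_def by (auto intro: K_closed generators_rat_modular)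
    then have "g x \<in> rat_modular_functions 75"
      unfolding g_def e_def by (auto intro!: K_closed generators_rat_modular f split: prod.split)
    then show ?thesis by (simp add: rat_modular_functions_eq)
  qed
  moreover have "i0 \<le> N" using le_degree[OF i0] N[of 0] by simp
  then have "(0, i0) \<in> J" by (simp add: J_def)
  moreover have "(case (0, i0) of (j, i) \<Rightarrow> a j i) \<noteq> 0" using i0 a[of 0 i0] by auto
  moreover have "finite J" by (simp add: J_def)
  ultimately obtain b :: "nat \<times> nat \<Rightarrow> rat" where b: "b (0, i0) \<noteq> 0" "(\<Sum>x\<in>J. of_rat (b x) * g x) = 0"
    using rational_descent[of J g "\<lambda>x. case x of (j, i) \<Rightarrow> a j i" "(0, i0)"] by blast
  define Q where "Q = (\<lambda>j. \<Sum>i\<le>N. of_rat (b (j, i)) * uX ^ i)"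
  have Q: "Q j \<in> E" for j unfolding Q_def by (intro closed E)
  have Q0: "Q 0 \<noteq> 0"
  proof -
    \<comment> \<open>The rational polynomial is read as one with complex constants, so that its
      pole order at \<infinity> shows it to be nonzero.\<close>
    define R where "R = (\<Sum>i\<le>N. Polynomial.monom (const_mero (of_rat (b (0, i)))) i)"
    have "Polynomial.coeff R i0 \<noteq> 0"
      using \<open>i0 \<le> N\<close> b(1) by (simp add: R_def coeff_sum const_mero_of_rat)
    then have "R \<noteq> 0" by auto
    moreover have "R \<in> cpoly" unfolding R_def by (rule cpoly_monom_sum)
    ultimately have "poly R uX \<noteq> 0" by (intro lord_nonzero[OF lord_poly] uX_lord)
    then show ?thesis by (simp add: R_def Q_def poly_sum poly_monom const_mero_of_rat)
  qed
  have "(\<Sum>x\<in>J. of_rat (b x) * g x) = (\<Sum>j<5. Q j * e j)"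
    unfolding split Q_def by (rule refl)
  then have "Q 0 * f + (Q 1 + Q 2 * vX + (Q 3 + Q 4 * vX) * dX) = 0"
    using b(2) unfolding sum5 by (simp add: e_def gens_def algebra_simps)
  then have "f * Q 0 = - (Q 1 + Q 2 * vX) + - (Q 3 + Q 4 * vX) * dX"
    by Groebner_Basis.algebra
  then have "f = (- (Q 1 + Q 2 * vX) + - (Q 3 + Q 4 * vX) * dX) / Q 0"
    by (rule nonzero_eq_divide_eq[OF Q0, THEN iffD2])
  then have "f = - (Q 1 + Q 2 * vX) / Q 0 + - (Q 3 + Q 4 * vX) / Q 0 * dX"
    by (simp only: add_divide_distrib times_divide_eq_left)
  moreover have "- (Q 1 + Q 2 * vX) / Q 0 \<in> E" "- (Q 3 + Q 4 * vX) / Q 0 \<in> E"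
    by (intro closed Q E)+
  ultimately show ?thesis by blast
qed

lemma subfield_generate: "subfield (generate_field mero_field H) mero_field"
proof -
  interpret F: field mero_field by (rule field_from_type_algebra)
  show ?thesis by (rule F.generate_field_is_subfield) simp
qed

lemma generate_field_subset: "subfield E mero_field \<Longrightarrow> H \<subseteq> E \<Longrightarrow> generate_field mero_field H \<subseteq> E"
proof -
  interpret F: field mero_field by (rule field_from_type_algebra)
  show "subfield E mero_field \<Longrightarrow> H \<subseteq> E \<Longrightarrow> generate_field mero_field H \<subseteq> E"
    by (rule F.generate_field_min_subfield1) simp_all
qed

lemma uX_vX_in_subfield:
  assumes "subfield E mero_field" "xX \<in> E" "yX \<in> E"
  shows "uX \<in> E" "vX \<in> E"
  unfolding uX_eq vX_eq by (intro subfield_closed[OF assms(1)] assms(2,3))+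

lemma rat_modular_generated: "rat_modular_functions 75 = generate_field mero_field {xX, yX, tX}"
proof
  let ?G = "generate_field mero_field {xX, yX, tX}"
  show "?G \<subseteq> rat_modular_functions 75"
    by (rule generate_field_subset) (simp_all add: subfield_rat_modular generators_rat_modular)
  have G: "xX \<in> ?G" "yX \<in> ?G" "tX \<in> ?G" by (auto intro: generate_field.incl)
  note closed = subfield_closed[OF subfield_generate]
  note uv = uX_vX_in_subfield[OF subfield_generate G(1,2)]
  have d: "dX \<in> ?G" unfolding dX_eq by (intro closed uv G)
  show "rat_modular_functions 75 \<subseteq> ?G"
  proof
    fix f assume "f \<in> rat_modular_functions 75"
    then obtain A B where "A \<in> ?G" "B \<in> ?G" "f = A + B * dX"
      using rat_modular_decomposition[OF _ subfield_generate uv] by blast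
    with d show "f \<in> ?G" by (simp add: closed)
  qed
qed

text \<open>In f = A + B dX the involution changes only the sign of the last term, so invariance
  forces B = 0.\<close>

lemma Fricke_fixed_field: "{f \<in> rat_modular_functions 75. Fricke f = f} = generate_field mero_field {xX, yX}" (is "?K = ?G")
proof
  have sub: "subfield (rat_modular_functions 75) mero_field" by (rule subfield_rat_modular) simp
  have inv: "Fricke (inverse f) = inverse (Fricke f)" "Fricke 1 = 1" for f
    by (simp_all add: Fricke_def pullback_arith pullback_1)
  have "subfield ?K mero_field"
    using sub unfolding subfield_type_algebra_iff by (simp add: Fricke_arith inv)
  then show G: "?G \<subseteq> ?K"
    by (rule generate_field_subset) (simp add: generators_rat_modular Fricke_xX Fricke_yX)
  have xy: "xX \<in> ?G" "yX \<in> ?G" by (auto intro: generate_field.incl)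
  note uv = uX_vX_in_subfield[OF subfield_generate xy]
  show "?K \<subseteq> ?G"
  proof
    fix f assume f: "f \<in> ?K"
    then obtain A B where AB: "A \<in> ?G" "B \<in> ?G" "f = A + B * dX"
      using rat_modular_decomposition[OF _ subfield_generate uv] by blast
    have "Fricke A = A" "Fricke B = B" using AB G by auto
    then have "A + B * dX = A - B * dX" using f AB(3) by (simp add: Fricke_arith Fricke_dX)
    then have "2 * (B * dX) = 0" by (simp add: algebra_simps eq_neg_iff_add_eq_0)
    then have "B = 0" using dX_nonzero by simp
    then show "f \<in> ?G" using AB by simp
  qed
qed


section \<open>The coordinate ring\<close>

definition ev1 :: "rat poly \<Rightarrow> mero" where "ev1 = eval_hom of_rat xX"
definition ev2 :: "rat poly poly \<Rightarrow> mero" where "ev2 = eval_hom ev1 yX"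
definition ev3 :: "rat_poly3 \<Rightarrow> mero" where "ev3 = eval_hom ev2 tX"

lemma is_hom_ev1: "is_hom ev1"
  unfolding ev1_def by (intro is_hom_eval_hom is_hom_of_rat)

lemma is_hom_ev2: "is_hom ev2"
  unfolding ev2_def by (intro is_hom_eval_hom is_hom_ev1)

lemma is_hom_ev3: "is_hom ev3"
  unfolding ev3_def by (intro is_hom_eval_hom is_hom_ev2)

lemma ev_0 [simp]: "ev1 0 = 0" "ev2 0 = 0" "ev3 0 = 0"
  by (simp_all add: ev1_def ev2_def ev3_def)

lemma ev_pCons:
  "ev1 (pCons r p) = of_rat r + xX * ev1 p"
  "ev2 (pCons p q) = ev1 p + yX * ev2 q"
  "ev3 (pCons q s) = ev2 q + tX * ev3 s"
  by (simp_all add: ev1_def ev2_def ev3_def eval_hom_pCons is_hom_of_rat is_hom_ev1[unfolded ev1_def]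
      is_hom_ev2[unfolded ev1_def ev2_def])

lemma ev1_cpoly: "map_poly of_rat p \<in> cpoly"
  by (auto simp: cpoly_def coeff_map_poly simp flip: const_mero_of_rat)

lemma map_poly_of_rat_eq_0: "map_poly (of_rat :: rat \<Rightarrow> mero) p = 0 \<Longrightarrow> p = 0"
  by (simp add: poly_eq_iff coeff_map_poly)

lemma Fricke_ev1: "Fricke (ev1 p) = ev1 p"
  unfolding ev1_def eval_hom_def by (intro Fricke_cpoly ev1_cpoly Fricke_xX)

text \<open>Multiplying by x replaces x y by vX + 3 + 4 x + x^2 and reduces the claim to the
  independence of 1 and vX; \<open>P\<close> is the resulting coefficient of 1.\<close>

lemma ev1_independent_2:
  assumes "ev1 a + yX * ev1 b = 0"
  shows "a = 0" "b = 0"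
proof -
  define P where "P = [:0, 1:] * a + [:3, 4, 1:] * b"
  have "ev1 P + ev1 b * vX = xX * (ev1 a + yX * ev1 b)"
    unfolding P_def is_hom_simps[OF is_hom_ev1] ev_pCons vX_eq by simp Groebner_Basis.algebra
  then have "poly (map_poly of_rat P) xX + poly (map_poly of_rat b) xX * vX = 0"
    using assms by (simp add: ev1_def eval_hom_def)
  from cpoly_independent_2[OF ev1_cpoly ev1_cpoly xX_lord this]
  have b: "b = 0" and "P = 0" using map_poly_of_rat_eq_0 by blast+
  then show "a = 0" by (simp add: P_def)
  show "b = 0" by (rule b)
qed

lemma ev1_independent_4:
  assumes "ev1 a + yX * ev1 b + tX * (ev1 c + yX * ev1 d) = 0"
  shows "a = 0" "b = 0" "c = 0" "d = 0"
proof -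
  define A B where "A = ev1 a + yX * ev1 b" and "B = ev1 c + yX * ev1 d"
  have 1: "A + tX * B = 0" using assms by (simp add: A_def B_def)
  have "Fricke (A + tX * B) = A - tX * B"
    by (simp add: A_def B_def Fricke_arith Fricke_ev1 Fricke_yX Fricke_tX)
  then have 2: "A - tX * B = 0" using 1 by (simp add: Fricke_arith)
  have "2 * A = 0" using 1 2 by (simp add: algebra_simps)
  then have A: "A = 0" by simp
  then have B: "B = 0" using 1 tX_nonzero by simp
  show "a = 0" "b = 0" using ev1_independent_2 A by (auto simp: A_def)
  show "c = 0" "d = 0" using ev1_independent_2 B by (auto simp: B_def)
qed

lemma ev3_vars: "ev3 var_X = xX" "ev3 var_Y = yX" "ev3 var_T = tX"
  by (simp_all add: var_X_def var_Y_def var_T_def ev_pCons is_hom_simps[OF is_hom_ev1] is_hom_simps[OF is_hom_ev2])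

lemma is_hom_const_poly: "is_hom (\<lambda>c. [:c:])"
  by (simp add: is_hom_def one_pCons)

definition curve_poly :: rat_poly3 where
  "curve_poly = var_Y ^ 2 + var_X * var_Y + var_Y - (var_X ^ 3 + var_X ^ 2)"

definition cover_poly :: rat_poly3 where
  "cover_poly = var_T ^ 2 - (- 99 - 390 * var_X - 569 * var_X ^ 2 - 372 * var_X ^ 3 - 67 * var_X ^ 4 + 56 * var_X ^ 5
     + 40 * var_X ^ 6 + 11 * var_X ^ 7 + var_X ^ 8
     - 3 * var_X * (2 + var_X) * (- 2 - 4 * var_X + 3 * var_X ^ 2 + 5 * var_X ^ 3 + 2 * var_X ^ 4) * var_Y)"

lemma ev3_relations: "ev3 curve_poly = 0" "ev3 cover_poly = 0"
  using curve_equation double_cover_equation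
  by (simp_all add: curve_poly_def cover_poly_def is_hom_simps[OF is_hom_ev3] ev3_vars)

text \<open>As a polynomial in T it is constant, and that constant is monic in Y, which permits the
  second division in \<open>ev3_kernel\<close>.\<close>

lemma curve_poly_monic: "\<exists>b0 b1. curve_poly = [:[:b0, b1, 1:]:]"
proof -
  define c :: "rat poly" where "c = [:0, 1:]"
  define Y :: "rat poly poly" where "Y = [:0, 1:]"
  have "curve_poly = [:Y ^ 2 + [:c:] * Y + Y - ([:c:] ^ 3 + [:c:] ^ 2):]"
    unfolding curve_poly_def var_X_def var_Y_def c_def[symmetric] Y_def[symmetric]
    by (simp only: is_hom_simps[OF is_hom_const_poly])
  also have "Y ^ 2 + [:c:] * Y + Y - ([:c:] ^ 3 + [:c:] ^ 2) = [:- (c ^ 3 + c ^ 2), c + 1, 1:]"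
    by (simp add: Y_def power2_eq_square power3_eq_cube)
  finally show ?thesis by blast
qed

lemma cover_poly_monic: "\<exists>b0 b1. cover_poly = [:b0, b1, 1:]"
proof -
  define A :: "rat poly poly" where "A = [:[:0, 1:]:]"
  define Y :: "rat poly poly" where "Y = [:0, 1:]"
  define C where "C = - 99 - 390 * A - 569 * A ^ 2 - 372 * A ^ 3 - 67 * A ^ 4 + 56 * A ^ 5
     + 40 * A ^ 6 + 11 * A ^ 7 + A ^ 8 - 3 * A * (2 + A) * (- 2 - 4 * A + 3 * A ^ 2 + 5 * A ^ 3 + 2 * A ^ 4) * Y"
  have "cover_poly = var_T ^ 2 - [:C:]"
    unfolding cover_poly_def var_X_def var_Y_def A_def[symmetric] Y_def[symmetric] C_def
    by (simp only: is_hom_simps[OF is_hom_const_poly])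
  also have "\<dots> = [:- C, 0, 1:]" by (simp add: var_T_def power2_eq_square)
  finally show ?thesis by blast
qed

lemma kernel_ideal:
  fixes h :: "'a :: comm_ring_1 \<Rightarrow> 'b :: comm_ring_1"
  assumes h: "is_hom h"
  shows "ideal {a. h a = 0} ring_of_type_algebra"
proof -
  let ?R = "ring_of_type_algebra :: 'a ring" and ?S = "ring_of_type_algebra :: 'b ring"
  interpret R: cring ?R by (rule cring_from_type_algebra)
  interpret S: cring ?S by (rule cring_from_type_algebra)
  interpret hom: ring_hom_ring ?R ?S h
    by (intro ring_hom_ringI2 R.ring_axioms S.ring_axioms ring_hom_memI) (simp_all add: is_hom_simps[OF h])
  have "a_kernel ?R ?S h = {a. h a = 0}" unfolding a_kernel_def' by simp
  then show ?thesis using hom.kernel_is_ideal by (simp only:)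
qed

text \<open>Division by the cover equation in T and by the curve equation in Y leaves r00 + r01 Y +
  (r10 + r11 Y) T, whose value vanishes only if all four coefficients do. As the kernel of a map
  into a field the ideal is then prime.\<close>

lemma ev3_kernel: "{a. ev3 a = 0} = Idl\<^bsub>rat_poly3_ring\<^esub> {curve_poly, cover_poly}" (is "?K = ?I")
proof
  interpret R: cring rat_poly3_ring by (rule cring_from_type_algebra)
  interpret I: ideal ?I rat_poly3_ring by (rule R.genideal_ideal) simp
  have mem: "curve_poly \<in> ?I" "cover_poly \<in> ?I"
    using R.genideal_self[of "{curve_poly, cover_poly}"] by auto
  show "?I \<subseteq> ?K"
    by (rule R.genideal_minimal[OF kernel_ideal[OF is_hom_ev3]]) (simp add: ev3_relations)
  show "?K \<subseteq> ?I"
  proof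
    fix a assume "a \<in> ?K"
    then have a: "ev3 a = 0" by simp
    obtain b0 b1 where cover: "cover_poly = [:b0, b1, 1:]" using cover_poly_monic by blast
    obtain c0 c1 where curve: "curve_poly = [:[:c0, c1, 1:]:]" using curve_poly_monic by blast
    define E where "E = [:c0, c1, 1:]"
    obtain q r0 r1 where q: "a = q * cover_poly + [:r0, r1:]"
      using monic_quadratic_division[OF cover] by blast
    obtain q0 r00 r01 where r0: "r0 = q0 * E + [:r00, r01:]"
      using monic_quadratic_division[OF E_def] by blast
    obtain q1 r10 r11 where r1: "r1 = q1 * E + [:r10, r11:]"
      using monic_quadratic_division[OF E_def] by blast
    have E: "ev2 E = 0"
      using ev3_relations(1) by (simp add: curve E_def[symmetric] ev_pCons)
    have "ev1 r00 + yX * ev1 r01 + tX * (ev1 r10 + yX * ev1 r11) = ev3 a"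
      by (simp add: q r0 r1 is_hom_simps[OF is_hom_ev3] is_hom_simps[OF is_hom_ev2] ev3_relations ev_pCons E)
    then have r: "r00 = 0" "r01 = 0" "r10 = 0" "r11 = 0"
      using a ev1_independent_4[of r00 r01 r10 r11] by simp_all
    have "a = q * cover_poly + [:q0, q1:] * curve_poly"
      by (simp add: q r0 r1 r curve E_def[symmetric] mult.commute)
    moreover have "q * cover_poly \<in> ?I" "[:q0, q1:] * curve_poly \<in> ?I"
      using I.I_l_closed[OF mem(2), of q] I.I_l_closed[OF mem(1), of "[:q0, q1:]"] by simp_all
    ultimately show "a \<in> ?I" using I.a_closed by simp
  qed
qed

lemma subfield_quotients:
  fixes h :: "'a :: comm_ring_1 \<Rightarrow> 'b :: Fields.field"
  assumes h: "is_hom h"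
  shows "subfield {h a / h b | a b. h b \<noteq> 0} ring_of_type_algebra" (is "subfield ?E _")
proof -
  have I: "f \<in> ?E" if "f = h a / h b" "h b \<noteq> 0" for f a b using that by blast
  show ?thesis
    unfolding subfield_type_algebra_iff
  proof (intro conjI ballI)
    show "1 \<in> ?E" by (rule I[of _ 1 1]) (simp_all add: is_hom_simps[OF h])
  next
    fix f g assume "f \<in> ?E" "g \<in> ?E"
    then obtain a b c d where *: "f = h a / h b" "h b \<noteq> 0" "g = h c / h d" "h d \<noteq> 0" by blast
    show "f - g \<in> ?E"
      by (rule I[of _ "a * d - c * b" "b * d"]) (use * in \<open>simp_all add: is_hom_simps[OF h] diff_frac_eq\<close>)
    show "f * g \<in> ?E"
      by (rule I[of _ "a * c" "b * d"]) (use * in \<open>simp_all add: is_hom_simps[OF h]\<close>)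
  next
    fix f assume "f \<in> ?E"
    then obtain a b where *: "f = h a / h b" "h b \<noteq> 0" by blast
    show "inverse f \<in> ?E"
    proof (cases "h a = 0")
      case True
      then show ?thesis using * by (intro I[of _ 0 1]) (simp_all add: is_hom_simps[OF h])
    next
      case False
      then show ?thesis using * by (intro I[of _ b a]) simp_all
    qed
  qed
qed

text \<open>The quotients of values of \<open>ev3\<close> form a field containing x, y and t, hence
  the whole function field.\<close>

lemma fraction_field_of_rat_modular:
  "fraction_field_of (rat_poly3_ring Quot (Idl\<^bsub>rat_poly3_ring\<^esub> {curve_poly, cover_poly}))
     (mero_field\<lparr>carrier := rat_modular_functions 75\<rparr>)"
proof (rule fraction_field_of_quotient[OF is_hom_ev3 ev3_kernel])
  show K: "subfield (rat_modular_functions 75) mero_field" by (rule subfield_rat_modular) simp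
  note closed = subfield_closed[OF K] generators_rat_modular
  have 1: "ev1 p \<in> rat_modular_functions 75" for p
    by (induction p) (auto simp: ev_pCons intro!: closed)
  have 2: "ev2 p \<in> rat_modular_functions 75" for p
    by (induction p) (auto simp: ev_pCons intro!: closed 1)
  have "ev3 p \<in> rat_modular_functions 75" for p
    by (induction p) (auto simp: ev_pCons intro!: closed 2)
  then show "range ev3 \<subseteq> rat_modular_functions 75" by blast
  define E where "E = {ev3 a / ev3 b | a b. ev3 b \<noteq> 0}"
  have "ev3 a \<in> E" for a
    unfolding E_def by (rule CollectI, intro exI[of _ a] exI[of _ 1]) (simp add: is_hom_simps[OF is_hom_ev3])
  from this[of var_X] this[of var_Y] this[of var_T] have "{xX, yX, tX} \<subseteq> E"
    by (simp add: ev3_vars)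
  then have "rat_modular_functions 75 \<subseteq> E"
    unfolding rat_modular_generated using subfield_quotients[OF is_hom_ev3] unfolding E_def
    by (intro generate_field_subset)
  then show "\<exists>a b. ev3 b \<noteq> 0 \<and> f = ev3 a / ev3 b" if "f \<in> rat_modular_functions 75" for f
    using that unfolding E_def by blast
qed

theorem mainTheorem17:
  fixes K :: "mero set" and w :: "mero \<Rightarrow> mero" and X' Y' T' :: rat_poly3
  defines "K \<equiv> rat_modular_functions 75"
    and "w \<equiv> atkin_lehner 75 75"
    and "X' \<equiv> var_X" and "Y' \<equiv> var_Y" and "T' \<equiv> var_T"
  shows "(\<exists>x\<in>K. \<exists>y\<in>K. \<exists>t\<in>K.
            K = generate_field mero_field {x, y, t} \<and>
            {f \<in> K. w f = f} = generate_field mero_field {x, y} \<and>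
            w t = - t \<and>
            y^2 + x*y + y = x^3 + x^2 \<and>
            t^2 = - 99 - 390*x - 569*x^2 - 372*x^3 - 67*x^4 + 56*x^5 + 40*x^6 + 11*x^7 + x^8
                  - 3*x*(2 + x)*(- 2 - 4*x + 3*x^2 + 5*x^3 + 2*x^4)*y) \<and>
         fraction_field_of
           (rat_poly3_ring Quot (Idl\<^bsub>rat_poly3_ring\<^esub>
              {Y'^2 + X'*Y' + Y' - (X'^3 + X'^2),
               T'^2 - (- 99 - 390*X' - 569*X'^2 - 372*X'^3 - 67*X'^4 + 56*X'^5 + 40*X'^6 + 11*X'^7 + X'^8
                      - 3*X'*(2 + X')*(- 2 - 4*X' + 3*X'^2 + 5*X'^3 + 2*X'^4)*Y')}))
           (mero_field\<lparr>carrier := K\<rparr>)"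
proof -
  have mod: "f \<in> modular_functions 75" if "f \<in> rat_modular_functions 75" for f
    using that by (simp add: rat_modular_functions_def)
  have w: "w f = Fricke f" if "f \<in> K" for f
    using that mod by (simp add: K_def w_def atkin_lehner_75)
  have "{f \<in> K. w f = f} = {f \<in> rat_modular_functions 75. Fricke f = f}"
    using w by (auto simp: K_def)
  then have fixed: "{f \<in> K. w f = f} = generate_field mero_field {xX, yX}"
    by (simp only: Fricke_fixed_field)
  have wt: "w tX = - tX"
    using w[of tX] generators_rat_modular by (simp add: K_def Fricke_tX)
  show ?thesis
  proof (intro conjI bexI)
    show "K = generate_field mero_field {xX, yX, tX}"
      unfolding K_def by (rule rat_modular_generated)
    show "xX \<in> K" "yX \<in> K" "tX \<in> K"
      unfolding K_def by (fact generators_rat_modular)+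
    show "fraction_field_of
           (rat_poly3_ring Quot (Idl\<^bsub>rat_poly3_ring\<^esub>
              {Y'^2 + X'*Y' + Y' - (X'^3 + X'^2),
               T'^2 - (- 99 - 390*X' - 569*X'^2 - 372*X'^3 - 67*X'^4 + 56*X'^5 + 40*X'^6 + 11*X'^7 + X'^8
                      - 3*X'*(2 + X')*(- 2 - 4*X' + 3*X'^2 + 5*X'^3 + 2*X'^4)*Y')}))
           (mero_field\<lparr>carrier := K\<rparr>)"
      using fraction_field_of_rat_modular
      unfolding curve_poly_def cover_poly_def K_def X'_def Y'_def T'_def .
  qed (fact fixed wt curve_equation double_cover_equation)+
qed

end
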